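(* Let $\omega\subset\mathbb{R}^2$, $\psi_A\in H^3(\omega;\mathbb{R}^3)$, $f\in L^2(\omega;\mathbb{R}^3)$ and $\alpha>0$ be as in the context. Then, up to an additive constant (independent of $\psi_B$), the total free energy $$\frac{\alpha}{2}\int_\omega\sqrt{\det g_A}\,\operatorname{tr}\left(S^{\mathrm{rel}}_{\psi_B}S^{\mathrm{rel}}_{\psi_B}\right)\,\mathrm{d}x-\int_\omega\sqrt{\det g_A}\;f\cdot\psi_B\,\mathrm{d}x$$ can be rewritten, for every $\psi_B\in H^2(\omega;\mathbb{R}^3)$ with $(\nabla\psi_B)^\top\nabla\psi_B=(\nabla\psi_A)^\top\nabla\psi_A$ almost everywhere in $\omega$, as $$\frac{\alpha}{2}\int_\omega\sqrt{\det g_A}\left(\sum_{m=1}^{3}\left|g_A^{-\frac12}D^2\psi_B^m\,g_A^{-\frac12}\right|^2-2\,II_B:\left(g_A^{-1}II_A\,g_A^{-1}\right)\right)\mathrm{d}x-\int_\omega\sqrt{\det g_A}\;f\cdot\psi_B\,\mathrm{d}x .$$ That is, there is a constant $C\in\mathbb{R}$, not depending on $\psi_B$, such that the first expression equals the second plus $C$ for all such $\psi_B$.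
   Context: $\omega\subset\mathbb{R}^2$ is a bounded, connected Lipschitz domain, $\alpha>0$ is an elastic constant, $f\in L^2(\omega;\mathbb{R}^3)$. $\psi_A\in H^3(\omega;\mathbb{R}^3)$ is an injective regular parametrization: using $H^3(\omega)\hookrightarrow C^1(\overline{\omega})$, the matrix $\nabla\psi_A(x)\in\mathbb{R}^{3\times2}$ has rank $2$ for all $x\in\overline\omega$, so that $g_A:=(\nabla\psi_A)^\top\nabla\psi_A$ is symmetric positive definite with $g_A$, $g_A^{-1}$, $g_A^{-1/2}$ uniformly bounded; $g_A^{-1/2}$ is the symmetric positive definite square root of $g_A^{-1}$. For a parametrization $\psi$, the unit normal is $n[\psi]=\frac{\partial_1\psi\times\partial_2\psi}{|\partial_1\psi\times\partial_2\psi|}$; write $n_A=n[\psi_A]$, $n_B=n[\psi_B]$. The notation $D^2\psi\cdot n$ means the $2\times2$ matrix $(\partial_i\partial_j\psi\cdot n)_{i,j=1,2}$. The second fundamental forms are $II_A=-D^2\psi_A\cdot n_A$ and $II_B=-D^2\psi_B\cdot n_B$. The relative shape operator is $S^{\mathrm{rel}}_{\psi_B}:=g_A^{-1}(II_A-II_B)$. $D^2\psi_B^m$ is the $2\times 2$ Hessian of the $m$-th component of $\psi_B$, $X:Y=\sum_{i,j}X_{ij}Y_{ij}$, and $|X|^2=X:X$ is the squared Frobenius norm. *)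

theory Defs
  imports "HOL-Analysis.Analysis"
begin

subsection \<open>Lipschitz domains\<close>

text \<open>A nonempty bounded connected open subset of the plane which, near each of its boundary points
  and after a rigid motion \<open>x \<mapsto> Q (x - p)\<close>, is the strict epigraph of a Lipschitz function of
  one variable.\<close>

definition bounded_lipschitz_domain :: "(real^2) set \<Rightarrow> bool" where
  "bounded_lipschitz_domain \<omega> \<longleftrightarrow>
     open \<omega> \<and> connected \<omega> \<and> bounded \<omega> \<and> \<omega> \<noteq> {} \<and>
     (\<forall>p\<in>frontier \<omega>. \<exists>r>0. \<exists>Q :: real^2 \<Rightarrow> real^2. \<exists>L. \<exists>\<gamma>::real \<Rightarrow> real.
        orthogonal_transformation Q \<and> L-lipschitz_on UNIV \<gamma> \<and>
        \<omega> \<inter> ball p r = {x \<in> ball p r. \<gamma> (Q (x - p) $ 1) < Q (x - p) $ 2})"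

subsection \<open>Weak derivatives and Sobolev spaces\<close>

definition partial_deriv :: "'n \<Rightarrow> (real^'n \<Rightarrow> real) \<Rightarrow> real^'n \<Rightarrow> real" where
  "partial_deriv i \<phi> x = frechet_derivative \<phi> (at x) (axis i 1)"

text \<open>Higher derivatives are indexed by lists: \<open>[i, j]\<close> stands for \<open>\<partial>\<^sub>i \<partial>\<^sub>j\<close>.\<close>

definition partial_derivs :: "'n list \<Rightarrow> (real^'n \<Rightarrow> real) \<Rightarrow> real^'n \<Rightarrow> real" where
  "partial_derivs \<beta> \<phi> = foldr partial_deriv \<beta> \<phi>"

text \<open>The space of smooth functions with compact support in \<open>\<omega>\<close>. Differentiability of all
  iterated partial derivatives makes each of them continuous, so this is smoothness.\<close>

definition test_function :: "(real^'n) set \<Rightarrow> (real^'n \<Rightarrow> real) \<Rightarrow> bool" where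
  "test_function \<omega> \<phi> \<longleftrightarrow>
     (\<forall>\<beta> x. partial_derivs \<beta> \<phi> differentiable (at x)) \<and>
     compact (closure {x. \<phi> x \<noteq> 0}) \<and> closure {x. \<phi> x \<noteq> 0} \<subseteq> \<omega>"

definition locally_integrable :: "(real^'n) set \<Rightarrow> (real^'n \<Rightarrow> real) \<Rightarrow> bool" where
  "locally_integrable \<omega> u \<longleftrightarrow> (\<forall>K. compact K \<and> K \<subseteq> \<omega> \<longrightarrow> integrable (lebesgue_on K) u)"

definition has_weak_deriv ::
    "(real^'n) set \<Rightarrow> 'n list \<Rightarrow> (real^'n \<Rightarrow> real) \<Rightarrow> (real^'n \<Rightarrow> real) \<Rightarrow> bool" where
  "has_weak_deriv \<omega> \<beta> u v \<longleftrightarrow>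
     locally_integrable \<omega> u \<and> locally_integrable \<omega> v \<and>
     (\<forall>\<phi>. test_function \<omega> \<phi> \<longrightarrow>
        (LINT x|lebesgue_on \<omega>. u x * partial_derivs \<beta> \<phi> x) =
        (-1) ^ length \<beta> * (LINT x|lebesgue_on \<omega>. v x * \<phi> x))"

text \<open>Weak derivatives are only unique almost everywhere; we fix one representative.\<close>

definition weak_deriv :: "(real^'n) set \<Rightarrow> 'n list \<Rightarrow> (real^'n \<Rightarrow> real) \<Rightarrow> real^'n \<Rightarrow> real" where
  "weak_deriv \<omega> \<beta> u = (SOME v. has_weak_deriv \<omega> \<beta> u v)"

definition L2 :: "(real^'n) set \<Rightarrow> (real^'n \<Rightarrow> 'b::real_normed_vector) \<Rightarrow> bool" where
  "L2 \<omega> u \<longleftrightarrow> u \<in> borel_measurable (lebesgue_on \<omega>) \<and> integrable (lebesgue_on \<omega>) (\<lambda>x. (norm (u x))\<^sup>2)"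

text \<open>\<open>sobolev_H k \<omega> \<psi>\<close> is membership in the space \<open>H\<^sup>k(\<omega>; \<real>\<^sup>m)\<close> (componentwise).\<close>

definition sobolev_H :: "nat \<Rightarrow> (real^'n) set \<Rightarrow> (real^'n \<Rightarrow> real^'m) \<Rightarrow> bool" where
  "sobolev_H k \<omega> \<psi> \<longleftrightarrow> L2 \<omega> \<psi> \<and>
     (\<forall>m \<beta>. length \<beta> \<le> k \<longrightarrow> (\<exists>v. has_weak_deriv \<omega> \<beta> (\<lambda>x. \<psi> x $ m) v \<and> L2 \<omega> v))"

definition weak_deriv_vec :: "(real^'n) set \<Rightarrow> 'n list \<Rightarrow> (real^'n \<Rightarrow> real^'m) \<Rightarrow> real^'n \<Rightarrow> real^'m" where
  "weak_deriv_vec \<omega> \<beta> \<psi> x = (\<chi> m. weak_deriv \<omega> \<beta> (\<lambda>y. \<psi> y $ m) x)"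

subsection \<open>Parametrized surfaces\<close>

definition weak_jacobian :: "(real^2) set \<Rightarrow> (real^2 \<Rightarrow> real^3) \<Rightarrow> real^2 \<Rightarrow> real^2^3" where
  "weak_jacobian \<omega> \<psi> x = (\<chi> m i. weak_deriv_vec \<omega> [i] \<psi> x $ m)"

text \<open>\<open>\<Psi>\<close> belongs to \<open>C\<^sup>1(closure \<omega>)\<close>, and \<open>G\<close> is the continuous extension to the
  closure of its Jacobian matrix.\<close>

definition C1_closure :: "(real^2) set \<Rightarrow> (real^2 \<Rightarrow> real^3) \<Rightarrow> (real^2 \<Rightarrow> real^2^3) \<Rightarrow> bool" where
  "C1_closure \<omega> \<Psi> G \<longleftrightarrow>
     continuous_on (closure \<omega>) \<Psi> \<and> continuous_on (closure \<omega>) G \<and>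
     (\<forall>x\<in>\<omega>. (\<Psi> has_derivative (\<lambda>h. G x *v h)) (at x))"

text \<open>Elements of \<open>H\<^sup>3\<close> are defined up to null sets; injectivity and regularity refer to the
  representative in \<open>C\<^sup>1(closure \<omega>)\<close> provided by the Sobolev embedding.\<close>

definition injective_regular :: "(real^2) set \<Rightarrow> (real^2 \<Rightarrow> real^3) \<Rightarrow> bool" where
  "injective_regular \<omega> \<psi> \<longleftrightarrow>
     (\<exists>\<Psi> G. C1_closure \<omega> \<Psi> G \<and> (AE x in lebesgue_on \<omega>. \<psi> x = \<Psi> x) \<and>
        inj_on \<Psi> \<omega> \<and> (\<forall>x\<in>closure \<omega>. rank (G x) = 2))"

definition first_form :: "(real^2) set \<Rightarrow> (real^2 \<Rightarrow> real^3) \<Rightarrow> real^2 \<Rightarrow> real^2^2" where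
  "first_form \<omega> \<psi> x = transpose (weak_jacobian \<omega> \<psi> x) ** weak_jacobian \<omega> \<psi> x"

definition unit_normal :: "(real^2) set \<Rightarrow> (real^2 \<Rightarrow> real^3) \<Rightarrow> real^2 \<Rightarrow> real^3" where
  "unit_normal \<omega> \<psi> x =
     (let N = cross3 (weak_deriv_vec \<omega> [1] \<psi> x) (weak_deriv_vec \<omega> [2] \<psi> x) in N /\<^sub>R norm N)"

definition second_form :: "(real^2) set \<Rightarrow> (real^2 \<Rightarrow> real^3) \<Rightarrow> real^2 \<Rightarrow> real^2^2" where
  "second_form \<omega> \<psi> x = - (\<chi> i j. weak_deriv_vec \<omega> [i, j] \<psi> x \<bullet> unit_normal \<omega> \<psi> x)"

definition hessian :: "(real^2) set \<Rightarrow> (real^2 \<Rightarrow> real^3) \<Rightarrow> 3 \<Rightarrow> real^2 \<Rightarrow> real^2^2" where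
  "hessian \<omega> \<psi> m x = (\<chi> i j. weak_deriv_vec \<omega> [i, j] \<psi> x $ m)"

definition rel_shape ::
    "(real^2) set \<Rightarrow> (real^2 \<Rightarrow> real^3) \<Rightarrow> (real^2 \<Rightarrow> real^3) \<Rightarrow> real^2 \<Rightarrow> real^2^2" where
  "rel_shape \<omega> \<psi>A \<psi>B x =
     matrix_inv (first_form \<omega> \<psi>A x) ** (second_form \<omega> \<psi>A x - second_form \<omega> \<psi>B x)"

definition sym_pos_def :: "real^'n^'n \<Rightarrow> bool" where
  "sym_pos_def A \<longleftrightarrow> transpose A = A \<and> (\<forall>v. v \<noteq> 0 \<longrightarrow> v \<bullet> (A *v v) > 0)"

definition spd_sqrt :: "real^'n^'n \<Rightarrow> real^'n^'n" where
  "spd_sqrt A = (THE R. sym_pos_def R \<and> R ** R = A)"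

definition inv_sqrt :: "real^'n^'n \<Rightarrow> real^'n^'n" where
  "inv_sqrt A = spd_sqrt (matrix_inv A)"

text \<open>For matrices, the library's inner product \<open>X \<bullet> Y\<close> and \<open>norm X\<close> are the Frobenius inner
  product \<open>X : Y\<close> and the Frobenius norm.\<close>

definition free_energy :: "(real^2) set \<Rightarrow> real \<Rightarrow> (real^2 \<Rightarrow> real^3) \<Rightarrow> (real^2 \<Rightarrow> real^3) \<Rightarrow>
    (real^2 \<Rightarrow> real^3) \<Rightarrow> real" where
  "free_energy \<omega> \<alpha> f \<psi>A \<psi>B =
     \<alpha> / 2 * (LINT x|lebesgue_on \<omega>. sqrt (det (first_form \<omega> \<psi>A x)) *
        trace (rel_shape \<omega> \<psi>A \<psi>B x ** rel_shape \<omega> \<psi>A \<psi>B x))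
     - (LINT x|lebesgue_on \<omega>. sqrt (det (first_form \<omega> \<psi>A x)) * (f x \<bullet> \<psi>B x))"

end

theory Submission
  imports Defs
begin

text \<open>
  The two integrands differ pointwise by a function determined by \<open>\<psi>A\<close>. Let \<open>g\<close> be the common first
  fundamental form and \<open>J\<close> its inverse. Expanding the square,
  \<open>tr (S S) = tr (J II\<^sub>A J II\<^sub>A) - 2 II\<^sub>B : (J II\<^sub>A J) + tr (J II\<^sub>B J II\<^sub>B)\<close>
  (\<open>trace_difference_square\<close>). On the other hand, decomposing the vectors \<open>\<partial>\<^sub>i\<partial>\<^sub>j\<psi>B\<close> with
  respect to the tangent vectors and the normal shows that the Hessian term
  \<open>\<Sum>\<^sub>m |g\<^sup>-\<^sup>1\<^sup>/\<^sup>2 D\<^sup>2\<psi>B\<^sup>m g\<^sup>-\<^sup>1\<^sup>/\<^sup>2|\<^sup>2\<close> equals \<open>tr (J II\<^sub>B J II\<^sub>B)\<close> plus a tangential energy, which is a function of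
  \<open>J\<close> and of the products \<open>\<partial>\<^sub>i\<partial>\<^sub>j\<psi>B \<bullet> \<partial>\<^sub>k\<psi>B\<close> (\<open>hessian_trace_decomposition\<close>). These products are the
  Christoffel symbols of the first kind, combinations of first derivatives of \<open>g\<close>; hence they are the same for
  \<open>\<psi>A\<close> and every isometric \<open>\<psi>B\<close> (\<open>tangential_parts_determined\<close>), and so is the tangential energy.

  For Sobolev maps the computation of the Christoffel symbols rests on a product rule for the weak
  derivative of \<open>\<partial>\<^sub>a\<psi> \<bullet> \<partial>\<^sub>b\<psi>\<close>. Since \<open>g\<close> is bounded, so are the first derivatives, and it is enough to
  treat bounded functions with integrable weak derivatives (\<open>has_weak_deriv_mult\<close>). The product rule comes
  from doubling the variables with a kernel concentrated near the diagonal and from the continuity of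
  translations in \<open>L\<^sup>1\<close> (\<open>product_rule_lborel\<close>). Derivatives of \<open>g\<close> computed from \<open>\<psi>A\<close> and
  from \<open>\<psi>B\<close> are then compared by uniqueness of weak derivatives (\<open>weak_deriv_unique_AE\<close>), which
  also makes the arbitrarily chosen representatives square integrable.

  Finally, splitting the integral of the sum requires every term to be integrable. This is where
  regularity of \<open>\<psi>A\<close> enters: up to the boundary its Jacobian is continuous and of full rank, so \<open>g\<close> and
  \<open>J\<close> are bounded (\<open>regular_bounds\<close>), and all terms are products of two square integrable functions with
  bounded weights (\<open>integrable_weighted_trace\<close>).
\<close>

section \<open>Smooth functions and test functions\<close>

definition smooth :: "(real^'n \<Rightarrow> real) \<Rightarrow> bool" where
  "smooth f \<longleftrightarrow> (\<forall>\<beta> x. partial_derivs \<beta> f differentiable (at x))"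

lemma partial_derivs_Nil: "partial_derivs [] f = f"
  and partial_derivs_Cons: "partial_derivs (i # \<beta>) f = partial_deriv i (partial_derivs \<beta> f)"
  and partial_derivs_snoc: "partial_derivs (\<beta> @ [i]) f = partial_derivs \<beta> (partial_deriv i f)"
  by (simp_all add: partial_derivs_def)

lemma partial_deriv_unique:
  "(f has_derivative D) (at x) \<Longrightarrow> partial_deriv i f x = D (axis i 1)"
  by (simp add: partial_deriv_def frechet_derivative_at[symmetric])

text \<open>Membership in a family of differentiable functions that is closed under partial derivatives
  implies smoothness; the family stands in for an explicit description of all iterated derivatives.\<close>

lemma smooth_coinduct:
  assumes "f \<in> S" and "\<And>f x. f \<in> S \<Longrightarrow> f differentiable (at x)"
    and "\<And>f i. f \<in> S \<Longrightarrow> partial_deriv i f \<in> S"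
  shows "smooth f"
proof -
  have "partial_derivs \<beta> f \<in> S" for \<beta>
    by (induction \<beta>) (use assms in \<open>auto simp: partial_derivs_Nil partial_derivs_Cons\<close>)
  with assms(2) show ?thesis by (auto simp: smooth_def)
qed

lemma smooth_differentiable: "smooth f \<Longrightarrow> f differentiable (at x)"
  by (metis smooth_def partial_derivs_Nil)

lemma smooth_partial_deriv: "smooth f \<Longrightarrow> smooth (partial_deriv i f)"
  unfolding smooth_def partial_derivs_snoc[symmetric] by blast

lemma smooth_has_derivative:
  "smooth f \<Longrightarrow> (f has_derivative frechet_derivative f (at x)) (at x)"
  using frechet_derivative_works smooth_differentiable by blast

lemma smooth_continuous: "smooth f \<Longrightarrow> continuous_on S f"
  by (simp add: continuous_at_imp_continuous_on differentiable_imp_continuous_within smooth_differentiable)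

lemma partial_deriv_const: "partial_deriv i (\<lambda>x. c) = (\<lambda>x. 0)"
  by (rule ext, subst partial_deriv_unique) (auto intro: derivative_eq_intros)

lemma partial_deriv_add:
  assumes "\<And>x. f differentiable (at x)" "\<And>x. g differentiable (at x)"
  shows "partial_deriv i (\<lambda>x. f x + g x) = (\<lambda>x. partial_deriv i f x + partial_deriv i g x)"
  using assms
  by (intro ext, subst partial_deriv_unique[OF has_derivative_add])
    (auto simp: frechet_derivative_works partial_deriv_def)

lemma partial_deriv_mult:
  assumes "\<And>x. f differentiable (at x)" "\<And>x. g differentiable (at x)"
  shows "partial_deriv i (\<lambda>x. f x * g x) = (\<lambda>x. f x * partial_deriv i g x + partial_deriv i f x * g x)"
  using assms
  by (intro ext, subst partial_deriv_unique[OF has_derivative_mult])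
    (auto simp: frechet_derivative_works partial_deriv_def)

lemma smooth_const: "smooth (\<lambda>x. c)"
  by (rule smooth_coinduct[where S = "range (\<lambda>c x. c)"]) (auto simp: partial_deriv_const)

text \<open>Products alone are not closed under partial derivatives, because the product rule produces sums.
  Closing up under both operations gives a family to which the coinduction rule applies.\<close>

inductive smooth_algebra :: "(real^'n \<Rightarrow> real) \<Rightarrow> bool" where
  gen: "smooth f \<Longrightarrow> smooth_algebra f"
| add: "smooth_algebra f \<Longrightarrow> smooth_algebra g \<Longrightarrow> smooth_algebra (\<lambda>x. f x + g x)"
| mult: "smooth_algebra f \<Longrightarrow> smooth_algebra g \<Longrightarrow> smooth_algebra (\<lambda>x. f x * g x)"

lemma smooth_algebra_differentiable: "smooth_algebra f \<Longrightarrow> f differentiable (at x)"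
  by (induction rule: smooth_algebra.induct) (auto intro: smooth_differentiable)

lemma smooth_algebra_partial_deriv: "smooth_algebra f \<Longrightarrow> smooth_algebra (partial_deriv i f)"
proof (induction rule: smooth_algebra.induct)
  case (gen f) then show ?case by (blast intro: smooth_algebra.gen smooth_partial_deriv)
next
  case (add f g)
  then show ?case
    by (simp add: partial_deriv_add smooth_algebra_differentiable smooth_algebra.add)
next
  case (mult f g)
  then show ?case
    by (simp add: partial_deriv_mult smooth_algebra_differentiable smooth_algebra.add smooth_algebra.mult)
qed

lemma smooth_algebra_smooth: "smooth_algebra f \<Longrightarrow> smooth f"
  by (rule smooth_coinduct[where S = "Collect smooth_algebra"])
    (simp_all add: smooth_algebra_differentiable smooth_algebra_partial_deriv)

lemma smooth_mult: "smooth f \<Longrightarrow> smooth g \<Longrightarrow> smooth (\<lambda>x. f x * g x)"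
  by (rule smooth_algebra_smooth) (rule smooth_algebra.mult; rule smooth_algebra.gen; assumption)

lemma smooth_prod: "finite I \<Longrightarrow> (\<And>i. i \<in> I \<Longrightarrow> smooth (f i)) \<Longrightarrow> smooth (\<lambda>x. \<Prod>i\<in>I. f i x)"
  by (induction I rule: finite_induct) (simp_all add: smooth_const smooth_mult)

lemma partial_deriv_translate:
  assumes "f differentiable (at (x - a))"
  shows "partial_deriv i (\<lambda>x. f (x - a)) x = partial_deriv i f (x - a)"
proof -
  have "((\<lambda>x. x - a) has_derivative (\<lambda>h. h)) (at x)" by (auto intro!: derivative_eq_intros)
  moreover have "(f has_derivative frechet_derivative f (at (x - a))) (at (x - a))"
    using assms frechet_derivative_works by blast
  ultimately have "((\<lambda>x. f (x - a)) has_derivative (\<lambda>h. frechet_derivative f (at (x - a)) h)) (at x)"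
    by (rule has_derivative_compose)
  from partial_deriv_unique[OF this] show ?thesis by (simp add: partial_deriv_def)
qed

lemma smooth_translate:
  fixes f :: "real^'n \<Rightarrow> real"
  assumes "smooth f" shows "smooth (\<lambda>x. f (x - a))"
proof (rule smooth_coinduct[where S = "(\<lambda>f x. f (x - a)) ` Collect smooth"])
  fix g :: "real^'n \<Rightarrow> real" and x i
  assume "g \<in> (\<lambda>f x. f (x - a)) ` Collect smooth"
  then obtain f where f: "smooth f" "g = (\<lambda>x. f (x - a))" by auto
  have "((\<lambda>x. x - a) has_derivative (\<lambda>h. h)) (at x)" by (auto intro!: derivative_eq_intros)
  from has_derivative_compose[OF this smooth_has_derivative[OF f(1)]]
  show "g differentiable (at x)" by (auto simp: f differentiable_def)
  show "partial_deriv i g \<in> (\<lambda>f x. f (x - a)) ` Collect smooth"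
    using f by (auto intro!: image_eqI[where x = "partial_deriv i f"]
        simp: smooth_partial_deriv partial_deriv_translate smooth_differentiable)
qed (use assms in auto)

text \<open>\<open>flat 1\<close> is the standard function \<open>exp (- 1 / t)\<close>, which vanishes to infinite order at \<open>0\<close>.
  The polynomial in \<open>1 / t\<close> is there because differentiation creates such factors.\<close>

definition flat :: "real poly \<Rightarrow> real \<Rightarrow> real" where
  "flat p t = (if t > 0 then poly p (inverse t) * exp (- inverse t) else 0)"

lemma poly_times_exp_minus_tendsto_0:
  "((\<lambda>s::real. poly p s * exp (- s)) \<longlongrightarrow> 0) at_top"
proof (induction p)
  case 0 then show ?case by simp
next
  have pow: "((\<lambda>s::real. s ^ n * exp (- s)) \<longlongrightarrow> 0) at_top" for n
    using tendsto_power_div_exp_0[of n] by (simp add: exp_minus divide_inverse)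
  case (pCons a p)
  \<comment> \<open>An additional power of the variable makes the claim strong enough for the induction on the polynomial.\<close>
  have *: "((\<lambda>s::real. s ^ k * (poly q s * exp (- s))) \<longlongrightarrow> 0) at_top" for k q
  proof (induction q arbitrary: k)
    case 0 then show ?case by simp
  next
    case (pCons b q)
    have "((\<lambda>s. b * (s ^ k * exp (- s)) + s ^ Suc k * (poly q s * exp (- s))) \<longlongrightarrow> b * 0 + 0) at_top"
      by (intro tendsto_intros pow pCons)
    then show ?case by (simp add: algebra_simps)
  qed
  from *[of 0 "pCons a p"] show ?case by simp
qed

text \<open>For \<open>t > 0\<close> and \<open>s = 1 / t\<close>, the derivative of \<open>p(s) exp(-s)\<close> with respect to \<open>t\<close> is
  \<open>s\<^sup>2 (p(s) - p'(s)) exp(-s)\<close>. At \<open>t = 0\<close> the exponential decay beats the polynomial, so the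
  difference quotients tend to \<open>0\<close>.\<close>

lemma flat_has_derivative:
  "(flat p has_real_derivative flat ([:0,0,1:] * (p - pderiv p)) t) (at t)"
proof -
  consider "t > 0" | "t < 0" | "t = 0" by linarith
  then show ?thesis
  proof cases
    case 1
    have "((\<lambda>t. poly p (inverse t) * exp (- inverse t)) has_real_derivative
        flat ([:0,0,1:] * (p - pderiv p)) t) (at t)"
      using 1 by (auto intro!: derivative_eq_intros poly_DERIV[THEN DERIV_chain2]
          simp: flat_def power2_eq_square algebra_simps)
    then show ?thesis
      by (rule has_field_derivative_transform_within_open[where S = "{0<..}"])
        (use 1 in \<open>auto simp: flat_def\<close>)
  next
    case 2
    have "((\<lambda>t. 0) has_real_derivative 0) (at t)" by simp
    then have "(flat p has_real_derivative 0) (at t)"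
      by (rule has_field_derivative_transform_within_open[where S = "{..<0}"])
        (use 2 in \<open>auto simp: flat_def\<close>)
    then show ?thesis using 2 by (simp add: flat_def)
  next
    case 3
    have "((\<lambda>h. (flat p (0 + h) - flat p 0) / h) \<longlongrightarrow> 0) (at 0)"
    proof (rule filterlim_split_at)
      have "\<forall>\<^sub>F h in at_left 0. 0 = (flat p (0 + h) - flat p 0) / h"
        by (auto simp: eventually_at flat_def intro!: exI[of _ 1])
      then show "((\<lambda>h. (flat p (0 + h) - flat p 0) / h) \<longlongrightarrow> 0) (at_left 0)"
        by (rule Lim_transform_eventually[rotated]) simp
    next
      have "((\<lambda>h. poly ([:0,1:] * p) (inverse h) * exp (- inverse h)) \<longlongrightarrow> 0) (at_right (0::real))"
        by (rule filterlim_compose[OF poly_times_exp_minus_tendsto_0 filterlim_inverse_at_top_right])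
      moreover have "\<forall>\<^sub>F h in at_right 0. poly ([:0,1:] * p) (inverse h) * exp (- inverse h)
          = (flat p (0 + h) - flat p 0) / h"
        by (auto simp: eventually_at flat_def field_simps intro!: exI[of _ 1])
      ultimately show "((\<lambda>h. (flat p (0 + h) - flat p 0) / h) \<longlongrightarrow> 0) (at_right 0)"
        by (rule Lim_transform_eventually)
    qed
    then show ?thesis using 3 by (simp add: DERIV_def flat_def)
  qed
qed

lemma flat_affine_partial_deriv:
  "((\<lambda>x::real^'n. flat p (c * x $ i + d)) has_derivative
    (\<lambda>h. c * h $ i * flat ([:0,0,1:] * (p - pderiv p)) (c * x $ i + d))) (at x)"
proof -
  have "((\<lambda>x::real^'n. c * x $ i + d) has_derivative (\<lambda>h. c * h $ i)) (at x)"
    by (auto intro!: derivative_eq_intros bounded_linear.has_derivative[OF bounded_linear_vec_nth])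
  from has_derivative_compose[OF this flat_has_derivative[unfolded has_field_derivative_def]]
  show ?thesis by (simp add: algebra_simps)
qed

lemma smooth_flat_affine: "smooth (\<lambda>x::real^'n. flat p (c * x $ i + d))"
proof (rule smooth_coinduct[where S = "range (\<lambda>(k,p) x. k * flat p (c * x $ i + d))"])
  show "(\<lambda>x. flat p (c * x $ i + d)) \<in> range (\<lambda>(k,p) x. k * flat p (c * x $ i + d))"
    by (auto intro!: image_eqI[where x = "(1,p)"])
next
  fix g :: "real^'n \<Rightarrow> real" and x j
  assume "g \<in> range (\<lambda>(k,p) x. k * flat p (c * x $ i + d))"
  then obtain k p where g: "g = (\<lambda>x. k * flat p (c * x $ i + d))" by auto
  have D: "(g has_derivative (\<lambda>h. k * (c * h $ i * flat ([:0,0,1:] * (p - pderiv p)) (c * x $ i + d)))) (at x)" for x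
    unfolding g by (intro has_derivative_mult_right flat_affine_partial_deriv)
  then show "g differentiable (at x)" by (auto simp: differentiable_def)
  show "partial_deriv j g \<in> range (\<lambda>(k,p) x. k * flat p (c * x $ i + d))"
    by (rule image_eqI[where x = "(k * c * axis j 1 $ i, [:0,0,1:] * (p - pderiv p))"])
      (auto simp: partial_deriv_unique[OF D])
qed

text \<open>A smooth function whose set of nonzero values is the open box from \<open>a\<close> to \<open>b\<close>. Since
  \<open>exp (- 1 / (c t))\<close> tends to \<open>1\<close> as \<open>c\<close> grows, it approximates the indicator function of the box
  from below. It is a product of functions of one coordinate each.\<close>

definition box_bump :: "real \<Rightarrow> real^'n \<Rightarrow> real^'n \<Rightarrow> real^'n \<Rightarrow> real" where
  "box_bump c a b x = (\<Prod>i\<in>UNIV. flat 1 (c * (x $ i - a $ i)) * flat 1 (c * (b $ i - x $ i)))"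

lemma smooth_box_bump: "smooth (box_bump c a b)"
proof -
  have "smooth (\<lambda>x. \<Prod>i\<in>UNIV. flat 1 (c * x $ i + (- c * a $ i)) * flat 1 ((-c) * x $ i + c * b $ i))"
    by (intro smooth_prod smooth_mult smooth_flat_affine) auto
  moreover have "(\<lambda>x. \<Prod>i\<in>UNIV. flat 1 (c * x $ i + (- c * a $ i)) * flat 1 ((-c) * x $ i + c * b $ i)) = box_bump c a b"
    by (simp add: box_bump_def algebra_simps fun_eq_iff)
  ultimately show ?thesis by simp
qed

lemma flat_1: "flat 1 t = (if t > 0 then exp (- inverse t) else 0)"
  by (simp add: flat_def)

lemma flat_1_bounds: "0 \<le> flat 1 t" "flat 1 t \<le> 1"
  by (auto simp: flat_1)

lemma box_bump_bounds: "0 \<le> box_bump c a b x" "box_bump c a b x \<le> 1"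
  unfolding box_bump_def
  by (auto intro!: prod_nonneg prod_le_1 mult_nonneg_nonneg mult_le_one simp: flat_1_bounds)

lemma box_bump_support: "c > 0 \<Longrightarrow> box_bump c a b x \<noteq> 0 \<longleftrightarrow> x \<in> box a b"
  by (auto simp: box_bump_def flat_1 mem_box_cart zero_less_mult_iff)

lemma box_bump_tendsto_indicator:
  "(\<lambda>n. box_bump (real (Suc n)) a b x) \<longlonglongrightarrow> indicator (box a b) x"
proof (cases "x \<in> box a b")
  case False
  then show ?thesis using box_bump_support[of "real (Suc _)" a b x] by auto
next
  case True
  have f1: "(\<lambda>n. flat 1 (real (Suc n) * s)) \<longlonglongrightarrow> 1" if "s > 0" for s
  proof -
    have "(\<lambda>n. exp (- (inverse (real (Suc n)) * inverse s))) \<longlonglongrightarrow> exp (- (0 * inverse s))"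
      by (intro tendsto_intros LIMSEQ_inverse_real_of_nat)
    then show ?thesis using that by (simp add: flat_1 inverse_mult_distrib)
  qed
  have "(\<lambda>n. box_bump (real (Suc n)) a b x) \<longlonglongrightarrow> (\<Prod>i\<in>(UNIV::'a set). 1 * 1)"
    unfolding box_bump_def
    by (intro tendsto_prod tendsto_mult f1) (use True in \<open>auto simp: mem_box_cart\<close>)
  then show ?thesis using True by simp
qed

lemma test_function_box_bump:
  assumes "c > 0" "cbox a b \<subseteq> \<omega>"
  shows "test_function \<omega> (box_bump c a b)"
proof -
  have "closure {x. box_bump c a b x \<noteq> 0} \<subseteq> cbox a b"
    using assms by (intro closure_minimal) (auto simp: box_bump_support box_subset_cbox[THEN subsetD])
  moreover from this have "compact (closure {x. box_bump c a b x \<noteq> 0})"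
    using bounded_subset compact_cbox compact_imp_bounded compact_eq_bounded_closed by (metis closed_closure)
  ultimately show ?thesis using assms smooth_box_bump[of c a b]
    by (auto simp: test_function_def smooth_def)
qed

lemma test_function_smooth: "test_function \<omega> \<phi> \<Longrightarrow> smooth \<phi>"
  by (simp add: test_function_def smooth_def)

lemma test_functionI:
  assumes "smooth \<phi>" "compact K" "K \<subseteq> \<omega>" "\<And>x. x \<notin> K \<Longrightarrow> \<phi> x = 0"
  shows "test_function \<omega> \<phi>"
proof -
  have "closure {x. \<phi> x \<noteq> 0} \<subseteq> K"
    using assms by (intro closure_minimal) (auto simp: compact_imp_closed)
  moreover from this have "compact (closure {x. \<phi> x \<noteq> 0})"
    using assms(2) bounded_subset compact_eq_bounded_closed by (metis closed_closure)
  ultimately show ?thesis using assms by (auto simp: test_function_def smooth_def)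
qed

lemma partial_deriv_eq_0_outside:
  assumes "closed K" "\<And>x. x \<notin> K \<Longrightarrow> \<phi> x = 0" "x \<notin> K"
  shows "partial_deriv i \<phi> x = 0"
proof -
  have "((\<lambda>x. 0) has_derivative (\<lambda>h. 0)) (at x)" by simp
  then have "(\<phi> has_derivative (\<lambda>h. 0)) (at x)"
    by (rule has_derivative_transform_within_open[where s = "- K"]) (use assms in auto)
  from partial_deriv_unique[OF this] show ?thesis by simp
qed

lemma test_function_support:
  assumes "test_function \<omega> \<phi>"
  shows "\<exists>K. compact K \<and> K \<subseteq> \<omega> \<and> (\<forall>x. x \<notin> K \<longrightarrow> \<phi> x = 0 \<and> (\<forall>i. partial_deriv i \<phi> x = 0))"
proof -
  define K where "K = closure {x. \<phi> x \<noteq> 0}"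
  have "{x. \<phi> x \<noteq> 0} \<subseteq> K" unfolding K_def by (rule closure_subset)
  then have 0: "\<phi> x = 0" if "x \<notin> K" for x using that by blast
  have "partial_deriv i \<phi> x = 0" if "x \<notin> K" for x i
    by (rule partial_deriv_eq_0_outside[of K, OF _ 0 that]) (simp_all add: K_def)
  moreover have "compact K" "K \<subseteq> \<omega>" using assms by (simp_all add: test_function_def K_def)
  ultimately show ?thesis using 0 by blast
qed

lemma test_function_partial_deriv:
  assumes "test_function \<omega> \<phi>" shows "test_function \<omega> (partial_deriv i \<phi>)"
proof -
  obtain K where "compact K" "K \<subseteq> \<omega>" "\<forall>x. x \<notin> K \<longrightarrow> \<phi> x = 0 \<and> (\<forall>i. partial_deriv i \<phi> x = 0)"
    using test_function_support[OF assms] by blast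
  then show ?thesis
    using test_functionI[OF smooth_partial_deriv[OF test_function_smooth[OF assms]], of K \<omega> i] by simp
qed

lemma test_function_mult:
  assumes "test_function \<omega> \<phi>" "smooth k" shows "test_function \<omega> (\<lambda>x. k x * \<phi> x)"
proof -
  obtain K where "compact K" "K \<subseteq> \<omega>" "\<forall>x. x \<notin> K \<longrightarrow> \<phi> x = 0 \<and> (\<forall>i. partial_deriv i \<phi> x = 0)"
    using test_function_support[OF assms(1)] by blast
  then show ?thesis
    using test_functionI[OF smooth_mult[OF assms(2) test_function_smooth[OF assms(1)]], of K \<omega>] by simp
qed

section \<open>Uniqueness of weak derivatives\<close>

lemma lborel_representative:
  fixes q :: "'a::euclidean_space \<Rightarrow> real"
  assumes "q \<in> borel_measurable lebesgue"
  shows "\<exists>q'\<in>borel_measurable borel. AE x in lebesgue. q x = q' x"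
  using completion_ex_borel_measurable_real[OF assms] by (auto intro: AE_completion)

lemma borel_measurable_indicator_box:
  "(indicator (box a b) :: 'a::euclidean_space \<Rightarrow> real) \<in> borel_measurable lebesgue"
  by (intro measurable_completion) auto

text \<open>The Borel sets over which \<open>q\<close> has integral zero form a Dynkin system, and the open boxes are an
  intersection-stable generator of the Borel sets.\<close>

lemma box_integrals_zero_imp_AE_zero_lborel:
  fixes q :: "'a::euclidean_space \<Rightarrow> real"
  assumes q: "integrable lborel q"
    and box0: "\<And>a b. (LINT x:box a b|lborel. q x) = 0"
  shows "AE x in lborel. q x = 0"
proof (rule sigma_finite_measure.density_zero[OF sigma_finite_lborel q])
  let ?E = "range (\<lambda>(a, b). box a b::'a set)"
  have si: "set_integrable lborel A q" if "A \<in> sets borel" for A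
    unfolding set_integrable_def using that by (intro integrable_mult_indicator q) simp
  \<comment> \<open>The whole space is needed for complements; it is exhausted by boxes.\<close>
  let ?A = "\<lambda>n::nat. box (- (real n *\<^sub>R One)) (real n *\<^sub>R One) :: 'a set"
  have "(\<lambda>n. LINT x:?A n|lborel. q x) \<longlonglongrightarrow> (LINT x:(\<Union>n. ?A n)|lborel. q x)"
  proof (rule set_integral_cont_up)
    show "incseq ?A"
    proof (rule incseq_SucI)
      show "?A n \<subseteq> ?A (Suc n)" for n by (rule subset_box_imp(4)) auto
    qed
  qed (auto intro!: si)
  then have "(LINT x:UNIV|lborel. q x) = 0"
    unfolding UN_box_eq_UNIV box0 using LIMSEQ_unique tendsto_const by blast
  fix A :: "'a set" assume "A \<in> sets lborel"
  then have A: "A \<in> sigma_sets UNIV ?E" by (simp add: borel_eq_box)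
  have sb: "X \<in> sets borel" if "X \<in> sigma_sets UNIV ?E" for X
    using that by (simp add: borel_eq_box)
  have "Int_stable ?E" by (auto simp: Int_stable_def box_Int_box)
  moreover have "?E \<subseteq> Pow UNIV" by simp
  ultimately show "(LINT x:A|lborel. q x) = 0" using A
  proof (induction rule: sigma_sets_induct_disjoint)
    case empty then show ?case by (simp add: set_lebesgue_integral_def)
  next
    case (compl A)
    have "(LINT x:A \<union> (UNIV - A)|lborel. q x) = (LINT x:A|lborel. q x) + (LINT x:UNIV - A|lborel. q x)"
      using sb[OF compl(1)] by (intro set_integral_Un si) auto
    then show ?case using compl \<open>(LINT x:UNIV|lborel. q x) = 0\<close> by (simp add: Compl_partition)
  next
    case (union A)
    have A: "A i \<in> sets borel" for i using union(2) by (intro sb) auto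
    have "(LINT x:(\<Union>i. A i)|lborel. q x) = (\<Sum>i. LINT x:A i|lborel. q x)"
      using union(1) A by (intro lebesgue_integral_countable_add si sets.countable_UN)
        (auto simp: disjoint_family_on_def)
    then show ?case using union by simp
  qed (auto simp: box0)
qed

lemma box_integrals_zero_imp_AE_zero:
  fixes q :: "'a::euclidean_space \<Rightarrow> real"
  assumes q: "integrable lebesgue q"
    and box0: "\<And>a b. (LINT x:box a b|lebesgue. q x) = 0"
  shows "AE x in lebesgue. q x = 0"
proof -
  obtain q' where q': "q' \<in> borel_measurable borel" and eq: "AE x in lebesgue. q x = q' x"
    using lborel_representative[of q] q by auto
  have "integrable lebesgue q'"
    by (rule integrable_cong_AE_imp[OF q _ eq]) (use q' in \<open>auto intro: measurable_completion\<close>)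
  then have "integrable lborel q'" using q' by (subst (asm) integrable_completion) auto
  moreover have "(LINT x:box a b|lborel. q' x) = 0" for a b
  proof -
    have "(LINT x:box a b|lborel. q' x) = (LINT x:box a b|lebesgue. q' x)"
      unfolding set_lebesgue_integral_def using q' by (subst integral_completion) auto
    also have "\<dots> = (LINT x:box a b|lebesgue. q x)"
      unfolding set_lebesgue_integral_def
      using borel_measurable_integrable[OF q] borel_measurable_integrable[OF \<open>integrable lebesgue q'\<close>] 
      by (intro integral_cong_AE borel_measurable_scaleR borel_measurable_indicator_box)
        (use eq in auto)
    finally show ?thesis using box0 by simp
  qed
  ultimately have "AE x in lborel. q' x = 0" by (rule box_integrals_zero_imp_AE_zero_lborel)
  then have "AE x in lebesgue. q' x = 0" by (rule AE_completion)
  with eq show ?thesis by eventually_elim simp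
qed

lemma locally_integrable_restrict:
  assumes "locally_integrable \<omega> v" "compact K" "K \<subseteq> \<omega>"
  shows "integrable lebesgue (\<lambda>x. if x \<in> K then v x else 0)"
proof -
  have "K \<in> sets lebesgue" using assms(2) by (simp add: lmeasurable_compact fmeasurableD)
  from Lebesgue_Measure.integrable_restrict_UNIV[OF this, of v] show ?thesis
    using assms by (simp add: locally_integrable_def)
qed

lemma integrable_mult_bounded:
  fixes f g :: "'a \<Rightarrow> real"
  assumes "integrable M f" "g \<in> borel_measurable M" "\<And>x. \<bar>g x\<bar> \<le> B"
  shows "integrable M (\<lambda>x. f x * g x)"
proof (rule Bochner_Integration.integrable_bound)
  show "integrable M (\<lambda>x. B * f x)" using assms by simp
  show "(\<lambda>x. f x * g x) \<in> borel_measurable M" using assms by measurable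
  have "B \<ge> 0" using assms(3) abs_ge_zero order_trans by blast
  then show "AE x in M. norm (f x * g x) \<le> norm (B * f x)"
    using assms(3) by (auto simp: abs_mult mult.commute[of B] intro!: mult_left_mono)
qed

lemma continuous_compact_support_bounded:
  fixes \<phi> :: "'a::topological_space \<Rightarrow> real"
  assumes "continuous_on UNIV \<phi>" "compact K" "\<And>x. x \<notin> K \<Longrightarrow> \<phi> x = 0"
  shows "\<exists>B. \<forall>x. \<bar>\<phi> x\<bar> \<le> B"
proof -
  have "bounded (\<phi> ` K)"
    using assms(2) continuous_on_subset[OF assms(1) subset_UNIV, of K]
    by (intro compact_imp_bounded compact_continuous_image)
  then obtain B where "\<And>x. x \<in> K \<Longrightarrow> \<bar>\<phi> x\<bar> \<le> B" by (auto simp: bounded_iff)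
  then have "\<bar>\<phi> x\<bar> \<le> max B 0" for x using assms(3)[of x] by (cases "x \<in> K") fastforce+
  then show ?thesis by blast
qed

lemma locally_integrable_mult:
  fixes \<phi> :: "real^'n \<Rightarrow> real"
  assumes v: "locally_integrable \<omega> v" and "open \<omega>" and K: "compact K" "K \<subseteq> \<omega>"
    and \<phi>: "continuous_on UNIV \<phi>" "\<And>x. x \<notin> K \<Longrightarrow> \<phi> x = 0"
  shows "integrable (lebesgue_on \<omega>) (\<lambda>x. v x * \<phi> x)"
    and "(LINT x|lebesgue_on \<omega>. v x * \<phi> x) = (LINT x|lebesgue. (if x \<in> K then v x else 0) * \<phi> x)"
proof -
  have \<omega>: "\<omega> \<in> sets lebesgue" using \<open>open \<omega>\<close> by auto
  have eq: "(\<lambda>x. if x \<in> \<omega> then v x * \<phi> x else 0) = (\<lambda>x. (if x \<in> K then v x else 0) * \<phi> x)"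
  proof
    fix x show "(if x \<in> \<omega> then v x * \<phi> x else 0) = (if x \<in> K then v x else 0) * \<phi> x"
      using K(2) \<phi>(2)[of x] by (cases "x \<in> K") auto
  qed
  obtain B where "\<And>x. \<bar>\<phi> x\<bar> \<le> B" using continuous_compact_support_bounded[OF \<phi>(1) K(1) \<phi>(2)] by blast
  then have "integrable lebesgue (\<lambda>x. (if x \<in> K then v x else 0) * \<phi> x)"
    using \<phi>(1) by (intro integrable_mult_bounded locally_integrable_restrict[OF v K])
      (auto intro!: measurable_completion borel_measurable_continuous_onI)
  then show "integrable (lebesgue_on \<omega>) (\<lambda>x. v x * \<phi> x)"
    using Lebesgue_Measure.integrable_restrict_UNIV[OF \<omega>, of "\<lambda>x. v x * \<phi> x"] by (simp add: eq)
  show "(LINT x|lebesgue_on \<omega>. v x * \<phi> x) = (LINT x|lebesgue. (if x \<in> K then v x else 0) * \<phi> x)"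
    using Lebesgue_Measure.integral_restrict_UNIV[OF \<omega>, of "\<lambda>x. v x * \<phi> x"] by (simp add: eq)
qed

text \<open>The fundamental lemma of the calculus of variations. The bumps converge boundedly to the indicator
  function of a box, so \<open>v\<close> has integral zero over every box whose closure lies in \<open>\<omega>\<close>. The
  hypothesis concerns bumps only, whose mixed partial derivatives can be computed explicitly.\<close>

lemma fundamental_lemma_of_variations:
  fixes v :: "real^'n \<Rightarrow> real"
  assumes "open \<omega>" and v: "locally_integrable \<omega> v"
    and bump0: "\<And>n a b. cbox a b \<subseteq> \<omega> \<Longrightarrow> (LINT x|lebesgue_on \<omega>. v x * box_bump (real (Suc n)) a b x) = 0"
  shows "AE x in lebesgue_on \<omega>. v x = 0"
proof -
  have box0: "(LINT x:box a b|lebesgue. (if x \<in> cbox a b then v x else 0)) = 0" if ab: "cbox a b \<subseteq> \<omega>" for a b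
  proof -
    let ?q = "\<lambda>x. if x \<in> cbox a b then v x else 0"
    have q: "integrable lebesgue ?q" by (intro locally_integrable_restrict[OF v] compact_cbox ab)
    have out: "box_bump (real (Suc n)) a b x = 0" if "x \<notin> cbox a b" for n x
      using that box_bump_support[of "real (Suc n)" a b x] box_subset_cbox[of a b] by auto
    have "(\<lambda>n. LINT x|lebesgue. ?q x * box_bump (real (Suc n)) a b x) \<longlonglongrightarrow> (LINT x|lebesgue. ?q x * indicator (box a b) x)"
    proof (rule integral_dominated_convergence[where w = "\<lambda>x. norm (?q x)"])
      show "AE x in lebesgue. (\<lambda>n. ?q x * box_bump (real (Suc n)) a b x) \<longlonglongrightarrow> ?q x * indicator (box a b) x"
        by (intro AE_I2 tendsto_mult tendsto_const box_bump_tendsto_indicator)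
      show "AE x in lebesgue. norm (?q x * box_bump (real (Suc n)) a b x) \<le> norm (?q x)" for n
        using box_bump_bounds[of "real (Suc n)" a b]
        by (intro AE_I2) (auto simp: abs_mult intro!: mult_left_le)
      have "box_bump (real (Suc n)) a b \<in> borel_measurable borel" for n
        by (intro borel_measurable_continuous_onI smooth_continuous smooth_box_bump)
      then show "(\<lambda>x. ?q x * box_bump (real (Suc n)) a b x) \<in> borel_measurable lebesgue" for n
        using q by (intro borel_measurable_times) (auto intro: measurable_completion)
      show "(\<lambda>x. ?q x * indicator (box a b) x) \<in> borel_measurable lebesgue"
        using q by (intro borel_measurable_times borel_measurable_indicator_box) auto
    qed (use q in auto)
    moreover have "(LINT x|lebesgue. ?q x * box_bump (real (Suc n)) a b x) = 0" for n
      using bump0[OF ab, of n] locally_integrable_mult(2)[OF v \<open>open \<omega>\<close> compact_cbox ab, of "box_bump (real (Suc n)) a b"] out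
      by (simp add: smooth_continuous smooth_box_bump)
    ultimately show ?thesis
      by (simp add: LIMSEQ_const_iff set_lebesgue_integral_def mult.commute)
  qed
  \<comment> \<open>Subboxes of a fixed box show that the function vanishes in it; countably many boxes cover the domain.\<close>
  have ae: "AE x in lebesgue. x \<in> cbox a b \<longrightarrow> v x = 0" if ab: "cbox a b \<subseteq> \<omega>" for a b
  proof -
    let ?q = "\<lambda>x. if x \<in> cbox a b then v x else 0"
    have q: "integrable lebesgue ?q" by (intro locally_integrable_restrict[OF v] compact_cbox ab)
    have "AE x in lebesgue. ?q x * indicator (box a b) x = 0"
    proof (rule box_integrals_zero_imp_AE_zero)
      show "integrable lebesgue (\<lambda>x. ?q x * indicator (box a b) x)"
        by (rule integrable_mult_bounded[OF q, of _ 1]) (rule borel_measurable_indicator_box, simp add: indicator_def)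
      fix c d
      obtain c' d' where cd: "box c d \<inter> box a b = box c' d'" using box_Int_box[of c d a b] by blast
      show "(LINT x:box c d|lebesgue. ?q x * indicator (box a b) x) = 0"
      proof (cases "box c' d' = {}")
        case True
        then have "(\<lambda>x. indicat_real (box c d) x *\<^sub>R (?q x * indicator (box a b) x)) = (\<lambda>x. 0)"
          using cd by (auto simp: indicator_def fun_eq_iff)
        then show ?thesis by (simp add: set_lebesgue_integral_def)
      next
        case False
        then have sub: "cbox c' d' \<subseteq> cbox a b"
          using closure_minimal[of "box c' d'" "cbox a b"] cd box_subset_cbox[of a b]
          by (metis closed_cbox closure_box Int_lower2 order_trans)
        have "(LINT x:box c d|lebesgue. ?q x * indicator (box a b) x) = (LINT x:box c' d'|lebesgue. (if x \<in> cbox c' d' then v x else 0))"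
          unfolding set_lebesgue_integral_def
        proof (rule Bochner_Integration.integral_cong[OF refl])
          fix x show "indicat_real (box c d) x *\<^sub>R (?q x * indicator (box a b) x) =
              indicat_real (box c' d') x *\<^sub>R (if x \<in> cbox c' d' then v x else 0)"
            using cd box_subset_cbox[of c' d'] box_subset_cbox[of a b] by (auto simp: indicator_def set_eq_iff)
        qed
        then show ?thesis using box0[of c' d'] sub ab by simp
      qed
    qed
    moreover have "AE x in lebesgue. x \<notin> cbox a b - box a b"
      using negligible_frontier_interval[of a b] by (intro AE_not_in) (simp add: negligible_iff_null_sets)
    ultimately show ?thesis
      by eventually_elim (auto simp: indicator_def split: if_splits)
  qed
  obtain \<D> where D: "countable \<D>" "\<D> \<subseteq> Pow \<omega>" "\<And>X. X \<in> \<D> \<Longrightarrow> \<exists>a b. X = cbox a b" "\<Union>\<D> = \<omega>"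
    using open_countable_Union_open_cbox[OF \<open>open \<omega>\<close>] by metis
  have "AE x in lebesgue. \<forall>X\<in>\<D>. x \<in> X \<longrightarrow> v x = 0"
    using D(2,3) ae by (subst AE_ball_countable[OF D(1)]) blast
  then have "AE x in lebesgue. x \<in> \<omega> \<longrightarrow> v x = 0"
    by eventually_elim (use D(4) in auto)
  then show ?thesis using \<open>open \<omega>\<close> by (subst AE_restrict_space_iff) auto
qed

lemma locally_integrable_diff:
  "locally_integrable \<omega> u \<Longrightarrow> locally_integrable \<omega> v \<Longrightarrow> locally_integrable \<omega> (\<lambda>x. u x - v x)"
  by (simp add: locally_integrable_def)

lemma test_function_integral:
  fixes u :: "real^'n \<Rightarrow> real"
  assumes "open \<omega>" "locally_integrable \<omega> u" "test_function \<omega> \<phi>"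
  shows "integrable (lebesgue_on \<omega>) (\<lambda>x. u x * \<phi> x)"
proof -
  obtain K where K: "compact K" "K \<subseteq> \<omega>" "\<forall>x. x \<notin> K \<longrightarrow> \<phi> x = 0 \<and> (\<forall>i. partial_deriv i \<phi> x = 0)"
    using test_function_support[OF assms(3)] by blast
  show ?thesis
    using K(3) by (intro locally_integrable_mult(1)[OF assms(2,1) K(1,2)] smooth_continuous test_function_smooth[OF assms(3)]) auto
qed

lemma weak_deriv_unique_AE:
  fixes u :: "real^'n \<Rightarrow> real"
  assumes "open \<omega>" "has_weak_deriv \<omega> \<beta> u v" "has_weak_deriv \<omega> \<beta> u v'"
  shows "AE x in lebesgue_on \<omega>. v x = v' x"
proof -
  have li: "locally_integrable \<omega> v" "locally_integrable \<omega> v'"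
    using assms by (auto simp: has_weak_deriv_def)
  have "AE x in lebesgue_on \<omega>. v x - v' x = 0"
  proof (rule fundamental_lemma_of_variations[OF \<open>open \<omega>\<close> locally_integrable_diff[OF li]])
    fix n a b assume "cbox a b \<subseteq> \<omega>"
    then have t: "test_function \<omega> (box_bump (real (Suc n)) a b)" by (intro test_function_box_bump) auto
    have "(-1) ^ length \<beta> * (LINT x|lebesgue_on \<omega>. v x * box_bump (real (Suc n)) a b x)
        = (-1) ^ length \<beta> * (LINT x|lebesgue_on \<omega>. v' x * box_bump (real (Suc n)) a b x)"
      using assms(2,3) t by (simp add: has_weak_deriv_def del: of_nat_Suc)
    then have "(LINT x|lebesgue_on \<omega>. v x * box_bump (real (Suc n)) a b x)
        = (LINT x|lebesgue_on \<omega>. v' x * box_bump (real (Suc n)) a b x)" by simp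
    then show "(LINT x|lebesgue_on \<omega>. (v x - v' x) * box_bump (real (Suc n)) a b x) = 0"
      unfolding left_diff_distrib
      using Bochner_Integration.integral_diff[OF test_function_integral[OF assms(1) li(1) t] test_function_integral[OF assms(1) li(2) t]]
      by simp
  qed
  then show ?thesis by eventually_elim simp
qed

section \<open>Continuity of translations in \<open>L\<^sup>1\<close>\<close>

lemma lborel_translate:
  fixes f :: "'a::euclidean_space \<Rightarrow> real"
  assumes "f \<in> borel_measurable borel"
  shows "integrable lborel (\<lambda>x. f (x + z)) \<longleftrightarrow> integrable lborel f"
    and "(LINT x|lborel. f (x + z)) = (LINT x|lborel. f x)"
proof -
  have m: "(+) z \<in> measurable lborel borel" by simp
  show "integrable lborel (\<lambda>x. f (x + z)) \<longleftrightarrow> integrable lborel f"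
    using integrable_distr_eq[OF m assms] by (simp add: lborel_distr_plus add.commute)
  show "(LINT x|lborel. f (x + z)) = (LINT x|lborel. f x)"
    using integral_distr[OF m assms] by (simp add: lborel_distr_plus add.commute)
qed

text \<open>Continuity is phrased with sequences because the dominated convergence theorem is.\<close>

definition L1_translation_continuous :: "('a::euclidean_space \<Rightarrow> real) \<Rightarrow> bool" where
  "L1_translation_continuous f \<longleftrightarrow>
     (\<forall>Z. Z \<longlonglongrightarrow> 0 \<longrightarrow> (\<lambda>n. LINT x|lborel. \<bar>f (x + Z n) - f x\<bar>) \<longlonglongrightarrow> 0)"

text \<open>Translations are isometries of \<open>L\<^sup>1\<close>, so the property passes to \<open>L\<^sup>1\<close>-limits.\<close>

lemma L1_translation_continuous_approx:
  fixes f :: "'a::euclidean_space \<Rightarrow> real"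
  assumes f: "integrable lborel f"
    and approx: "\<And>e. e > 0 \<Longrightarrow> \<exists>g. integrable lborel g \<and> L1_translation_continuous g \<and> (LINT x|lborel. \<bar>f x - g x\<bar>) < e"
  shows "L1_translation_continuous f"
  unfolding L1_translation_continuous_def
proof (intro allI impI LIMSEQ_I)
  fix Z :: "nat \<Rightarrow> 'a" and e :: real assume Z: "Z \<longlonglongrightarrow> 0" and "e > 0"
  then obtain g where g: "integrable lborel g" "L1_translation_continuous g" "(LINT x|lborel. \<bar>f x - g x\<bar>) < e / 3"
    using approx[of "e / 3"] by auto
  have [measurable]: "f \<in> borel_measurable borel" "g \<in> borel_measurable borel"
    using f g(1) by (auto dest: borel_measurable_integrable)
  have fg: "integrable lborel (\<lambda>x. \<bar>f x - g x\<bar>)" using f g by auto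
  have sh: "integrable lborel (\<lambda>x. f (x + z))" "integrable lborel (\<lambda>x. g (x + z))"
      "integrable lborel (\<lambda>x. \<bar>f (x + z) - g (x + z)\<bar>)"
      "(LINT x|lborel. \<bar>f (x + z) - g (x + z)\<bar>) = (LINT x|lborel. \<bar>f x - g x\<bar>)" for z
    using lborel_translate[of "\<lambda>x. \<bar>f x - g x\<bar>" z] lborel_translate(1)[of f z] lborel_translate(1)[of g z] f g fg by auto
  have le: "(LINT x|lborel. \<bar>f (x + z) - f x\<bar>) \<le> 2 * (LINT x|lborel. \<bar>f x - g x\<bar>) + (LINT x|lborel. \<bar>g (x + z) - g x\<bar>)" for z
  proof -
    have "(LINT x|lborel. \<bar>f (x + z) - f x\<bar>)
        \<le> (LINT x|lborel. \<bar>f (x + z) - g (x + z)\<bar> + \<bar>f x - g x\<bar> + \<bar>g (x + z) - g x\<bar>)"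
      using sh[of z] f g by (intro integral_mono) auto
    also have "\<dots> = 2 * (LINT x|lborel. \<bar>f x - g x\<bar>) + (LINT x|lborel. \<bar>g (x + z) - g x\<bar>)"
      using sh[of z] fg f g by simp
    finally show ?thesis .
  qed
  from g(2) Z have "(\<lambda>n. LINT x|lborel. \<bar>g (x + Z n) - g x\<bar>) \<longlonglongrightarrow> 0"
    by (simp add: L1_translation_continuous_def)
  from LIMSEQ_D[OF this, of "e / 3"] \<open>e > 0\<close>
  obtain N where N: "\<And>n. n \<ge> N \<Longrightarrow> (LINT x|lborel. \<bar>g (x + Z n) - g x\<bar>) < e / 3" by fastforce
  have "norm ((LINT x|lborel. \<bar>f (x + Z n) - f x\<bar>) - 0) < e" if "n \<ge> N" for n
    using le[of "Z n"] N[OF that] g(3) by simp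
  then show "\<exists>N. \<forall>n\<ge>N. norm ((LINT x|lborel. \<bar>f (x + Z n) - f x\<bar>) - 0) < e" by blast
qed

lemma integrable_indicator_lborel:
  "A \<in> sets borel \<Longrightarrow> emeasure lborel A < \<infinity> \<Longrightarrow> integrable lborel (indicator A :: 'a::euclidean_space \<Rightarrow> real)"
  by (intro integrable_real_indicator) auto

text \<open>If \<open>x\<close> lies in the open set \<open>U\<close>, so does \<open>x + z\<close> for small \<open>z\<close>. Hence the positive part of
  \<open>1\<^sub>U(x) - 1\<^sub>U(x + z)\<close> tends to zero pointwise and boundedly by \<open>1\<^sub>U\<close>. This controls the absolute
  value as well, since the two indicator functions have the same integral.\<close>

lemma L1_translation_continuous_open:
  fixes U :: "'a::euclidean_space set"
  assumes "open U" and fin: "emeasure lborel U < \<infinity>"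
  shows "L1_translation_continuous (indicator U)"
  unfolding L1_translation_continuous_def
proof (intro allI impI)
  fix Z :: "nat \<Rightarrow> 'a" assume Z: "Z \<longlonglongrightarrow> 0"
  let ?u = "indicator U :: 'a \<Rightarrow> real"
  have [measurable]: "U \<in> sets borel" using \<open>open U\<close> by simp
  have u: "integrable lborel ?u" by (intro integrable_indicator_lborel fin) simp
  have uz: "integrable lborel (\<lambda>x. ?u (x + z))" for z using lborel_translate(1)[of ?u z] u by simp
  have "(\<lambda>n. LINT x|lborel. max (?u x - ?u (x + Z n)) 0) \<longlonglongrightarrow> (LINT x|(lborel :: 'a measure). (0 :: real))"
  proof (rule integral_dominated_convergence[where w = ?u])
    show "AE x in lborel. (\<lambda>n. max (?u x - ?u (x + Z n)) 0) \<longlonglongrightarrow> 0"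
    proof (rule AE_I2)
      fix x
      show "(\<lambda>n. max (?u x - ?u (x + Z n)) 0) \<longlonglongrightarrow> 0"
      proof (cases "x \<in> U")
        case True
        have "(\<lambda>n. x + Z n) \<longlonglongrightarrow> x + 0" by (intro tendsto_intros Z)
        then have "\<forall>\<^sub>F n in sequentially. x + Z n \<in> U"
          using \<open>open U\<close> True by (auto dest!: topological_tendstoD)
        then have "\<forall>\<^sub>F n in sequentially. max (?u x - ?u (x + Z n)) 0 = 0"
          by eventually_elim (simp add: True)
        then show ?thesis by (rule tendsto_eventually)
      qed (simp add: max_def)
    qed
    show "AE x in lborel. norm (max (?u x - ?u (x + Z n)) 0) \<le> ?u x" for n
      by (auto simp: indicator_def)
  qed (use u in \<open>auto intro!: borel_measurable_max\<close>)
  then have "(\<lambda>n. 2 * (LINT x|lborel. max (?u x - ?u (x + Z n)) 0)) \<longlonglongrightarrow> 2 * 0"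
    by (intro tendsto_mult tendsto_const) simp
  moreover have "(LINT x|lborel. \<bar>?u (x + z) - ?u x\<bar>) = 2 * (LINT x|lborel. max (?u x - ?u (x + z)) 0)" for z
  proof -
    have "(LINT x|lborel. \<bar>?u (x + z) - ?u x\<bar>) = (LINT x|lborel. 2 * max (?u x - ?u (x + z)) 0 + (?u (x + z) - ?u x))"
      by (intro Bochner_Integration.integral_cong) (auto simp: indicator_def)
    also have "\<dots> = (LINT x|lborel. 2 * max (?u x - ?u (x + z)) 0) + ((LINT x|lborel. ?u (x + z)) - (LINT x|lborel. ?u x))"
      using u uz[of z] by (subst Bochner_Integration.integral_add) (auto intro!: integrable_max)
    also have "(LINT x|lborel. ?u (x + z)) = (LINT x|lborel. ?u x)"
      by (rule lborel_translate(2)) simp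
    finally show ?thesis by simp
  qed
  ultimately show "(\<lambda>n. LINT x|lborel. \<bar>?u (x + Z n) - ?u x\<bar>) \<longlonglongrightarrow> 0" by simp
qed

lemma L1_translation_continuous_cmult:
  "L1_translation_continuous f \<Longrightarrow> L1_translation_continuous (\<lambda>x. f x * c)"
  unfolding L1_translation_continuous_def left_diff_distrib[symmetric] abs_mult
  by (auto intro: tendsto_mult_left_zero)

lemma L1_translation_continuous_add:
  assumes f: "integrable lborel f" "L1_translation_continuous f"
    and g: "integrable lborel g" "L1_translation_continuous g"
  shows "L1_translation_continuous (\<lambda>x. f x + g x)"
  unfolding L1_translation_continuous_def
proof (intro allI impI)
  fix Z :: "nat \<Rightarrow> 'a" assume Z: "Z \<longlonglongrightarrow> 0"
  have [measurable]: "f \<in> borel_measurable borel" "g \<in> borel_measurable borel"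
    using f g(1) by (auto dest: borel_measurable_integrable)
  have sh: "integrable lborel (\<lambda>x. f (x + z))" "integrable lborel (\<lambda>x. g (x + z))" for z
    using lborel_translate(1)[of f z] lborel_translate(1)[of g z] f g by auto
  show "(\<lambda>n. LINT x|lborel. \<bar>f (x + Z n) + g (x + Z n) - (f x + g x)\<bar>) \<longlonglongrightarrow> 0"
  proof (rule tendsto_sandwich[OF _ _ tendsto_const])
    show "(\<lambda>n. (LINT x|lborel. \<bar>f (x + Z n) - f x\<bar>) + (LINT x|lborel. \<bar>g (x + Z n) - g x\<bar>)) \<longlonglongrightarrow> 0"
      using f(2) g(2) Z by (intro tendsto_add_zero) (auto simp: L1_translation_continuous_def)
    show "\<forall>\<^sub>F n in sequentially. (LINT x|lborel. \<bar>f (x + Z n) + g (x + Z n) - (f x + g x)\<bar>)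
        \<le> (LINT x|lborel. \<bar>f (x + Z n) - f x\<bar>) + (LINT x|lborel. \<bar>g (x + Z n) - g x\<bar>)"
    proof (rule always_eventually, rule allI)
      fix n
      have "(LINT x|lborel. \<bar>f (x + Z n) + g (x + Z n) - (f x + g x)\<bar>)
          \<le> (LINT x|lborel. \<bar>f (x + Z n) - f x\<bar> + \<bar>g (x + Z n) - g x\<bar>)"
        using sh f g by (intro integral_mono) auto
      then show "(LINT x|lborel. \<bar>f (x + Z n) + g (x + Z n) - (f x + g x)\<bar>)
          \<le> (LINT x|lborel. \<bar>f (x + Z n) - f x\<bar>) + (LINT x|lborel. \<bar>g (x + Z n) - g x\<bar>)"
        using sh f g by simp
    qed
  qed (auto intro!: always_eventually)
qed

text \<open>Outer regularity reduces indicator functions of sets of finite measure to those of open sets;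
  linear combinations and limits then reach every integrable function.\<close>

lemma integrable_imp_L1_translation_continuous:
  fixes f :: "'a::euclidean_space \<Rightarrow> real"
  assumes "integrable lborel f"
  shows "L1_translation_continuous f"
  using assms
proof (induction rule: integrable_induct)
  case (base A c)
  have A: "A \<in> sets borel" "integrable lborel (indicator A :: 'a \<Rightarrow> real)"
    using base integrable_indicator_lborel by auto
  have "L1_translation_continuous (indicator A :: 'a \<Rightarrow> real)"
  proof (rule L1_translation_continuous_approx[OF A(2)])
    fix e :: real assume "e > 0"
    then obtain U where U: "open U" "A \<subseteq> U" "emeasure lborel (U - A) < ennreal e"
      using outer_regular_lborel[OF A(1)] by metis
    have "emeasure lborel U \<le> emeasure lborel A + emeasure lborel (U - A)"
      using emeasure_subadditive[of A lborel "U - A"] A(1) U by (auto simp: Un_absorb1)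
    also have "\<dots> < \<infinity>"
      using base(2) order.strict_trans[OF U(3) ennreal_less_top] by (simp add: ennreal_add_less_top)
    finally have fin: "emeasure lborel U < \<infinity>" .
    have "(LINT x|lborel. \<bar>indicat_real A x - indicat_real U x\<bar>) = (LINT x|lborel. indicat_real (U - A) x)"
      using U(2) by (intro Bochner_Integration.integral_cong) (auto simp: indicator_def)
    also have "\<dots> = measure lborel (U - A)" by simp
    also have "\<dots> < e"
    proof -
      have "emeasure lborel (U - A) \<noteq> top" using U(3) by auto
      then have "ennreal (measure lborel (U - A)) < ennreal e"
        using U(3) emeasure_eq_ennreal_measure[of lborel "U - A"] by simp
      then show ?thesis by (simp add: ennreal_less_iff)
    qed
    finally show "\<exists>g. integrable lborel g \<and> L1_translation_continuous g \<and> (LINT x|lborel. \<bar>indicat_real A x - g x\<bar>) < e"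
      using U fin by (intro exI[of _ "indicator U"]) (auto intro!: integrable_indicator_lborel L1_translation_continuous_open)
  qed
  then show ?case using L1_translation_continuous_cmult by simp
next
  case (add f g)
  then show ?case by (intro L1_translation_continuous_add)
next
  case (lim f s)
  have f: "integrable lborel f" and s: "integrable lborel (s i)" "L1_translation_continuous (s i)"
    and to: "(\<lambda>i. s i x) \<longlonglongrightarrow> f x" and le: "norm (s i x) \<le> 2 * norm (f x)" for i x
    using lim by simp_all
  have [measurable]: "f \<in> borel_measurable borel" "s i \<in> borel_measurable borel" for i
    using f s(1) by (auto dest: borel_measurable_integrable)
  have "(\<lambda>i. LINT x|lborel. \<bar>f x - s i x\<bar>) \<longlonglongrightarrow> (LINT x|(lborel :: 'a measure). (0 :: real))"
  proof (rule integral_dominated_convergence[where w = "\<lambda>x. 3 * \<bar>f x\<bar>"])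
    show "AE x in lborel. (\<lambda>i. \<bar>f x - s i x\<bar>) \<longlonglongrightarrow> 0"
    proof (rule AE_I2)
      fix x
      have "(\<lambda>i. \<bar>f x - s i x\<bar>) \<longlonglongrightarrow> \<bar>f x - f x\<bar>" by (intro tendsto_intros to)
      then show "(\<lambda>i. \<bar>f x - s i x\<bar>) \<longlonglongrightarrow> 0" by simp
    qed
    show "AE x in lborel. norm \<bar>f x - s i x\<bar> \<le> 3 * \<bar>f x\<bar>" for i
    proof (rule AE_I2)
      fix x show "norm \<bar>f x - s i x\<bar> \<le> 3 * \<bar>f x\<bar>" using le[of i x] by (simp add: abs_if split: if_splits)
    qed
  qed (use f in auto)
  then have "(\<lambda>i. LINT x|lborel. \<bar>f x - s i x\<bar>) \<longlonglongrightarrow> 0" by simp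
  then have ev: "\<exists>i. (LINT x|lborel. \<bar>f x - s i x\<bar>) < e" if "e > 0" for e
    using order_tendstoD(2)[of _ 0 sequentially e] that by (auto simp: eventually_sequentially)
  show ?case
    by (rule L1_translation_continuous_approx[OF f]) (use ev s in blast)
qed

text \<open>The translation can be moved from one factor to the other by a change of variables. It is placed on
  the factor that is merely integrable, so that the bounded one can be estimated uniformly.\<close>

lemma correlation_tendsto:
  fixes P Q :: "'a::euclidean_space \<Rightarrow> real"
  assumes PQ: "integrable lborel P" "integrable lborel Q"
    and bd: "(\<forall>x. \<bar>P x\<bar> \<le> B) \<or> (\<forall>x. \<bar>Q x\<bar> \<le> B)" and Z: "Z \<longlonglongrightarrow> 0"
  shows "(\<lambda>n. LINT x|lborel. P x * Q (x + Z n)) \<longlonglongrightarrow> (LINT x|lborel. P x * Q x)"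
proof -
  have main: "(\<lambda>n. LINT x|lborel. P x * Q (x + Z n)) \<longlonglongrightarrow> (LINT x|lborel. P x * Q x)"
    if PQ: "integrable lborel P" "integrable lborel Q" and bd: "\<And>x. \<bar>P x\<bar> \<le> B" and Z: "Z \<longlonglongrightarrow> 0"
    for P Q :: "'a \<Rightarrow> real" and Z
  proof -
    have [measurable]: "P \<in> borel_measurable borel" "Q \<in> borel_measurable borel"
      using PQ by (auto dest: borel_measurable_integrable)
    have Qz: "integrable lborel (\<lambda>x. Q (x + z))" for z using lborel_translate(1)[of Q z] PQ by simp
    have int: "integrable lborel (\<lambda>x. P x * Q (x + z))" for z
      using integrable_mult_bounded[OF Qz, of P B z] bd by (simp add: mult.commute)
    have int0: "integrable lborel (\<lambda>x. P x * Q x)" using int[of 0] by simp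
    have B: "B \<ge> 0" using bd[of 0] by linarith
    have "(\<lambda>n. (LINT x|lborel. P x * Q (x + Z n)) - (LINT x|lborel. P x * Q x)) \<longlonglongrightarrow> 0"
    proof (rule tendsto_rabs_zero_cancel, rule tendsto_sandwich[OF _ _ tendsto_const])
      show "(\<lambda>n. B * (LINT x|lborel. \<bar>Q (x + Z n) - Q x\<bar>)) \<longlonglongrightarrow> 0"
        using integrable_imp_L1_translation_continuous[OF PQ(2)] Z
        by (intro tendsto_mult_right_zero) (simp add: L1_translation_continuous_def)
      show "\<forall>\<^sub>F n in sequentially. \<bar>(LINT x|lborel. P x * Q (x + Z n)) - (LINT x|lborel. P x * Q x)\<bar> \<le> B * (LINT x|lborel. \<bar>Q (x + Z n) - Q x\<bar>)"
      proof (rule always_eventually, rule allI)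
        fix n
        have "\<bar>(LINT x|lborel. P x * Q (x + Z n)) - (LINT x|lborel. P x * Q x)\<bar> = \<bar>LINT x|lborel. P x * (Q (x + Z n) - Q x)\<bar>"
          using int int0 by (simp add: right_diff_distrib)
        also have "\<dots> \<le> (LINT x|lborel. \<bar>P x * (Q (x + Z n) - Q x)\<bar>)" by (rule integral_abs_bound)
        also have "\<dots> \<le> (LINT x|lborel. B * \<bar>Q (x + Z n) - Q x\<bar>)"
        proof (rule integral_mono)
          show "integrable lborel (\<lambda>x. \<bar>P x * (Q (x + Z n) - Q x)\<bar>)"
            using int int0 by (simp add: right_diff_distrib)
          show "integrable lborel (\<lambda>x. B * \<bar>Q (x + Z n) - Q x\<bar>)" using Qz[of "Z n"] PQ by simp
          show "\<bar>P x * (Q (x + Z n) - Q x)\<bar> \<le> B * \<bar>Q (x + Z n) - Q x\<bar>" for x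
            using bd[of x] by (simp add: abs_mult mult_right_mono)
        qed
        finally show "\<bar>(LINT x|lborel. P x * Q (x + Z n)) - (LINT x|lborel. P x * Q x)\<bar> \<le> B * (LINT x|lborel. \<bar>Q (x + Z n) - Q x\<bar>)"
          by simp
      qed
    qed (auto intro!: always_eventually)
    then show ?thesis by (simp add: LIM_zero_iff)
  qed
  have [measurable]: "P \<in> borel_measurable borel" "Q \<in> borel_measurable borel"
    using PQ by (auto dest: borel_measurable_integrable)
  have mZ: "(\<lambda>n. - Z n) \<longlonglongrightarrow> 0" using tendsto_minus[OF Z] by simp
  show ?thesis using bd
  proof
    assume "\<forall>x. \<bar>P x\<bar> \<le> B"
    then show ?thesis using main[OF PQ _ Z] by simp
  next
    assume b: "\<forall>x. \<bar>Q x\<bar> \<le> B"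
    have "(LINT x|lborel. P x * Q (x + z)) = (LINT x|lborel. Q x * P (x + - z))" for z
      using lborel_translate(2)[of "\<lambda>x. P x * Q (x + z)" "- z"] by (simp add: mult.commute)
    then show ?thesis using main[OF PQ(2,1) _ mZ] b by (simp add: mult.commute)
  qed
qed

section \<open>The product rule on the whole space\<close>

lemma integrable_tensor:
  fixes f :: "'a::euclidean_space \<Rightarrow> real" and g :: "'b::euclidean_space \<Rightarrow> real"
  assumes "integrable lborel f" "integrable lborel g"
  shows "integrable (lborel \<Otimes>\<^sub>M lborel) (\<lambda>(x, y). f x * g y)"
proof (rule lborel_pair.Fubini_integrable)
  have [measurable]: "f \<in> borel_measurable borel" "g \<in> borel_measurable borel"
    using assms by (auto dest: borel_measurable_integrable)
  show "(\<lambda>(x, y). f x * g y) \<in> borel_measurable (lborel \<Otimes>\<^sub>M lborel)" by measurable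
qed (use assms in \<open>auto simp: abs_mult\<close>)

text \<open>The shear \<open>(x, z) \<mapsto> (x, x + z)\<close> is a translation on every fibre with fixed \<open>x\<close>, and therefore
  preserves the product measure.\<close>

lemma Fubini_shear:
  fixes F :: "'a::euclidean_space \<Rightarrow> 'a \<Rightarrow> real"
  assumes F: "integrable (lborel \<Otimes>\<^sub>M lborel) (\<lambda>(x, y). F x y)"
  shows "integrable lborel (\<lambda>z. LINT x|lborel. F x (x + z))"
    and "(LINT z|lborel. LINT x|lborel. F x (x + z)) = (LINT x|lborel. LINT y|lborel. F x y)"
proof -
  have [measurable]: "(\<lambda>(x, y). F x y) \<in> borel_measurable (borel \<Otimes>\<^sub>M borel)"
    using borel_measurable_integrable[OF F] by simp
  have Fx [measurable]: "F x \<in> borel_measurable borel" for x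
  proof -
    have "(\<lambda>y. (\<lambda>(x, y). F x y) (x, y)) \<in> borel_measurable borel" by measurable
    then show ?thesis by simp
  qed
  have tr: "(LINT z|lborel. F x (x + z)) = (LINT y|lborel. F x y)"
      "(LINT z|lborel. \<bar>F x (x + z)\<bar>) = (LINT y|lborel. \<bar>F x y\<bar>)"
      "integrable lborel (\<lambda>z. F x (x + z)) \<longleftrightarrow> integrable lborel (F x)" for x
    using lborel_translate[of "F x" x] lborel_translate(2)[of "\<lambda>y. \<bar>F x y\<bar>" x]
    by (simp_all add: add.commute)
  have H: "integrable (lborel \<Otimes>\<^sub>M lborel) (\<lambda>(x, z). F x (x + z))"
  proof (rule lborel_pair.Fubini_integrable)
    have "(\<lambda>p. (\<lambda>(x, y). F x y) (fst p, fst p + snd p)) \<in> borel_measurable (borel \<Otimes>\<^sub>M borel)" by measurable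
    then show "(\<lambda>(x, z). F x (x + z)) \<in> borel_measurable (lborel \<Otimes>\<^sub>M lborel)"
      by (simp add: split_beta')
    show "AE x in lborel. integrable lborel (\<lambda>z. case (x, z) of (x, z) \<Rightarrow> F x (x + z))"
      using lborel_pair.AE_integrable_fst[OF F] by (simp add: tr)
    show "integrable lborel (\<lambda>x. LINT z|lborel. norm (case (x, z) of (x, z) \<Rightarrow> F x (x + z)))"
      using lborel_pair.integrable_fst[of "\<lambda>x y. \<bar>F x y\<bar>"] integrable_abs[OF F]
      by (simp add: tr split_beta')
  qed
  show "integrable lborel (\<lambda>z. LINT x|lborel. F x (x + z))"
    by (rule lborel_pair.integrable_snd[OF H])
  show "(LINT z|lborel. LINT x|lborel. F x (x + z)) = (LINT x|lborel. LINT y|lborel. F x y)"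
    unfolding lborel_pair.Fubini_integral[OF H] tr ..
qed

text \<open>A bump around the origin that is invariant under \<open>z \<mapsto> - z\<close>; consequently \<open>bump r (x - y)\<close> is a
  test function of \<open>x\<close> as well as of \<open>y\<close>.\<close>

definition bump :: "real \<Rightarrow> real^'n \<Rightarrow> real" where
  "bump r = box_bump 1 (\<chi> i. - r) (\<chi> i. r)"

lemma bump_minus: "bump r (- z) = bump r z"
  by (simp add: bump_def box_bump_def mult.commute add.commute)

lemma bump_pos_iff: "bump r z > 0 \<longleftrightarrow> z \<in> box (\<chi> i. - r) (\<chi> i. r)"
  using box_bump_support[of 1 "\<chi> i. - r" "\<chi> i. r" z] box_bump_bounds(1)[of 1 "\<chi> i. - r" "\<chi> i. r" z]
  by (simp add: bump_def) linarith

lemma bump_eq_0: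
  fixes z :: "real^'n"
  assumes "norm z > r * real CARD('n)" shows "bump r z = 0"
proof (rule ccontr)
  assume "bump r z \<noteq> 0"
  then have "z \<in> box (\<chi> i. - r) (\<chi> i. r)" using box_bump_support[OF zero_less_one, of "\<chi> i. - r" "\<chi> i. r" z] by (simp add: bump_def)
  then have "\<bar>z $ i\<bar> \<le> r" for i by (simp add: mem_box_cart abs_le_iff) (metis less_imp_le minus_le_iff)
  then have "norm z \<le> (\<Sum>i\<in>(UNIV :: 'n set). r)"
    using norm_le_l1_cart[of z] by (meson order_trans sum_mono)
  with assms show False by (simp add: mult.commute)
qed

lemma smooth_bump: "smooth (bump r)"
  by (simp add: bump_def smooth_box_bump)

lemma partial_deriv_bump_minus: "partial_deriv c (bump r) (- z) = - partial_deriv c (bump r) z"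
proof -
  have "((\<lambda>x. - x) has_derivative (\<lambda>h. - h)) (at z)" by (auto intro!: derivative_eq_intros)
  from has_derivative_compose[OF this smooth_has_derivative[OF smooth_bump]]
  have "(bump r has_derivative (\<lambda>h. frechet_derivative (bump r) (at (- z)) (- h))) (at z)"
    by (simp add: bump_minus)
  from partial_deriv_unique[OF this, of c]
  have "partial_deriv c (bump r) z = frechet_derivative (bump r) (at (- z)) (- axis c 1)" .
  also have "\<dots> = - partial_deriv c (bump r) (- z)"
    using linear_frechet_derivative[OF smooth_differentiable[OF smooth_bump, of r "- z"]]
    by (simp add: partial_deriv_def linear_neg)
  finally show ?thesis by simp
qed

lemma continuous_compact_support_measurable_bounded:
  fixes \<phi> :: "'a::euclidean_space \<Rightarrow> real"
  assumes "continuous_on UNIV \<phi>" "compact K" "\<And>x. x \<notin> K \<Longrightarrow> \<phi> x = 0"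
  shows "\<phi> \<in> borel_measurable borel" "\<exists>B. \<forall>x. \<bar>\<phi> x\<bar> \<le> B"
  using assms by (auto intro!: borel_measurable_continuous_onI continuous_compact_support_bounded)

lemma test_function_measurable_bounded:
  fixes \<phi> :: "real^'n \<Rightarrow> real"
  assumes "test_function \<omega> \<phi>"
  shows "\<phi> \<in> borel_measurable borel" "\<exists>B. \<forall>x. \<bar>\<phi> x\<bar> \<le> B"
proof -
  obtain K where K: "compact K" "K \<subseteq> \<omega>" "\<forall>x. x \<notin> K \<longrightarrow> \<phi> x = 0 \<and> (\<forall>i. partial_deriv i \<phi> x = 0)"
    using test_function_support[OF assms] by blast
  show "\<phi> \<in> borel_measurable borel" "\<exists>B. \<forall>x. \<bar>\<phi> x\<bar> \<le> B"
    using continuous_compact_support_measurable_bounded[of \<phi> K] K smooth_continuous[OF test_function_smooth[OF assms]]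
    by auto
qed

lemma test_function_bump: "test_function UNIV (bump r :: real^'n \<Rightarrow> real)"
proof (rule test_functionI[of _ "cball 0 (r * real CARD('n))"])
  fix x :: "real^'n" assume "x \<notin> cball 0 (r * real CARD('n))"
  then show "bump r x = 0" by (intro bump_eq_0) simp
qed (auto simp: smooth_bump)

text \<open>The proof doubles the variables. Let \<open>k(x, y) = bump r (x - y)\<close>. For fixed
  \<open>y\<close>, the function \<open>k(x, y) \<phi>(x)\<close> is a test function of \<open>x\<close>, and the weak equation of \<open>U\<close>
  applies to it; for fixed \<open>x\<close> in the support of \<open>\<phi>\<close> and small \<open>r\<close>, \<open>k(x, y)\<close> is a test function of
  \<open>y\<close>, and the weak equation of \<open>W\<close> applies. Derivatives of \<open>k\<close> in \<open>x\<close> and in \<open>y\<close> are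
  opposite to each other, so they cancel when the two double integrals are added. What remains is
  \<open>\<integral> bump r z * S z dz = 0\<close>, where \<open>S z\<close> is the defect of the product rule for \<open>U\<close> and the function \<open>W\<close>
  translated by \<open>z\<close>. Since \<open>S\<close> is continuous at \<open>0\<close> and \<open>r\<close> is arbitrarily small, \<open>S 0 = 0\<close>.

  Boundedness of \<open>U\<close> and \<open>W\<close> ensures that each term of \<open>S\<close> pairs a bounded function with an integrable one.\<close>

lemma product_rule_lborel:
  fixes U U' W W' :: "real^'n \<Rightarrow> real"
  assumes "open \<omega>"
    and U: "integrable lborel U" "integrable lborel U'" "\<And>x. \<bar>U x\<bar> \<le> M"
      "\<And>\<phi>. test_function \<omega> \<phi> \<Longrightarrow> (LINT x|lborel. U x * partial_deriv c \<phi> x) = - (LINT x|lborel. U' x * \<phi> x)"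
    and W: "integrable lborel W" "integrable lborel W'" "\<And>x. \<bar>W x\<bar> \<le> M"
      "\<And>\<phi>. test_function \<omega> \<phi> \<Longrightarrow> (LINT x|lborel. W x * partial_deriv c \<phi> x) = - (LINT x|lborel. W' x * \<phi> x)"
    and \<phi>: "test_function \<omega> \<phi>"
  shows "(LINT x|lborel. U x * W x * partial_deriv c \<phi> x) = - (LINT x|lborel. (U x * W' x + U' x * W x) * \<phi> x)"
proof -
  have [measurable]: "U \<in> borel_measurable borel" "U' \<in> borel_measurable borel"
    "W \<in> borel_measurable borel" "W' \<in> borel_measurable borel"
    using U W by (auto dest: borel_measurable_integrable)
  obtain K where K: "compact K" "K \<subseteq> \<omega>" "\<forall>x. x \<notin> K \<longrightarrow> \<phi> x = 0 \<and> (\<forall>i. partial_deriv i \<phi> x = 0)"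
    using test_function_support[OF \<phi>] by blast
  obtain \<epsilon> where \<epsilon>: "\<epsilon> > 0" "(\<Union>x\<in>K. ball x \<epsilon>) \<subseteq> \<omega>"
    using compact_subset_open_imp_ball_epsilon_subset[OF K(1) \<open>open \<omega>\<close> K(2)] .
  define D where "D = partial_deriv c \<phi>"
  have D: "test_function \<omega> D" using test_function_partial_deriv[OF \<phi>] by (simp add: D_def)
  note [measurable] = test_function_measurable_bounded(1)[OF \<phi>] test_function_measurable_bounded(1)[OF D]
  obtain B1 B2 where B1: "\<And>x. \<bar>\<phi> x\<bar> \<le> B1" and B2: "\<And>x. \<bar>D x\<bar> \<le> B2"
    using test_function_measurable_bounded(2)[OF \<phi>] test_function_measurable_bounded(2)[OF D] by blast
  have B0: "B1 \<ge> 0" "B2 \<ge> 0" "M \<ge> 0" using B1[of 0] B2[of 0] U(3)[of 0] by linarith+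
  let ?a = "\<lambda>x. U x * D x" and ?b = "\<lambda>x. U x * \<phi> x" and ?d = "\<lambda>x. U' x * \<phi> x"
  have abd: "integrable lborel ?a" "integrable lborel ?b" "integrable lborel ?d"
    by (rule integrable_mult_bounded[OF _ _ B2] integrable_mult_bounded[OF _ _ B1]; use U in simp)+
  have ab_bd: "\<bar>?a x\<bar> \<le> M * B2" "\<bar>?b x\<bar> \<le> M * B1" for x
    using U(3)[of x] B1[of x] B2[of x] B0 by (simp_all add: abs_mult mult_mono)
  let ?E = "\<lambda>x y. ?a x * W y + ?b x * W' y + ?d x * W y"
  define S where "S z = (LINT x|lborel. ?E x (x + z))" for z
  have W_tr: "integrable lborel (\<lambda>x. W (x + z))" "integrable lborel (\<lambda>x. W' (x + z))" for z
    using lborel_translate(1)[of W z] lborel_translate(1)[of W' z] W by simp_all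
  have S_int: "integrable lborel (\<lambda>x. ?a x * W (x + z))" "integrable lborel (\<lambda>x. ?b x * W' (x + z))"
    "integrable lborel (\<lambda>x. ?d x * W (x + z))" for z
    using integrable_mult_bounded[OF abd(1), of "\<lambda>x. W (x + z)" M]
      integrable_mult_bounded[OF W_tr(2)[of z], of ?b "M * B1"]
      integrable_mult_bounded[OF abd(3), of "\<lambda>x. W (x + z)" M] W(3) ab_bd
    by (simp_all add: mult.commute)
  have S_eq: "S z = (LINT x|lborel. ?a x * W (x + z)) + (LINT x|lborel. ?b x * W' (x + z)) + (LINT x|lborel. ?d x * W (x + z))" for z
    unfolding S_def using S_int[of z] by simp
  have S_cont: "(\<lambda>n. S (Z n)) \<longlonglongrightarrow> S 0" if Z: "Z \<longlonglongrightarrow> 0" for Z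
    unfolding S_eq add_0_right
    using correlation_tendsto[OF abd(1) W(1) _ Z, of M] correlation_tendsto[OF abd(2) W(2) _ Z, of "M * B1"]
      correlation_tendsto[OF abd(3) W(1) _ Z, of M] W(3) ab_bd
    by (intro tendsto_add) auto
  have kernel: "integrable lborel (\<lambda>z. bump r z * S z) \<and> (LINT z|lborel. bump r z * S z) = 0"
    if r: "r * real CARD('n) < \<epsilon>" for r
  proof -
    let ?k = "\<lambda>x y. bump r (x - y)" and ?k1 = "\<lambda>x y. partial_deriv c (bump r) (x - y)"
    note tb = test_function_bump[of r, where 'n = 'n]
    note tb1 = test_function_partial_deriv[OF tb, of c]
    note [measurable] = test_function_measurable_bounded(1)[OF tb] test_function_measurable_bounded(1)[OF tb1]
    obtain A1 A2 where A1: "\<And>z::real^'n. \<bar>bump r z\<bar> \<le> A1" and A2: "\<And>z. \<bar>partial_deriv c (bump r) z\<bar> \<le> A2"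
      using test_function_measurable_bounded(2)[OF tb] test_function_measurable_bounded(2)[OF tb1] by blast
    have tens: "integrable (lborel \<Otimes>\<^sub>M lborel) (\<lambda>(x, y). f x * g y * ?k x y)"
        "integrable (lborel \<Otimes>\<^sub>M lborel) (\<lambda>(x, y). f x * g y * ?k1 x y)"
      if "integrable lborel f" "integrable lborel g" for f g :: "real^'n \<Rightarrow> real"
    proof -
      show "integrable (lborel \<Otimes>\<^sub>M lborel) (\<lambda>(x, y). f x * g y * ?k x y)"
        using integrable_mult_bounded[OF integrable_tensor[OF that], of "\<lambda>(x,y). ?k x y" A1] A1
        by (simp add: split_beta')
      show "integrable (lborel \<Otimes>\<^sub>M lborel) (\<lambda>(x, y). f x * g y * ?k1 x y)"
        using integrable_mult_bounded[OF integrable_tensor[OF that], of "\<lambda>(x,y). ?k1 x y" A2] A2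
        by (simp add: split_beta')
    qed
    \<comment> \<open>\<open>E1\<close> integrates to zero in \<open>x\<close> and \<open>E2\<close> in \<open>y\<close>; the terms with derivatives of the kernel cancel in their sum.\<close>
    let ?E1 = "\<lambda>x y. W y * (U x * (?k x y * D x + ?k1 x y * \<phi> x) + U' x * (?k x y * \<phi> x))"
    let ?E2 = "\<lambda>x y. ?b x * (W' y * ?k x y - W y * ?k1 x y)"
    have E1: "integrable (lborel \<Otimes>\<^sub>M lborel) (\<lambda>(x, y). ?E1 x y)"
      using Bochner_Integration.integrable_add[OF Bochner_Integration.integrable_add[OF tens(1)[OF abd(1) W(1)] tens(2)[OF abd(2) W(1)]] tens(1)[OF abd(3) W(1)]]
      by (simp add: split_beta' algebra_simps)
    have E2: "integrable (lborel \<Otimes>\<^sub>M lborel) (\<lambda>(x, y). ?E2 x y)"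
      using Bochner_Integration.integrable_diff[OF tens(1)[OF abd(2) W(2)] tens(2)[OF abd(2) W(1)]]
      by (simp add: split_beta' algebra_simps)
    have E1_0: "(LINT x|lborel. ?E1 x y) = 0" for y
    proof -
      have sk: "smooth (\<lambda>x. ?k x y)" by (rule smooth_translate[OF smooth_bump])
      have t: "test_function \<omega> (\<lambda>x. ?k x y * \<phi> x)" by (rule test_function_mult[OF \<phi> sk])
      have d: "partial_deriv c (\<lambda>x. ?k x y * \<phi> x) x = ?k x y * D x + ?k1 x y * \<phi> x" for x
        by (simp add: partial_deriv_mult[OF smooth_differentiable[OF sk] smooth_differentiable[OF test_function_smooth[OF \<phi>]]] D_def
            partial_deriv_translate smooth_differentiable smooth_bump)
      have "(LINT x|lborel. U x * (?k x y * D x + ?k1 x y * \<phi> x)) = - (LINT x|lborel. U' x * (?k x y * \<phi> x))"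
        using U(4)[OF t] unfolding d .
      moreover have "integrable lborel (\<lambda>x. U x * (?k x y * D x + ?k1 x y * \<phi> x))"
        using integrable_mult_bounded[OF abd(1), of "\<lambda>x. ?k x y" A1] integrable_mult_bounded[OF abd(2), of "\<lambda>x. ?k1 x y" A2] A1 A2
        by (simp add: algebra_simps)
      moreover have "integrable lborel (\<lambda>x. U' x * (?k x y * \<phi> x))"
        using integrable_mult_bounded[OF abd(3), of "\<lambda>x. ?k x y" A1] A1
        by (simp add: algebra_simps)
      ultimately show ?thesis by simp
    qed
    have E2_0: "(LINT y|lborel. ?E2 x y) = 0" for x
    proof (cases "x \<in> K")
      case False
      then show ?thesis using K(3) by simp
    next
      case True
      have t: "test_function \<omega> (\<lambda>y. bump r (y - x))"
      proof (rule test_functionI[of _ "cball x (r * real CARD('n))"])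
        show "smooth (\<lambda>y. bump r (y - x))" by (rule smooth_translate[OF smooth_bump])
        have "cball x (r * real CARD('n)) \<subseteq> ball x \<epsilon>" using r by auto
        then show "cball x (r * real CARD('n)) \<subseteq> \<omega>" using \<epsilon>(2) True by blast
        fix y assume "y \<notin> cball x (r * real CARD('n))"
        then show "bump r (y - x) = 0" by (intro bump_eq_0) (simp add: dist_norm norm_minus_commute)
      qed simp
      have k: "bump r (y - x) = ?k x y" for y using bump_minus[of r "x - y"] by simp
      have d: "partial_deriv c (\<lambda>y. bump r (y - x)) y = - ?k1 x y" for y
        using partial_deriv_bump_minus[of c r "x - y"]
        by (simp add: partial_deriv_translate smooth_differentiable smooth_bump)
      have "(LINT y|lborel. W y * - ?k1 x y) = - (LINT y|lborel. W' y * ?k x y)"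
        using W(4)[OF t] unfolding d unfolding k .
      moreover have "integrable lborel (\<lambda>y. W y * ?k1 x y)" "integrable lborel (\<lambda>y. W' y * ?k x y)"
        using integrable_mult_bounded[OF W(1), of "\<lambda>y. ?k1 x y" A2] integrable_mult_bounded[OF W(2), of "\<lambda>y. ?k x y" A1] A1 A2
        by simp_all
      ultimately show ?thesis by simp
    qed
    have E12: "integrable (lborel \<Otimes>\<^sub>M lborel) (\<lambda>(x, y). ?k x y * ?E x y)"
      using Bochner_Integration.integrable_add[OF E1 E2] by (simp add: split_beta' algebra_simps)
    have "integral\<^sup>L (lborel \<Otimes>\<^sub>M lborel) (\<lambda>(x, y). ?k x y * ?E x y)
        = integral\<^sup>L (lborel \<Otimes>\<^sub>M lborel) (\<lambda>(x, y). ?E1 x y) + integral\<^sup>L (lborel \<Otimes>\<^sub>M lborel) (\<lambda>(x, y). ?E2 x y)"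
      using Bochner_Integration.integral_add[OF E1 E2] by (simp add: split_beta' algebra_simps)
    also have "\<dots> = 0"
      unfolding lborel_pair.integral_snd[OF E1, symmetric] lborel_pair.integral_fst[OF E2, symmetric] E1_0 E2_0
      by simp
    finally have I0: "(LINT x|lborel. LINT y|lborel. ?k x y * ?E x y) = 0"
      using lborel_pair.integral_fst[OF E12] by simp
    have "(LINT x|lborel. ?k x (x + z) * ?E x (x + z)) = bump r z * S z" for z
      using bump_minus[of r z] by (simp add: S_def)
    then show ?thesis using Fubini_shear[OF E12] I0 by simp
  qed
  \<comment> \<open>If \<open>S\<close> had a strict sign near \<open>0\<close>, its integral against a bump with small support could not vanish.\<close>
  have sign: "\<exists>z. norm z < \<delta> \<and> s * S z \<le> 0" if "\<delta> > 0" "s = 1 \<or> s = -1" for \<delta> s :: real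
  proof (rule ccontr)
    assume neg: "\<not> ?thesis"
    define r where "r = min \<epsilon> \<delta> / (2 * real CARD('n))"
    have rn: "r * real CARD('n) = min \<epsilon> \<delta> / 2" by (simp add: r_def)
    have r: "r > 0" using \<epsilon>(1) \<open>\<delta> > 0\<close> by (simp add: r_def)
    have pos: "s * S z > 0" if "bump r z \<noteq> 0" for z
    proof -
      have "norm z \<le> r * real CARD('n)" using bump_eq_0[of r z] that by force
      then have "norm z < \<delta>" using rn \<epsilon>(1) \<open>\<delta> > 0\<close> by (simp add: min_def split: if_splits)
      with neg show ?thesis by force
    qed
    have "r * real CARD('n) < \<epsilon>" unfolding rn using \<epsilon>(1) \<open>\<delta> > 0\<close> by linarith
    from kernel[OF this] have int: "integrable lborel (\<lambda>z. s * (bump r z * S z))" and I0: "(LINT z|lborel. s * (bump r z * S z)) = 0"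
      by simp_all
    have nn: "0 \<le> s * (bump r z * S z)" for z
    proof (cases "bump r z = 0")
      case False
      have "0 \<le> bump r z * (s * S z)"
        using pos[OF False] box_bump_bounds(1) by (metis bump_def less_imp_le mult_nonneg_nonneg)
      then show ?thesis by (simp add: mult.left_commute)
    qed simp
    have "AE z in lborel. s * (bump r z * S z) = 0"
      using integral_nonneg_eq_0_iff_AE[OF int] nn I0 by simp
    then have "AE z in (lborel :: (real^'n) measure). z \<notin> box (\<chi> i. - r) (\<chi> i. r)"
    proof eventually_elim
      case (elim z)
      then show ?case using pos[of z] bump_pos_iff[of r z] by auto
    qed
    then have "box (\<chi> i. - r) (\<chi> i. r) \<in> null_sets (lborel :: (real^'n) measure)"
      by (subst AE_iff_null_sets) auto
    then have "negligible (box (\<chi> i. - r) (\<chi> i. r) :: (real^'n) set)"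
      by (simp add: negligible_iff_null_sets null_sets_completionI)
    then have "box (\<chi> i. - r) (\<chi> i. r) = ({} :: (real^'n) set)"
      using open_not_negligible[OF open_box] by blast
    moreover have "0 \<in> box (\<chi> i. - r) (\<chi> i. r :: real^'n)" using r by (simp add: mem_box_cart)
    ultimately show False by blast
  qed
  have le: "s * S 0 \<le> 0" if "s = 1 \<or> s = -1" for s :: real
  proof -
    have "\<exists>Z. \<forall>n. norm (Z n) < inverse (real (Suc n)) \<and> s * S (Z n) \<le> 0"
      using sign[OF _ that] by (intro choice) simp
    then obtain Z where Z: "\<And>n. norm (Z n) < inverse (real (Suc n))" "\<And>n. s * S (Z n) \<le> 0" by blast
    have "Z \<longlonglongrightarrow> 0"
      by (rule Lim_null_comparison[OF _ LIMSEQ_inverse_real_of_nat]) (use Z(1) in \<open>auto intro!: always_eventually less_imp_le\<close>)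
    then have "(\<lambda>n. s * S (Z n)) \<longlonglongrightarrow> s * S 0" by (intro tendsto_intros S_cont)
    then show ?thesis by (rule LIMSEQ_le_const2) (use Z(2) in auto)
  qed
  have "S 0 = 0" using le[of 1] le[of "-1"] by simp
  then have "(LINT x|lborel. ?a x * W x) + ((LINT x|lborel. ?b x * W' x) + (LINT x|lborel. ?d x * W x)) = 0"
    using S_eq[of 0] by simp
  moreover have "(LINT x|lborel. ?b x * W' x) + (LINT x|lborel. ?d x * W x) = (LINT x|lborel. (U x * W' x + U' x * W x) * \<phi> x)"
    using S_int(2,3)[of 0] by (subst Bochner_Integration.integral_add[symmetric]) (simp_all add: algebra_simps)
  moreover have "(LINT x|lborel. ?a x * W x) = (LINT x|lborel. U x * W x * partial_deriv c \<phi> x)"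
    by (simp add: D_def algebra_simps)
  ultimately show ?thesis by linarith
qed

section \<open>Weak derivatives on a domain\<close>

lemma borel_measurable_lebesgue_on_AE:
  fixes f g :: "'a::euclidean_space \<Rightarrow> 'b::euclidean_space"
  assumes S: "S \<in> sets lebesgue" and f: "f \<in> borel_measurable (lebesgue_on S)"
    and eq: "AE x in lebesgue_on S. f x = g x"
  shows "g \<in> borel_measurable (lebesgue_on S)"
proof -
  have "AE x in lebesgue. x \<in> S \<longrightarrow> f x = g x"
    using eq S by (simp add: AE_restrict_space_iff)
  then have "AE x in lebesgue. (if x \<in> S then f x else 0) = (if x \<in> S then g x else 0)"
    by eventually_elim simp
  from borel_measurable_AE[OF borel_measurable_if_I[OF f S] this] show ?thesis
    by (rule borel_measurable_if_D)
qed

lemma integrable_subset_lebesgue_on: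
  fixes f :: "'a::euclidean_space \<Rightarrow> real"
  assumes f: "integrable (lebesgue_on S) f" and "S \<in> sets lebesgue" "T \<in> sets lebesgue" "T \<subseteq> S"
  shows "integrable (lebesgue_on T) f"
proof -
  have "integrable lebesgue (\<lambda>x. if x \<in> S then f x else 0)"
    using f assms(2) by (simp add: Lebesgue_Measure.integrable_restrict_UNIV)
  from integrable_mult_indicator[OF assms(3) this]
  have "integrable lebesgue (\<lambda>x. indicat_real T x *\<^sub>R (if x \<in> S then f x else 0))" .
  also have "(\<lambda>x. indicat_real T x *\<^sub>R (if x \<in> S then f x else 0)) = (\<lambda>x. if x \<in> T then f x else 0)"
    using assms(4) by (auto simp: fun_eq_iff indicator_def)
  finally show ?thesis using assms(3) by (simp add: Lebesgue_Measure.integrable_restrict_UNIV)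
qed

lemma integrable_imp_locally_integrable:
  assumes "open \<omega>" "integrable (lebesgue_on \<omega>) f" shows "locally_integrable \<omega> f"
  unfolding locally_integrable_def
  using assms by (auto intro!: integrable_subset_lebesgue_on[OF assms(2)] simp: lmeasurable_compact fmeasurableD)

lemma has_weak_deriv_cong_AE:
  assumes "open \<omega>" "has_weak_deriv \<omega> \<beta> u v"
    and u: "AE x in lebesgue_on \<omega>. u x = u' x" and v: "AE x in lebesgue_on \<omega>. v x = v' x"
  shows "has_weak_deriv \<omega> \<beta> u' v'"
proof -
  have \<omega>: "\<omega> \<in> sets lebesgue" using assms(1) by auto
  have li: "locally_integrable \<omega> g'" if g: "locally_integrable \<omega> g" "AE x in lebesgue_on \<omega>. g x = g' x" for g g'
    unfolding locally_integrable_def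
  proof (intro allI impI)
    fix K assume K: "compact K \<and> K \<subseteq> \<omega>"
    then have Ks: "K \<in> sets lebesgue" by (simp add: lmeasurable_compact fmeasurableD)
    have int: "integrable (lebesgue_on K) g" using g(1) K by (simp add: locally_integrable_def)
    have ae: "AE x in lebesgue_on K. g x = g' x"
      using g(2) K Ks \<omega> by (auto simp: AE_restrict_space_iff elim!: eventually_mono)
    show "integrable (lebesgue_on K) g'"
      by (rule integrable_cong_AE_imp[OF int borel_measurable_lebesgue_on_AE[OF Ks _ ae] ae]) (use int in auto)
  qed
  have eq: "(LINT x|lebesgue_on \<omega>. g x * \<phi> x) = (LINT x|lebesgue_on \<omega>. g' x * \<phi> x)"
    if g: "locally_integrable \<omega> g" "AE x in lebesgue_on \<omega>. g x = g' x" and \<phi>: "test_function \<omega> \<phi>" for g g' \<phi>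
    using test_function_integral[OF assms(1) g(1) \<phi>] test_function_integral[OF assms(1) li[OF g] \<phi>] g(2)
    by (intro integral_cong_AE) (auto elim!: eventually_mono)
  have pd: "test_function \<omega> (partial_derivs \<gamma> \<phi>)" if "test_function \<omega> \<phi>" for \<gamma> \<phi>
    by (induction \<gamma>) (simp_all add: partial_derivs_Nil partial_derivs_Cons that test_function_partial_deriv)
  show ?thesis
    using assms(2) li[OF _ u] li[OF _ v] eq[OF _ u pd] eq[OF _ v]
    by (simp add: has_weak_deriv_def)
qed

text \<open>The predicate \<open>P\<close> turns a bound that holds almost everywhere on \<open>\<omega>\<close> into one that the
  representative satisfies at every point.\<close>

lemma lborel_representative_on:
  fixes f :: "'a::euclidean_space \<Rightarrow> real"
  assumes \<omega>: "open \<omega>" and f: "integrable (lebesgue_on \<omega>) f" and P: "AE x in lebesgue_on \<omega>. P (f x)"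
    and "P 0" "{y. P y} \<in> sets borel"
  shows "\<exists>F. integrable lborel F \<and> (\<forall>x. P (F x)) \<and> (AE x in lebesgue. F x = (if x \<in> \<omega> then f x else 0))"
proof -
  have \<omega>': "\<omega> \<in> sets lebesgue" using \<omega> by auto
  let ?f = "\<lambda>x. if x \<in> \<omega> then f x else 0"
  have int: "integrable lebesgue ?f" using f \<omega>' by (simp add: Lebesgue_Measure.integrable_restrict_UNIV)
  obtain q where q [measurable]: "q \<in> borel_measurable borel" and eq: "AE x in lebesgue. ?f x = q x"
    using lborel_representative[of ?f] int by auto
  define F where "F x = (if q x \<in> {y. P y} then q x else 0)" for x
  note [measurable] = \<open>{y. P y} \<in> sets borel\<close>
  have F [measurable]: "F \<in> borel_measurable borel" unfolding F_def by measurable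
  have "AE x in lebesgue. x \<in> \<omega> \<longrightarrow> P (f x)" using P \<omega>' by (simp add: AE_restrict_space_iff)
  with eq have ae: "AE x in lebesgue. ?f x = F x"
    by eventually_elim (use \<open>P 0\<close> in \<open>auto simp: F_def split: if_splits\<close>)
  have "integrable lebesgue F"
    by (rule integrable_cong_AE_imp[OF int _ ae]) (use F in \<open>auto intro: measurable_completion\<close>)
  then have "integrable lborel F" by (simp add: integrable_completion)
  then show ?thesis using ae \<open>P 0\<close> by (intro exI[of _ F]) (auto simp: F_def elim!: eventually_mono)
qed

lemma integral_lborel_representative:
  fixes f F g :: "'a::euclidean_space \<Rightarrow> real"
  assumes \<omega>: "open \<omega>" and F [measurable]: "F \<in> borel_measurable borel"
    and ae: "AE x in lebesgue. F x = (if x \<in> \<omega> then f x else 0)" and g [measurable]: "g \<in> borel_measurable borel"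
  shows "(LINT x|lebesgue_on \<omega>. f x * g x) = (LINT x|lborel. F x * g x)"
proof -
  have \<omega>': "\<omega> \<in> sets lebesgue" using \<omega> by auto
  have "(LINT x|lebesgue_on \<omega>. f x * g x) = (LINT x|lebesgue. (if x \<in> \<omega> then f x * g x else 0))"
    by (simp add: Lebesgue_Measure.integral_restrict_UNIV[OF \<omega>'])
  also have "\<dots> = (LINT x|lebesgue. F x * g x)"
  proof (rule integral_cong_AE)
    have ae': "AE x in lebesgue. F x * g x = (if x \<in> \<omega> then f x * g x else 0)" using ae by eventually_elim simp
    then show "AE x in lebesgue. (if x \<in> \<omega> then f x * g x else 0) = F x * g x" by eventually_elim simp
    show m: "(\<lambda>x. F x * g x) \<in> borel_measurable lebesgue" by (intro measurable_completion) simp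
    show "(\<lambda>x. if x \<in> \<omega> then f x * g x else 0) \<in> borel_measurable lebesgue"
      by (rule borel_measurable_AE[OF m ae'])
  qed
  also have "\<dots> = (LINT x|lborel. F x * g x)" by (rule integral_completion) simp
  finally show ?thesis .
qed

lemma integrable_mult_AE_bounded:
  fixes f g :: "'a \<Rightarrow> real"
  assumes "integrable M f" "g \<in> borel_measurable M" "AE x in M. \<bar>g x\<bar> \<le> B"
  shows "integrable M (\<lambda>x. f x * g x)"
proof (rule Bochner_Integration.integrable_bound)
  show "integrable M (\<lambda>x. B * f x)" using assms by simp
  show "(\<lambda>x. f x * g x) \<in> borel_measurable M" using assms by measurable
  show "AE x in M. norm (f x * g x) \<le> norm (B * f x)"
    using assms(3)
  proof eventually_elim
    case (elim x)
    then have "\<bar>f x\<bar> * \<bar>g x\<bar> \<le> \<bar>f x\<bar> * \<bar>B\<bar>" by (intro mult_left_mono) auto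
    then show ?case by (simp add: abs_mult mult.commute)
  qed
qed

text \<open>Extension by zero and a change on a null set turn the four functions into Borel functions on the whole
  space, two of them bounded everywhere.\<close>

lemma has_weak_deriv_mult:
  fixes u w :: "real^'n \<Rightarrow> real"
  assumes \<omega>: "open \<omega>"
    and u: "has_weak_deriv \<omega> [c] u u'" "integrable (lebesgue_on \<omega>) u" "integrable (lebesgue_on \<omega>) u'"
      "AE x in lebesgue_on \<omega>. \<bar>u x\<bar> \<le> M"
    and w: "has_weak_deriv \<omega> [c] w w'" "integrable (lebesgue_on \<omega>) w" "integrable (lebesgue_on \<omega>) w'"
      "AE x in lebesgue_on \<omega>. \<bar>w x\<bar> \<le> M"
  shows "has_weak_deriv \<omega> [c] (\<lambda>x. u x * w x) (\<lambda>x. u x * w' x + u' x * w x)"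
proof -
  have rep_bounded: "\<exists>F. integrable lborel F \<and> (\<forall>x. \<bar>F x\<bar> \<le> \<bar>M\<bar>) \<and> (AE x in lebesgue. F x = (if x \<in> \<omega> then f x else 0))"
    if "integrable (lebesgue_on \<omega>) f" "AE x in lebesgue_on \<omega>. \<bar>f x\<bar> \<le> M" for f
    using that(2) by (intro lborel_representative_on[OF \<omega> that(1)]) (auto elim!: eventually_mono)
  have rep: "\<exists>F. integrable lborel F \<and> (AE x in lebesgue. F x = (if x \<in> \<omega> then f x else 0))"
    if "integrable (lebesgue_on \<omega>) f" for f :: "real^'n \<Rightarrow> real"
    using lborel_representative_on[OF \<omega> that, of "\<lambda>_. True"] by simp
  obtain U where U_int: "integrable lborel U" and U_bd: "\<forall>x. \<bar>U x\<bar> \<le> \<bar>M\<bar>"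
    and U: "AE x in lebesgue. U x = (if x \<in> \<omega> then u x else 0)"
    using rep_bounded[OF u(2,4)] by blast
  obtain W where W_int: "integrable lborel W" and W_bd: "\<forall>x. \<bar>W x\<bar> \<le> \<bar>M\<bar>"
    and W: "AE x in lebesgue. W x = (if x \<in> \<omega> then w x else 0)"
    using rep_bounded[OF w(2,4)] by blast
  obtain U' where U'_int: "integrable lborel U'" and U': "AE x in lebesgue. U' x = (if x \<in> \<omega> then u' x else 0)"
    using rep[OF u(3)] by blast
  obtain W' where W'_int: "integrable lborel W'" and W': "AE x in lebesgue. W' x = (if x \<in> \<omega> then w' x else 0)"
    using rep[OF w(3)] by blast
  note UW = U_int U'_int W_int W'_int
  have bd: "\<bar>U x\<bar> \<le> \<bar>M\<bar>" "\<bar>W x\<bar> \<le> \<bar>M\<bar>" for x using U_bd W_bd by auto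
  have m [measurable]: "U \<in> borel_measurable borel" "U' \<in> borel_measurable borel"
    "W \<in> borel_measurable borel" "W' \<in> borel_measurable borel"
    using UW by (auto dest: borel_measurable_integrable)
  have weak: "(LINT x|lborel. F x * partial_deriv c \<phi> x) = - (LINT x|lborel. F' x * \<phi> x)"
    if "has_weak_deriv \<omega> [c] f f'" "F \<in> borel_measurable borel" "F' \<in> borel_measurable borel"
      "AE x in lebesgue. F x = (if x \<in> \<omega> then f x else 0)" "AE x in lebesgue. F' x = (if x \<in> \<omega> then f' x else 0)"
      "test_function \<omega> \<phi>" for f f' F F' \<phi>
    using that(1,6) integral_lborel_representative[OF \<omega> that(2,4) test_function_measurable_bounded(1)[OF test_function_partial_deriv[OF that(6)]], of c]
      integral_lborel_representative[OF \<omega> that(3,5) test_function_measurable_bounded(1)[OF that(6)]]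
    by (simp add: has_weak_deriv_def partial_derivs_def)
  have um: "u \<in> borel_measurable (lebesgue_on \<omega>)" "w \<in> borel_measurable (lebesgue_on \<omega>)" using u w by auto
  have "integrable (lebesgue_on \<omega>) (\<lambda>x. w x * u x)" "integrable (lebesgue_on \<omega>) (\<lambda>x. w' x * u x)"
      "integrable (lebesgue_on \<omega>) (\<lambda>x. u' x * w x)"
    using integrable_mult_AE_bounded[OF w(2) um(1) u(4)] integrable_mult_AE_bounded[OF w(3) um(1) u(4)]
      integrable_mult_AE_bounded[OF u(3) um(2) w(4)] by simp_all
  then have int: "integrable (lebesgue_on \<omega>) (\<lambda>x. u x * w x)" "integrable (lebesgue_on \<omega>) (\<lambda>x. u x * w' x + u' x * w x)"
    by (simp_all add: mult.commute)
  have ae: "AE x in lebesgue. U x * W x = (if x \<in> \<omega> then u x * w x else 0)"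
      "AE x in lebesgue. U x * W' x + U' x * W x = (if x \<in> \<omega> then u x * w' x + u' x * w x else 0)"
    using U U' W W' by (eventually_elim, simp)+
  show ?thesis
    unfolding has_weak_deriv_def
  proof (intro conjI allI impI)
    fix \<phi> assume \<phi>: "test_function \<omega> \<phi>"
    have "(LINT x|lborel. U x * W x * partial_deriv c \<phi> x) = - (LINT x|lborel. (U x * W' x + U' x * W x) * \<phi> x)"
      by (rule product_rule_lborel[OF \<omega> UW(1,2) bd(1) weak[OF u(1) m(1,2) U U'] UW(3,4) bd(2) weak[OF w(1) m(3,4) W W'] \<phi>])
    then show "(LINT x|lebesgue_on \<omega>. u x * w x * partial_derivs [c] \<phi> x)
        = (- 1) ^ length [c] * (LINT x|lebesgue_on \<omega>. (u x * w' x + u' x * w x) * \<phi> x)"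
      using integral_lborel_representative[OF \<omega> _ ae(1) test_function_measurable_bounded(1)[OF test_function_partial_deriv[OF \<phi>]], of c]
        integral_lborel_representative[OF \<omega> _ ae(2) test_function_measurable_bounded(1)[OF \<phi>]]
      by (simp add: partial_derivs_def)
  qed (use int integrable_imp_locally_integrable[OF \<omega>] in auto)
qed

definition invariant_along :: "'n \<Rightarrow> (real^'n \<Rightarrow> real) \<Rightarrow> bool" where
  "invariant_along i f \<longleftrightarrow> (\<forall>x t. f (x + t *\<^sub>R axis i 1) = f x)"

lemma invariant_along_partial_deriv_eq_0:
  assumes "invariant_along i f" "smooth f" shows "partial_deriv i f x = 0"
proof -
  have "((\<lambda>t. x + t *\<^sub>R axis i 1) has_derivative (\<lambda>t. t *\<^sub>R axis i 1)) (at (0::real))"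
    by (auto intro!: derivative_eq_intros)
  moreover have "(f has_derivative frechet_derivative f (at x)) (at (x + 0 *\<^sub>R axis i 1))"
    using smooth_has_derivative[OF assms(2)] by simp
  ultimately have "((\<lambda>t. f (x + t *\<^sub>R axis i 1)) has_derivative (\<lambda>t. frechet_derivative f (at x) (t *\<^sub>R axis i 1))) (at 0)"
    by (rule has_derivative_compose)
  moreover have "(\<lambda>t. f (x + t *\<^sub>R axis i 1)) = (\<lambda>t. f x)"
    using assms(1) by (simp add: invariant_along_def)
  ultimately have "((\<lambda>t::real. f x) has_derivative (\<lambda>t. frechet_derivative f (at x) (t *\<^sub>R axis i 1))) (at 0)"
    by simp
  from has_derivative_unique[OF this has_derivative_const]
  have "frechet_derivative f (at x) (1 *\<^sub>R axis i 1) = 0" by (rule fun_cong)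
  then show ?thesis by (simp add: partial_deriv_def)
qed

lemma invariant_along_partial_deriv:
  assumes "invariant_along i f" "smooth f" shows "invariant_along i (partial_deriv j f)"
  unfolding invariant_along_def
proof (intro allI)
  fix x t
  have "f = (\<lambda>y. f (y - t *\<^sub>R axis i 1))"
    using assms(1) unfolding invariant_along_def
    by (metis diff_add_cancel)
  then have "partial_deriv j f (x + t *\<^sub>R axis i 1) = partial_deriv j (\<lambda>y. f (y - t *\<^sub>R axis i 1)) (x + t *\<^sub>R axis i 1)"
    by simp
  also have "\<dots> = partial_deriv j f x"
    using partial_deriv_translate[OF smooth_differentiable[OF assms(2)], of j "t *\<^sub>R axis i 1" "x + t *\<^sub>R axis i 1"] by simp
  finally show "partial_deriv j f (x + t *\<^sub>R axis i 1) = partial_deriv j f x" .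
qed

text \<open>A bump is a product of a factor depending on the coordinate \<open>i\<close> alone and a factor independent of
  it. For \<open>j\<close> different from \<open>i\<close>, both mixed partial derivatives are therefore the product of the
  \<open>i\<close>-derivative of the first and the \<open>j\<close>-derivative of the second factor.\<close>

lemma box_bump_mixed_partials:
  "partial_deriv i (partial_deriv j (box_bump c a b)) = partial_deriv j (partial_deriv i (box_bump c a b))"
proof (cases "i = j")
  case False
  let ?g = "\<lambda>k x. flat 1 (c * x $ k + (- c * a $ k)) * flat 1 ((-c) * x $ k + c * b $ k)"
  define A where "A = ?g i"
  define B where "B = (\<lambda>x. \<Prod>k\<in>UNIV - {i}. ?g k x)"
  have A: "smooth A" unfolding A_def by (intro smooth_mult smooth_flat_affine)
  have B: "smooth B" unfolding B_def by (intro smooth_prod smooth_mult smooth_flat_affine) simp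
  have AB: "box_bump c a b = (\<lambda>x. A x * B x)"
  proof
    fix x
    have "box_bump c a b x = (\<Prod>k\<in>UNIV. ?g k x)" by (simp add: box_bump_def algebra_simps)
    also have "\<dots> = A x * B x" unfolding A_def B_def by (rule prod.remove) auto
    finally show "box_bump c a b x = A x * B x" .
  qed
  have Aj: "invariant_along j A" using False by (simp add: invariant_along_def A_def axis_def)
  have Bi: "invariant_along i B" by (auto simp: invariant_along_def B_def axis_def intro!: prod.cong)
  note smooth = A B smooth_partial_deriv[OF A] smooth_partial_deriv[OF B]
  show ?thesis
    by (simp add: AB partial_deriv_mult smooth_differentiable smooth invariant_along_partial_deriv_eq_0[OF Aj]
        invariant_along_partial_deriv_eq_0[OF Bi] invariant_along_partial_deriv_eq_0[OF invariant_along_partial_deriv[OF Aj]]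
        invariant_along_partial_deriv_eq_0[OF invariant_along_partial_deriv[OF Bi]])
qed simp

text \<open>A locally integrable function is determined by its integrals against bumps, and the mixed partial
  derivatives of a bump agree because of its product form.\<close>

lemma weak_mixed_partials_AE:
  fixes u :: "real^'n \<Rightarrow> real"
  assumes "open \<omega>" "has_weak_deriv \<omega> [i, j] u v" "has_weak_deriv \<omega> [j, i] u v'"
  shows "AE x in lebesgue_on \<omega>. v x = v' x"
proof -
  have li: "locally_integrable \<omega> v" "locally_integrable \<omega> v'"
    using assms by (auto simp: has_weak_deriv_def)
  have "AE x in lebesgue_on \<omega>. v x - v' x = 0"
  proof (rule fundamental_lemma_of_variations[OF \<open>open \<omega>\<close> locally_integrable_diff[OF li]])
    fix n a b assume "cbox a b \<subseteq> \<omega>"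
    then have t: "test_function \<omega> (box_bump (real (Suc n)) a b)" by (intro test_function_box_bump) auto
    have "(LINT x|lebesgue_on \<omega>. v x * box_bump (real (Suc n)) a b x)
        = (LINT x|lebesgue_on \<omega>. v' x * box_bump (real (Suc n)) a b x)"
      using assms(2,3) t box_bump_mixed_partials[of i j "real (Suc n)" a b]
      by (simp add: has_weak_deriv_def partial_derivs_def del: of_nat_Suc) metis
    then show "(LINT x|lebesgue_on \<omega>. (v x - v' x) * box_bump (real (Suc n)) a b x) = 0"
      unfolding left_diff_distrib
      using Bochner_Integration.integral_diff[OF test_function_integral[OF assms(1) li(1) t] test_function_integral[OF assms(1) li(2) t]]
      by simp
  qed
  then show ?thesis by eventually_elim simp
qed

text \<open>Integrate by parts against the test function \<open>\<partial>\<^sub>j \<phi>\<close>. In the list \<open>[i, j]\<close> the derivative \<open>\<partial>\<^sub>i\<close>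
  acts on the test function last, hence on \<open>u\<close> first.\<close>

lemma has_weak_deriv_of_weak_deriv:
  assumes "has_weak_deriv \<omega> [i] u w" "has_weak_deriv \<omega> [i, j] u v"
  shows "has_weak_deriv \<omega> [j] w v"
  unfolding has_weak_deriv_def
proof (intro conjI allI impI)
  fix \<phi> assume \<phi>: "test_function \<omega> \<phi>"
  have "(LINT x|lebesgue_on \<omega>. u x * partial_deriv i (partial_deriv j \<phi>) x) = - (LINT x|lebesgue_on \<omega>. w x * partial_deriv j \<phi> x)"
    using assms(1) test_function_partial_deriv[OF \<phi>, of j] by (simp add: has_weak_deriv_def partial_derivs_def)
  moreover have "(LINT x|lebesgue_on \<omega>. u x * partial_deriv i (partial_deriv j \<phi>) x) = (LINT x|lebesgue_on \<omega>. v x * \<phi> x)"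
    using assms(2) \<phi> by (simp add: has_weak_deriv_def partial_derivs_def)
  ultimately show "(LINT x|lebesgue_on \<omega>. w x * partial_derivs [j] \<phi> x) = (- 1) ^ length [j] * (LINT x|lebesgue_on \<omega>. v x * \<phi> x)"
    by (simp add: partial_derivs_def)
qed (use assms in \<open>auto simp: has_weak_deriv_def\<close>)

lemma has_weak_deriv_add:
  fixes u w :: "real^'n \<Rightarrow> real"
  assumes "open \<omega>" "has_weak_deriv \<omega> [c] u u'" "has_weak_deriv \<omega> [c] w w'"
  shows "has_weak_deriv \<omega> [c] (\<lambda>x. u x + w x) (\<lambda>x. u' x + w' x)"
  unfolding has_weak_deriv_def
proof (intro conjI allI impI)
  have li: "locally_integrable \<omega> u" "locally_integrable \<omega> w" "locally_integrable \<omega> u'" "locally_integrable \<omega> w'"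
    using assms by (auto simp: has_weak_deriv_def)
  then show "locally_integrable \<omega> (\<lambda>x. u x + w x)" "locally_integrable \<omega> (\<lambda>x. u' x + w' x)"
    by (simp_all add: locally_integrable_def)
  fix \<phi> assume \<phi>: "test_function \<omega> \<phi>"
  note int = test_function_integral[OF assms(1) _ \<phi>] test_function_integral[OF assms(1) _ test_function_partial_deriv[OF \<phi>]]
  have "(LINT x|lebesgue_on \<omega>. u x * partial_deriv c \<phi> x) = - (LINT x|lebesgue_on \<omega>. u' x * \<phi> x)"
    "(LINT x|lebesgue_on \<omega>. w x * partial_deriv c \<phi> x) = - (LINT x|lebesgue_on \<omega>. w' x * \<phi> x)"
    using assms(2,3) \<phi> by (simp_all add: has_weak_deriv_def partial_derivs_def)
  then show "(LINT x|lebesgue_on \<omega>. (u x + w x) * partial_derivs [c] \<phi> x) = (- 1) ^ length [c] * (LINT x|lebesgue_on \<omega>. (u' x + w' x) * \<phi> x)"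
    by (simp add: partial_derivs_def distrib_right int li)
qed

lemma has_weak_deriv_sum:
  fixes u :: "'k \<Rightarrow> real^'n \<Rightarrow> real"
  assumes "open \<omega>" "finite I" "\<And>k. k \<in> I \<Longrightarrow> has_weak_deriv \<omega> [c] (u k) (u' k)"
  shows "has_weak_deriv \<omega> [c] (\<lambda>x. \<Sum>k\<in>I. u k x) (\<lambda>x. \<Sum>k\<in>I. u' k x)"
  using assms(2,3)
proof (induction I rule: finite_induct)
  case empty
  then show ?case by (simp add: has_weak_deriv_def locally_integrable_def)
next
  case (insert k I)
  then show ?case by (simp add: has_weak_deriv_add[OF assms(1)])
qed

section \<open>Classical derivatives are weak derivatives\<close>

text \<open>All difference quotients of \<open>F\<close> in the direction \<open>e\<close> have integral zero by translation invariance.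
  The mean value theorem bounds them by \<open>B\<close>, and they vanish outside a ball, so the limit may be taken
  under the integral.\<close>

lemma integral_directional_derivative_eq_0:
  fixes F :: "'a::euclidean_space \<Rightarrow> real"
  assumes F: "\<And>x. (F has_derivative F' x) (at x)" and K: "compact K" "\<And>x. x \<notin> K \<Longrightarrow> F x = 0"
    and B: "\<And>x. \<bar>F' x e\<bar> \<le> B" and e: "norm e = 1"
  shows "(LINT x|lborel. F' x e) = 0"
proof -
  have line: "((\<lambda>s. F (x + s *\<^sub>R e)) has_real_derivative F' (x + s *\<^sub>R e) e) (at s)" for x s
  proof -
    have "((\<lambda>s. x + s *\<^sub>R e) has_derivative (\<lambda>s. s *\<^sub>R e)) (at s)" by (auto intro!: derivative_eq_intros)
    from has_derivative_compose[OF this F]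
    have "((\<lambda>s. F (x + s *\<^sub>R e)) has_derivative (\<lambda>h. F' (x + s *\<^sub>R e) (h *\<^sub>R e))) (at s)" .
    moreover have "F' y (h *\<^sub>R e) = F' y e * h" for y h
      using has_derivative_linear[OF F[of y]] by (simp add: linear_scale)
    ultimately show ?thesis by (simp add: has_field_derivative_def)
  qed
  define t where "t n = inverse (real (Suc n))" for n
  have t: "t n > 0" "t n \<le> 1" "t \<longlonglongrightarrow> 0" for n
    unfolding t_def by (simp, simp add: divide_simps, rule LIMSEQ_inverse_real_of_nat)
  define q where "q n x = (F (x + t n *\<^sub>R e) - F x) / t n" for n x
  have cont: "continuous_on UNIV F"
    using F by (intro continuous_at_imp_continuous_on ballI has_derivative_continuous) auto
  then have [measurable]: "F \<in> borel_measurable borel" by (rule borel_measurable_continuous_onI)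
  have "(\<lambda>x. indicator K x *\<^sub>R F x) = F" using K(2) by (auto simp: fun_eq_iff indicator_def)
  then have F_int: "integrable lborel F"
    using borel_integrable_compact[OF K(1) continuous_on_subset[OF cont subset_UNIV]] by simp
  have q_lim: "(\<lambda>n. q n x) \<longlonglongrightarrow> F' x e" for x
  proof -
    have "((\<lambda>h. (F (x + h *\<^sub>R e) - F x) / h) \<longlongrightarrow> F' x e) (at 0)"
      using line[of x 0] by (simp add: DERIV_def)
    moreover have "filterlim t (at 0) sequentially"
      using t by (auto simp: filterlim_at intro!: always_eventually less_imp_neq[symmetric])
    ultimately show ?thesis unfolding q_def by (rule filterlim_compose)
  qed
  obtain R where R: "\<And>x. x \<in> K \<Longrightarrow> norm x \<le> R"
    using compact_imp_bounded[OF K(1)] by (auto simp: bounded_iff)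
  have q_bd: "norm (q n x) \<le> indicator (cball 0 (R + 1)) x * B" for n x
  proof (cases "x \<in> cball 0 (R + 1)")
    case True
    have "\<exists>z>0. z < t n \<and> F (x + t n *\<^sub>R e) - F (x + 0 *\<^sub>R e) = (t n - 0) * F' (x + z *\<^sub>R e) e"
      by (rule MVT2[OF t(1)]) (rule line)
    then obtain z where "F (x + t n *\<^sub>R e) - F x = t n * F' (x + z *\<^sub>R e) e" by auto
    then show ?thesis using B[of "x + z *\<^sub>R e"] t(1)[of n] True by (simp add: q_def)
  next
    case False
    then have "x \<notin> K" using R[of x] by auto
    moreover have "x + t n *\<^sub>R e \<notin> K"
    proof
      assume "x + t n *\<^sub>R e \<in> K"
      from R[OF this] have "norm x \<le> R + norm (t n *\<^sub>R e)" using norm_triangle_ineq4[of "x + t n *\<^sub>R e" "t n *\<^sub>R e"] by simp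
      with False t(1,2)[of n] e show False by simp
    qed
    ultimately show ?thesis using K(2) False by (simp add: q_def)
  qed
  have "(\<lambda>n. LINT x|lborel. q n x) \<longlonglongrightarrow> (LINT x|lborel. F' x e)"
  proof (rule integral_dominated_convergence[where w = "\<lambda>x. indicator (cball 0 (R + 1)) x * B"])
    show m: "q n \<in> borel_measurable lborel" for n unfolding q_def by measurable
    show "(\<lambda>x. F' x e) \<in> borel_measurable lborel"
      by (rule borel_measurable_LIMSEQ_real[OF _ m]) (rule q_lim)
    show "integrable lborel (\<lambda>x::'a. indicator (cball 0 (R + 1)) x * B)"
      using emeasure_lborel_cball_finite[of "0::'a" "R + 1"] by (intro integrable_mult_left integrable_real_indicator) auto
  qed (use q_lim q_bd in auto)
  moreover have "(LINT x|lborel. q n x) = 0" for n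
    using lborel_translate[of F "t n *\<^sub>R e"] F_int by (simp add: q_def)
  ultimately show ?thesis by (simp add: LIMSEQ_const_iff)
qed

lemma locally_integrable_continuous:
  fixes f :: "real^'n \<Rightarrow> real"
  assumes "continuous_on \<omega> f" shows "locally_integrable \<omega> f"
  unfolding locally_integrable_def
proof (intro allI impI)
  fix K assume K: "compact K \<and> K \<subseteq> \<omega>"
  then have "integrable lborel (\<lambda>x. indicator K x *\<^sub>R f x)"
    using assms continuous_on_subset by (intro borel_integrable_compact) auto
  then have "integrable lebesgue (\<lambda>x. indicator K x *\<^sub>R f x)"
    by (subst integrable_completion) (auto dest: borel_measurable_integrable)
  then show "integrable (lebesgue_on K) f"
    using K by (subst integrable_restrict_space) (auto simp: lmeasurable_compact fmeasurableD)
qed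

text \<open>The product \<open>u \<phi>\<close>, extended by zero, is differentiable on the whole space and has compact support,
  so its partial derivative has integral zero.\<close>

lemma has_weak_deriv_classical:
  fixes u :: "real^'n \<Rightarrow> real"
  assumes \<omega>: "open \<omega>" and u: "\<And>x. x \<in> \<omega> \<Longrightarrow> (u has_derivative D x) (at x)"
    and cont: "continuous_on \<omega> (\<lambda>x. D x (axis i 1))"
  shows "has_weak_deriv \<omega> [i] u (\<lambda>x. D x (axis i 1))"
  unfolding has_weak_deriv_def
proof (intro conjI allI impI)
  have ucont: "continuous_on \<omega> u"
    using u by (intro continuous_at_imp_continuous_on ballI has_derivative_continuous) auto
  show li: "locally_integrable \<omega> u" "locally_integrable \<omega> (\<lambda>x. D x (axis i 1))"
    by (intro locally_integrable_continuous ucont cont)+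
  fix \<phi> assume \<phi>: "test_function \<omega> \<phi>"
  obtain K where K: "compact K" "K \<subseteq> \<omega>" "\<forall>x. x \<notin> K \<longrightarrow> \<phi> x = 0 \<and> (\<forall>i. partial_deriv i \<phi> x = 0)"
    using test_function_support[OF \<phi>] by blast
  define F where "F x = (if x \<in> \<omega> then u x * \<phi> x else 0)" for x
  define F' where "F' x = (if x \<in> \<omega> then (\<lambda>h. u x * frechet_derivative \<phi> (at x) h + D x h * \<phi> x) else (\<lambda>h. 0))" for x
  have F: "(F has_derivative F' x) (at x)" for x
  proof (cases "x \<in> \<omega>")
    case True
    have "((\<lambda>x. u x * \<phi> x) has_derivative F' x) (at x)"
      using has_derivative_mult[OF u[OF True] smooth_has_derivative[OF test_function_smooth[OF \<phi>]]] True
      by (simp add: F'_def)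
    then show ?thesis
      by (rule has_derivative_transform_within_open[OF _ \<omega> True]) (simp add: F_def)
  next
    case False
    then have "x \<in> - K" using K(2) by auto
    have "((\<lambda>x. 0) has_derivative F' x) (at x)" using False by (simp add: F'_def)
    then show ?thesis
      by (rule has_derivative_transform_within_open[OF _ _ \<open>x \<in> - K\<close>])
        (use K in \<open>auto simp: F_def compact_imp_closed\<close>)
  qed
  have F0: "F x = 0" if "x \<notin> K" for x using K(3) that by (simp add: F_def)
  have p: "F' x (axis i 1) = (if x \<in> K then u x * partial_deriv i \<phi> x + D x (axis i 1) * \<phi> x else 0)" for x
    using K(2,3) by (auto simp: F'_def partial_deriv_def[symmetric])
  have "continuous_on K (\<lambda>x. u x * partial_deriv i \<phi> x + D x (axis i 1) * \<phi> x)"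
    using continuous_on_subset[OF ucont K(2)] continuous_on_subset[OF cont K(2)]
      smooth_continuous[OF test_function_smooth[OF \<phi>]] smooth_continuous[OF smooth_partial_deriv[OF test_function_smooth[OF \<phi>]]]
    by (intro continuous_intros) auto
  from compact_imp_bounded[OF compact_continuous_image[OF this K(1)]]
  obtain B where B: "\<And>x. x \<in> K \<Longrightarrow> \<bar>u x * partial_deriv i \<phi> x + D x (axis i 1) * \<phi> x\<bar> \<le> B"
    by (auto simp: bounded_iff)
  have "\<bar>F' x (axis i 1)\<bar> \<le> max B 0" for x using B[of x] by (auto simp: p)
  from integral_directional_derivative_eq_0[OF F K(1) F0 this]
  have I0: "(LINT x|lborel. F' x (axis i 1)) = 0" by simp
  have ae: "AE x in lebesgue. F' x (axis i 1) = (if x \<in> \<omega> then u x * partial_deriv i \<phi> x + D x (axis i 1) * \<phi> x else 0)"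
    using K(2,3) by (intro AE_I2) (auto simp: p)
  have "(\<lambda>x. if x \<in> K then u x * partial_deriv i \<phi> x + D x (axis i 1) * \<phi> x else 0) \<in> borel_measurable borel"
    using \<open>continuous_on K _\<close> compact_imp_closed[OF K(1)]
    by (intro borel_measurable_continuous_on_if) auto
  then have m: "(\<lambda>x. F' x (axis i 1)) \<in> borel_measurable borel" by (simp add: p)
  have "(LINT x|lebesgue_on \<omega>. (u x * partial_deriv i \<phi> x + D x (axis i 1) * \<phi> x) * 1) = (LINT x|lborel. F' x (axis i 1) * 1)"
    by (rule integral_lborel_representative[OF \<omega> m ae]) simp
  then have "(LINT x|lebesgue_on \<omega>. u x * partial_deriv i \<phi> x + D x (axis i 1) * \<phi> x) = 0"
    using I0 by simp
  moreover note Bochner_Integration.integral_add[OF test_function_integral[OF \<omega> li(1) test_function_partial_deriv[OF \<phi>]]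
      test_function_integral[OF \<omega> li(2) \<phi>], of i]
  ultimately show "(LINT x|lebesgue_on \<omega>. u x * partial_derivs [i] \<phi> x)
      = (- 1) ^ length [i] * (LINT x|lebesgue_on \<omega>. D x (axis i 1) * \<phi> x)"
    by (simp add: partial_derivs_def)
qed

section \<open>Weak derivatives of Sobolev parametrizations\<close>

lemma L2_integrable:
  fixes u :: "real^'n \<Rightarrow> real"
  assumes "open \<omega>" "bounded \<omega>" "L2 \<omega> u" shows "integrable (lebesgue_on \<omega>) u"
proof (rule Bochner_Integration.integrable_bound)
  have "\<omega> \<in> lmeasurable" using assms(1,2) by (rule lmeasurable_open[rotated])
  then interpret finite_measure "lebesgue_on \<omega>" by (rule finite_measure_lebesgue_on)
  show "integrable (lebesgue_on \<omega>) (\<lambda>x. 1 + (norm (u x))\<^sup>2)" using assms(3) by (simp add: L2_def)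
  show "AE x in lebesgue_on \<omega>. norm (u x) \<le> norm (1 + (norm (u x))\<^sup>2)"
  proof (rule AE_I2)
    fix x
    show "norm (u x) \<le> norm (1 + (norm (u x))\<^sup>2)"
      using sum_squares_bound[of "norm (u x)" 1] by simp
  qed
qed (use assms in \<open>simp add: L2_def\<close>)

lemma L2_mult_integrable:
  fixes u v :: "real^'n \<Rightarrow> real"
  assumes "L2 \<omega> u" "L2 \<omega> v" shows "integrable (lebesgue_on \<omega>) (\<lambda>x. u x * v x)"
proof (rule Bochner_Integration.integrable_bound)
  show "integrable (lebesgue_on \<omega>) (\<lambda>x. (norm (u x))\<^sup>2 + (norm (v x))\<^sup>2)" using assms by (simp add: L2_def)
  show "AE x in lebesgue_on \<omega>. norm (u x * v x) \<le> norm ((norm (u x))\<^sup>2 + (norm (v x))\<^sup>2)"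
  proof (rule AE_I2)
    fix x
    have "2 * \<bar>u x\<bar> * \<bar>v x\<bar> \<le> \<bar>u x\<bar>\<^sup>2 + \<bar>v x\<bar>\<^sup>2" by (rule sum_squares_bound)
    moreover have "0 \<le> \<bar>u x\<bar> * \<bar>v x\<bar>" by simp
    ultimately have "\<bar>u x\<bar> * \<bar>v x\<bar> \<le> \<bar>u x\<bar>\<^sup>2 + \<bar>v x\<bar>\<^sup>2" by linarith
    then show "norm (u x * v x) \<le> norm ((norm (u x))\<^sup>2 + (norm (v x))\<^sup>2)" by (simp add: abs_mult)
  qed
qed (use assms in \<open>auto simp: L2_def\<close>)

text \<open>The chosen representative agrees almost everywhere with a square integrable weak derivative,
  by uniqueness, and is therefore itself square integrable.\<close>

lemma sobolev_weak_deriv: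
  assumes \<omega>: "open \<omega>" and "sobolev_H k \<omega> \<psi>" "length \<beta> \<le> k"
  shows "has_weak_deriv \<omega> \<beta> (\<lambda>y. \<psi> y $ m) (\<lambda>x. weak_deriv_vec \<omega> \<beta> \<psi> x $ m)"
    and "L2 \<omega> (\<lambda>x. weak_deriv_vec \<omega> \<beta> \<psi> x $ m)"
proof -
  let ?w = "\<lambda>x. weak_deriv_vec \<omega> \<beta> \<psi> x $ m"
  obtain v where v: "has_weak_deriv \<omega> \<beta> (\<lambda>y. \<psi> y $ m) v" "L2 \<omega> v"
    using assms by (auto simp: sobolev_H_def)
  have "has_weak_deriv \<omega> \<beta> (\<lambda>y. \<psi> y $ m) (weak_deriv \<omega> \<beta> (\<lambda>y. \<psi> y $ m))"
    unfolding weak_deriv_def by (rule someI[of _ v]) (rule v(1))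
  then show w: "has_weak_deriv \<omega> \<beta> (\<lambda>y. \<psi> y $ m) ?w" by (simp add: weak_deriv_vec_def)
  have ae: "AE x in lebesgue_on \<omega>. v x = ?w x" by (rule weak_deriv_unique_AE[OF \<omega> v(1) w])
  have m: "?w \<in> borel_measurable (lebesgue_on \<omega>)"
    using \<omega> v(2) by (intro borel_measurable_lebesgue_on_AE[OF _ _ ae]) (auto simp: L2_def)
  have "integrable (lebesgue_on \<omega>) (\<lambda>x. (norm (?w x))\<^sup>2)"
  proof (rule integrable_cong_AE_imp)
    show "integrable (lebesgue_on \<omega>) (\<lambda>x. (norm (v x))\<^sup>2)" using v(2) by (simp add: L2_def)
    show "AE x in lebesgue_on \<omega>. (norm (v x))\<^sup>2 = (norm (?w x))\<^sup>2" using ae by eventually_elim simp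
  qed (use m in simp)
  with m show "L2 \<omega> ?w" by (simp add: L2_def)
qed

lemma first_form_nth: "first_form \<omega> \<psi> x $ a $ b = weak_deriv_vec \<omega> [a] \<psi> x \<bullet> weak_deriv_vec \<omega> [b] \<psi> x"
  by (simp add: first_form_def matrix_matrix_mult_def transpose_def weak_jacobian_def inner_vec_def)

text \<open>With the Gram matrix written as \<open>[[E, F], [F, H]]\<close>, evaluating its quadratic form at \<open>(F, - E)\<close> gives
  \<open>E * (E * H - F * F)\<close>.\<close>

lemma det_gram_pos:
  fixes G :: "real^2^3"
  assumes "rank G = 2" shows "det (transpose G ** G) > 0"
proof -
  have "inj ((*v) G)" using assms by (simp add: full_rank_injective[symmetric])
  then have pos: "(G *v x) \<bullet> (G *v x) > 0" if "x \<noteq> 0" for x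
    using that by (metis inner_gt_zero_iff injD matrix_vector_mult_0_right)
  define E F H where "E = (\<Sum>m\<in>UNIV. G $ m $ 1 * G $ m $ 1)" and "F = (\<Sum>m\<in>UNIV. G $ m $ 1 * G $ m $ 2)"
    and "H = (\<Sum>m\<in>UNIV. G $ m $ 2 * G $ m $ 2)"
  have q: "(G *v x) \<bullet> (G *v x) = E * (x $ 1)\<^sup>2 + 2 * F * x $ 1 * x $ 2 + H * (x $ 2)\<^sup>2" for x
    by (simp add: E_def F_def H_def inner_vec_def matrix_vector_mult_def sum_2 sum_3 power2_eq_square algebra_simps)
  have E: "E > 0" using pos[of "axis 1 1"] by (simp add: q axis_def vec_eq_iff forall_2)
  have "vector [F, - E] \<noteq> (0 :: real^2)" using E by (simp add: vec_eq_iff forall_2 vector_2)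
  from pos[OF this] have "E * (E * H - F * F) > 0" by (simp add: q vector_2 power2_eq_square algebra_simps)
  then have "E * H - F * F > 0" using E by (simp add: zero_less_mult_iff)
  moreover have "det (transpose G ** G) = E * H - F * F"
    by (simp add: det_2 matrix_matrix_mult_def transpose_def E_def F_def H_def mult.commute)
  ultimately show ?thesis by simp
qed

text \<open>The Jacobian of the representative in \<open>C\<^sup>1(closure \<omega>)\<close> coincides almost everywhere with the weak one.
  It is continuous on a compact set, so its norm is bounded and the positive Gram determinant
  attains its minimum.\<close>

lemma regular_bounds:
  assumes \<omega>: "open \<omega>" "bounded \<omega>" and "sobolev_H k \<omega> \<psi>" "k \<ge> 1" "injective_regular \<omega> \<psi>"
  shows "\<exists>M \<delta>. \<delta> > 0 \<and> (AE x in lebesgue_on \<omega>. (\<forall>a. norm (weak_deriv_vec \<omega> [a] \<psi> x) \<le> M) \<and> det (first_form \<omega> \<psi> x) \<ge> \<delta>)"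
proof -
  obtain \<Psi> G where C1: "C1_closure \<omega> \<Psi> G" and eq: "AE x in lebesgue_on \<omega>. \<psi> x = \<Psi> x"
    and rank: "\<And>x. x \<in> closure \<omega> \<Longrightarrow> rank (G x) = 2"
    using assms(5) by (auto simp: injective_regular_def)
  have G: "continuous_on (closure \<omega>) G" and \<Psi>: "\<And>x. x \<in> \<omega> \<Longrightarrow> (\<Psi> has_derivative (\<lambda>h. G x *v h)) (at x)"
    using C1 by (auto simp: C1_closure_def)
  have "AE x in lebesgue_on \<omega>. weak_deriv_vec \<omega> [a] \<psi> x $ m = G x $ m $ a" for a m
  proof -
    have "has_weak_deriv \<omega> [a] (\<lambda>x. \<Psi> x $ m) (\<lambda>x. (G x *v axis a 1) $ m)"
    proof (rule has_weak_deriv_classical[OF \<omega>(1)])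
      show "((\<lambda>x. \<Psi> x $ m) has_derivative (\<lambda>h. (G x *v h) $ m)) (at x)" if "x \<in> \<omega>" for x
        by (rule bounded_linear.has_derivative[OF bounded_linear_vec_nth \<Psi>[OF that]])
      show "continuous_on \<omega> (\<lambda>x. (G x *v axis a 1) $ m)"
        using continuous_on_subset[OF G closure_subset]
        by (simp add: matrix_vector_mul_component inner_axis) (intro continuous_intros)
    qed
    then have "has_weak_deriv \<omega> [a] (\<lambda>x. \<psi> x $ m) (\<lambda>x. (G x *v axis a 1) $ m)"
      by (rule has_weak_deriv_cong_AE[OF \<omega>(1)]) (use eq in \<open>auto elim!: eventually_mono\<close>)
    from weak_deriv_unique_AE[OF \<omega>(1) sobolev_weak_deriv(1)[OF \<omega>(1) assms(3)] this] assms(4)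
    show ?thesis by (simp add: matrix_vector_mul_component inner_axis)
  qed
  then have ae: "AE x in lebesgue_on \<omega>. \<forall>a m. weak_deriv_vec \<omega> [a] \<psi> x $ m = G x $ m $ a"
    by (simp add: AE_all_countable)
  have comp: "compact (closure \<omega>)" using \<omega>(2) by simp
  obtain M where M: "\<And>x. x \<in> closure \<omega> \<Longrightarrow> norm (\<chi> m. G x $ m $ 1) \<le> M \<and> norm (\<chi> m. G x $ m $ 2) \<le> M"
  proof -
    have c: "continuous_on (closure \<omega>) (\<lambda>x. \<chi> m. G x $ m $ a)" for a
      using G by (intro continuous_on_vec_lambda continuous_intros)
    have "\<exists>M. \<forall>x\<in>closure \<omega>. norm (\<chi> m. G x $ m $ a) \<le> M" for a
      using compact_imp_bounded[OF compact_continuous_image[OF c comp]] by (auto simp: bounded_iff)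
    then obtain M1 M2 where "\<forall>x\<in>closure \<omega>. norm (\<chi> m. G x $ m $ 1) \<le> M1" "\<forall>x\<in>closure \<omega>. norm (\<chi> m. G x $ m $ 2) \<le> M2"
      by meson
    then show thesis by (intro that[of "max M1 M2"]) (auto simp: le_max_iff_disj)
  qed
  obtain \<delta> where \<delta>: "\<delta> > 0" "\<And>x. x \<in> closure \<omega> \<Longrightarrow> \<delta> \<le> det (transpose (G x) ** G x)"
  proof (cases "closure \<omega> = {}")
    case True
    then show thesis using that[of 1] by simp
  next
    case False
    have "continuous_on (closure \<omega>) (\<lambda>x. det (transpose (G x) ** G x))"
      unfolding det_2 matrix_matrix_mult_def transpose_def by (simp add: sum_3) (intro continuous_intros G)
    from continuous_attains_inf[OF comp False this] obtain x0 where
      "x0 \<in> closure \<omega>" "\<And>x. x \<in> closure \<omega> \<Longrightarrow> det (transpose (G x0) ** G x0) \<le> det (transpose (G x) ** G x)" by blast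
    then show thesis using that det_gram_pos[OF rank] by blast
  qed
  have "AE x in lebesgue_on \<omega>. (\<forall>a. norm (weak_deriv_vec \<omega> [a] \<psi> x) \<le> M) \<and> det (first_form \<omega> \<psi> x) \<ge> \<delta>"
    using ae AE_space
  proof eventually_elim
    case (elim x)
    have x: "x \<in> closure \<omega>" using elim(2) closure_subset by auto
    have d: "weak_deriv_vec \<omega> [a] \<psi> x = (\<chi> m. G x $ m $ a)" for a
      using elim(1) by (simp add: vec_eq_iff)
    have "weak_jacobian \<omega> \<psi> x = G x" using elim(1) by (simp add: weak_jacobian_def vec_eq_iff)
    then show ?case using M[OF x] \<delta>(2)[OF x] by (simp add: d forall_2 first_form_def)
  qed
  with \<delta>(1) show ?thesis by blast
qed

lemma first_form_weak_deriv:
  fixes \<psi> :: "real^2 \<Rightarrow> real^3"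
  assumes \<omega>: "open \<omega>" "bounded \<omega>" and \<psi>: "sobolev_H 2 \<omega> \<psi>"
    and M: "AE x in lebesgue_on \<omega>. \<forall>a. norm (weak_deriv_vec \<omega> [a] \<psi> x) \<le> M"
  shows "has_weak_deriv \<omega> [c] (\<lambda>x. first_form \<omega> \<psi> x $ a $ b)
    (\<lambda>x. weak_deriv_vec \<omega> [a] \<psi> x \<bullet> weak_deriv_vec \<omega> [b, c] \<psi> x + weak_deriv_vec \<omega> [a, c] \<psi> x \<bullet> weak_deriv_vec \<omega> [b] \<psi> x)"
proof -
  let ?W = "\<lambda>a m x. weak_deriv_vec \<omega> [a] \<psi> x $ m" and ?V = "\<lambda>a b m x. weak_deriv_vec \<omega> [a, b] \<psi> x $ m"
  have W: "has_weak_deriv \<omega> [c] (?W a m) (?V a c m)" for a m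
    by (rule has_weak_deriv_of_weak_deriv[OF sobolev_weak_deriv(1)[OF \<omega>(1) \<psi>] sobolev_weak_deriv(1)[OF \<omega>(1) \<psi>]]) simp_all
  have int: "integrable (lebesgue_on \<omega>) (?W a m)" "integrable (lebesgue_on \<omega>) (?V a c m)" for a m
    by (rule L2_integrable[OF \<omega> sobolev_weak_deriv(2)[OF \<omega>(1) \<psi>]], simp)+
  have bd: "AE x in lebesgue_on \<omega>. \<bar>?W a m x\<bar> \<le> M" for a m
    using M by eventually_elim (meson component_le_norm_cart order_trans)
  have "has_weak_deriv \<omega> [c] (\<lambda>x. \<Sum>m\<in>UNIV. ?W a m x * ?W b m x) (\<lambda>x. \<Sum>m\<in>UNIV. ?W a m x * ?V b c m x + ?V a c m x * ?W b m x)"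
    by (rule has_weak_deriv_sum[OF \<omega>(1) finite]) (rule has_weak_deriv_mult[OF \<omega>(1) W int bd W int bd])
  then show ?thesis by (simp add: first_form_nth inner_vec_def sum.distrib)
qed

lemma second_weak_derivs_symmetric:
  assumes \<omega>: "open \<omega>" and \<psi>: "sobolev_H 2 \<omega> \<psi>"
  shows "AE x in lebesgue_on \<omega>. \<forall>i j. weak_deriv_vec \<omega> [i, j] \<psi> x = weak_deriv_vec \<omega> [j, i] \<psi> x"
proof -
  have "AE x in lebesgue_on \<omega>. weak_deriv_vec \<omega> [i, j] \<psi> x $ m = weak_deriv_vec \<omega> [j, i] \<psi> x $ m" for i j m
    by (rule weak_mixed_partials_AE[OF \<omega> sobolev_weak_deriv(1)[OF \<omega> \<psi>] sobolev_weak_deriv(1)[OF \<omega> \<psi>]]) auto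
  then show ?thesis by (simp add: vec_eq_iff AE_all_countable)
qed

text \<open>The tangential components of the second derivatives are the Christoffel symbols of the first kind:
  \<open>2 \<partial>\<^sub>i\<partial>\<^sub>j\<psi> \<bullet> \<partial>\<^sub>k\<psi> = \<partial>\<^sub>i g\<^sub>j\<^sub>k + \<partial>\<^sub>j g\<^sub>i\<^sub>k - \<partial>\<^sub>k g\<^sub>i\<^sub>j\<close>. They depend on the metric alone.\<close>

lemma tangential_parts_determined:
  fixes \<psi> \<psi>' :: "real^2 \<Rightarrow> real^3"
  assumes \<omega>: "open \<omega>" "bounded \<omega>" and \<psi>: "sobolev_H 2 \<omega> \<psi>" "sobolev_H 2 \<omega> \<psi>'"
    and M: "AE x in lebesgue_on \<omega>. \<forall>a. norm (weak_deriv_vec \<omega> [a] \<psi> x) \<le> M"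
    and iso: "AE x in lebesgue_on \<omega>. first_form \<omega> \<psi>' x = first_form \<omega> \<psi> x"
  shows "AE x in lebesgue_on \<omega>. \<forall>i j k. weak_deriv_vec \<omega> [i, j] \<psi>' x \<bullet> weak_deriv_vec \<omega> [k] \<psi>' x
    = weak_deriv_vec \<omega> [i, j] \<psi> x \<bullet> weak_deriv_vec \<omega> [k] \<psi> x"
proof -
  have M': "AE x in lebesgue_on \<omega>. \<forall>a. norm (weak_deriv_vec \<omega> [a] \<psi>' x) \<le> M"
    using M iso
  proof eventually_elim
    case (elim x)
    have "norm (weak_deriv_vec \<omega> [a] \<psi>' x) = norm (weak_deriv_vec \<omega> [a] \<psi> x)" for a
      using elim(2) first_form_nth[of \<omega> \<psi> x a a] first_form_nth[of \<omega> \<psi>' x a a] by (simp add: norm_eq_sqrt_inner)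
    with elim(1) show ?case by simp
  qed
  let ?D = "\<lambda>\<psi> c a b x. weak_deriv_vec \<omega> [a] \<psi> x \<bullet> weak_deriv_vec \<omega> [b, c] \<psi> x + weak_deriv_vec \<omega> [a, c] \<psi> x \<bullet> weak_deriv_vec \<omega> [b] \<psi> x"
  have "AE x in lebesgue_on \<omega>. ?D \<psi>' c a b x = ?D \<psi> c a b x" for a b c
  proof (rule weak_deriv_unique_AE[OF \<omega>(1)])
    show "has_weak_deriv \<omega> [c] (\<lambda>x. first_form \<omega> \<psi> x $ a $ b) (?D \<psi> c a b)"
      by (rule first_form_weak_deriv[OF \<omega> \<psi>(1) M])
    show "has_weak_deriv \<omega> [c] (\<lambda>x. first_form \<omega> \<psi> x $ a $ b) (?D \<psi>' c a b)"
      using iso by (intro has_weak_deriv_cong_AE[OF \<omega>(1) first_form_weak_deriv[OF \<omega> \<psi>(2) M']]) (auto elim!: eventually_mono)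
  qed
  then have "AE x in lebesgue_on \<omega>. \<forall>a b c. ?D \<psi>' c a b x = ?D \<psi> c a b x" by (simp add: AE_all_countable)
  with second_weak_derivs_symmetric[OF \<omega>(1) \<psi>(1)] second_weak_derivs_symmetric[OF \<omega>(1) \<psi>(2)]
  show ?thesis
  proof eventually_elim
    case (elim x)
    \<comment> \<open>The derivatives of the metric are expanded by the product rule; symmetry of the second derivatives cancels four of the six terms.\<close>
    have chr: "2 * (weak_deriv_vec \<omega> [i, j] \<rho> x \<bullet> weak_deriv_vec \<omega> [k] \<rho> x) = ?D \<rho> i j k x + ?D \<rho> j i k x - ?D \<rho> k i j x"
      if "\<forall>i j. weak_deriv_vec \<omega> [i, j] \<rho> x = weak_deriv_vec \<omega> [j, i] \<rho> x" for \<rho> :: "real^2 \<Rightarrow> real^3" and i j k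
      using that[rule_format, of k i] that[rule_format, of k j] that[rule_format, of j i] by (simp add: inner_commute)
    show ?case
    proof (intro allI)
      fix i j k
      show "weak_deriv_vec \<omega> [i, j] \<psi>' x \<bullet> weak_deriv_vec \<omega> [k] \<psi>' x
          = weak_deriv_vec \<omega> [i, j] \<psi> x \<bullet> weak_deriv_vec \<omega> [k] \<psi> x"
        using chr[OF elim(1), of i j k] chr[OF elim(2), of i j k] elim(3) by simp
    qed
  qed
qed

section \<open>Symmetric matrices and the Gauss frame\<close>

lemma sym_pos_def_2:
  fixes A :: "real^2^2"
  shows "sym_pos_def A \<longleftrightarrow> A $ 1 $ 2 = A $ 2 $ 1 \<and> A $ 1 $ 1 > 0 \<and> A $ 1 $ 1 * A $ 2 $ 2 - A $ 1 $ 2 * A $ 2 $ 1 > 0"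
proof -
  have sym: "transpose A = A \<longleftrightarrow> A $ 1 $ 2 = A $ 2 $ 1"
    by (auto simp: transpose_def vec_eq_iff forall_2)
  have q: "v \<bullet> (A *v v) = A $ 1 $ 1 * (v $ 1)\<^sup>2 + 2 * A $ 1 $ 2 * v $ 1 * v $ 2 + A $ 2 $ 2 * (v $ 2)\<^sup>2"
    if "A $ 1 $ 2 = A $ 2 $ 1" for v
    by (simp add: inner_vec_def matrix_vector_mult_def sum_2 that power2_eq_square algebra_simps)
  show ?thesis
  proof
    assume spd: "sym_pos_def A"
    then have s: "A $ 1 $ 2 = A $ 2 $ 1" using sym by (simp add: sym_pos_def_def)
    have pos: "v \<noteq> 0 \<Longrightarrow> A $ 1 $ 1 * (v $ 1)\<^sup>2 + 2 * A $ 1 $ 2 * v $ 1 * v $ 2 + A $ 2 $ 2 * (v $ 2)\<^sup>2 > 0" for v :: "real^2"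
      using spd q[OF s] by (simp add: sym_pos_def_def)
    have p: "A $ 1 $ 1 > 0" using pos[of "axis 1 1"] by (simp add: axis_def vec_eq_iff forall_2)
    have "vector [A $ 1 $ 2, - A $ 1 $ 1] \<noteq> (0 :: real^2)" using p by (simp add: vec_eq_iff forall_2 vector_2)
    from pos[OF this] have "A $ 1 $ 1 * (A $ 1 $ 1 * A $ 2 $ 2 - A $ 1 $ 2 * A $ 1 $ 2) > 0"
      by (simp add: vector_2 power2_eq_square algebra_simps)
    then show "A $ 1 $ 2 = A $ 2 $ 1 \<and> A $ 1 $ 1 > 0 \<and> A $ 1 $ 1 * A $ 2 $ 2 - A $ 1 $ 2 * A $ 2 $ 1 > 0"
      using p s by (simp add: zero_less_mult_iff)
  next
    assume *: "A $ 1 $ 2 = A $ 2 $ 1 \<and> A $ 1 $ 1 > 0 \<and> A $ 1 $ 1 * A $ 2 $ 2 - A $ 1 $ 2 * A $ 2 $ 1 > 0"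
    then have s: "A $ 1 $ 2 = A $ 2 $ 1" by simp
    have "v \<bullet> (A *v v) > 0" if "v \<noteq> 0" for v
    proof -
      have eq: "A $ 1 $ 1 * (v \<bullet> (A *v v)) = (A $ 1 $ 1 * v $ 1 + A $ 1 $ 2 * v $ 2)\<^sup>2
          + (A $ 1 $ 1 * A $ 2 $ 2 - A $ 1 $ 2 * A $ 2 $ 1) * (v $ 2)\<^sup>2"
        unfolding q[OF s] using s by (simp add: power2_eq_square algebra_simps)
      have "A $ 1 $ 1 * (v \<bullet> (A *v v)) > 0"
      proof (cases "v $ 2 = 0")
        case True
        then have "v $ 1 \<noteq> 0" using that by (auto simp: vec_eq_iff forall_2)
        then show ?thesis unfolding eq using * True by simp
      next
        case False
        then have "(A $ 1 $ 1 * A $ 2 $ 2 - A $ 1 $ 2 * A $ 2 $ 1) * (v $ 2)\<^sup>2 > 0"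
            by (intro mult_pos_pos) (use * in auto)
        then show ?thesis unfolding eq by (rule add_nonneg_pos[rotated]) simp
      qed
      then show ?thesis using * by (simp add: zero_less_mult_iff)
    qed
    then show "sym_pos_def A" using s sym by (simp add: sym_pos_def_def)
  qed
qed

text \<open>By the Cayley-Hamilton theorem, a positive root \<open>R\<close> of \<open>A\<close> satisfies \<open>tr R * R = A + det R * I\<close>, where
  \<open>det R = sqrt (det A)\<close> and \<open>tr R = sqrt (tr A + 2 det R)\<close>. So \<open>R\<close> is determined by \<open>A\<close>, and the
  formula also defines a root.\<close>

lemma ex1_spd_sqrt_2:
  fixes A :: "real^2^2"
  assumes A: "sym_pos_def A"
  shows "\<exists>!R. sym_pos_def R \<and> R ** R = A"
proof -
  define p q r where "p = A $ 1 $ 1" and "q = A $ 1 $ 2" and "r = A $ 2 $ 2"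
  have A_eq: "A $ 2 $ 1 = q" and p: "p > 0" and d: "p * r - q * q > 0"
    using A by (auto simp: sym_pos_def_2 p_def q_def r_def)
  have "p * r > 0" using d zero_le_square[of q] by linarith
  then have r: "r > 0" using p by (simp add: zero_less_mult_iff)
  define s where "s = sqrt (p * r - q * q)"
  have s: "s > 0" "s * s = p * r - q * q" using d by (simp_all add: s_def)
  define t where "t = sqrt (p + r + 2 * s)"
  have t: "t > 0" "t * t = p + r + 2 * s" using p r s by (simp_all add: t_def)
  define R :: "real^2^2" where "R = vector [vector [(p + s) / t, q / t], vector [q / t, (r + s) / t]]"
  have R: "R $ 1 $ 1 = (p + s) / t" "R $ 1 $ 2 = q / t" "R $ 2 $ 1 = q / t" "R $ 2 $ 2 = (r + s) / t"
    by (simp_all add: R_def vector_2)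
  have tt: "x / t * (y / t) = x * y / (p + r + 2 * s)" for x y using t by simp
  have ps: "p + r + 2 * s \<noteq> 0" using p r s by simp
  have R_det: "R $ 1 $ 1 * R $ 2 $ 2 - R $ 1 $ 2 * R $ 2 $ 1 = s"
  proof -
    have "(p + s) * (r + s) - q * q = s * (p + r + 2 * s)" using s(2) by (simp add: algebra_simps)
    then show ?thesis unfolding R tt using ps by (simp add: diff_divide_distrib[symmetric])
  qed
  have "sym_pos_def R" unfolding sym_pos_def_2 R_det using p s t by (simp add: R)
  moreover have "R ** R = A"
  proof -
    have e: "(p + s) * (p + s) + q * q = p * (p + r + 2 * s)" "(p + s) * q + q * (r + s) = q * (p + r + 2 * s)"
      "q * (p + s) + (r + s) * q = q * (p + r + 2 * s)" "q * q + (r + s) * (r + s) = r * (p + r + 2 * s)"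
      using s(2) by (simp_all add: algebra_simps)
    show ?thesis
      using ps by (simp add: t(2) vec_eq_iff forall_2 matrix_matrix_mult_def sum_2 R tt add_divide_distrib[symmetric] e A_eq
          p_def[symmetric] q_def[symmetric] r_def[symmetric])
  qed
  moreover have "R' = R" if R': "sym_pos_def R' \<and> R' ** R' = A" for R'
  proof -
    define a b c where "a = R' $ 1 $ 1" and "b = R' $ 1 $ 2" and "c = R' $ 2 $ 2"
    have b: "R' $ 2 $ 1 = b" and a: "a > 0" and d': "a * c - b * b > 0"
      using R' by (auto simp: sym_pos_def_2 a_def b_def c_def)
    have "a * c > 0" using d' zero_le_square[of b] by linarith
    then have c: "c > 0" using a by (simp add: zero_less_mult_iff)
    have sq: "a * a + b * b = p" "a * b + b * c = q" "b * b + c * c = r"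
      using R' b by (auto simp: vec_eq_iff forall_2 matrix_matrix_mult_def sum_2 a_def b_def c_def p_def q_def r_def)
    have "(a * c - b * b)\<^sup>2 = p * r - q * q" unfolding sq[symmetric] by (simp add: power2_eq_square algebra_simps)
    then have s': "s = a * c - b * b" unfolding s_def using d' by (metis less_imp_le real_sqrt_unique)
    have "(a + c)\<^sup>2 = p + r + 2 * s" unfolding sq[symmetric] s' by (simp add: power2_eq_square algebra_simps)
    then have t': "t = a + c" unfolding t_def using a c by (metis add_nonneg_nonneg less_imp_le real_sqrt_unique)
    have "a = (p + s) / t" "b = q / t" "c = (r + s) / t"
      using a c unfolding t' s' sq[symmetric] by (simp_all add: field_simps)
    then show "R' = R" using b by (simp add: vec_eq_iff forall_2 R a_def[symmetric] b_def[symmetric] c_def[symmetric])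
  qed
  ultimately show ?thesis by blast
qed

lemma spd_sqrt_2:
  fixes A :: "real^2^2"
  assumes "sym_pos_def A" shows "sym_pos_def (spd_sqrt A)" "spd_sqrt A ** spd_sqrt A = A"
  using theI'[OF ex1_spd_sqrt_2[OF assms]] by (simp_all add: spd_sqrt_def)

lemma matrix_inv_unique:
  fixes A B :: "real^'n^'n"
  assumes "A ** B = mat 1" "B ** A = mat 1" shows "matrix_inv A = B"
  unfolding matrix_inv_def
proof (rule some_equality)
  fix B' assume "A ** B' = mat 1 \<and> B' ** A = mat 1"
  then have "B' = B' ** (A ** B)" by (simp add: assms)
  also have "\<dots> = B" using \<open>A ** B' = mat 1 \<and> B' ** A = mat 1\<close> by (simp add: matrix_mul_assoc)
  finally show "B' = B" .
qed (use assms in simp)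

lemma matrix_inv_2:
  fixes g :: "real^2^2"
  assumes "det g \<noteq> 0"
  shows "matrix_inv g = vector [vector [g $ 2 $ 2 / det g, - g $ 1 $ 2 / det g], vector [- g $ 2 $ 1 / det g, g $ 1 $ 1 / det g]]" (is "_ = ?J")
proof (rule matrix_inv_unique)
  define D where "D = det g"
  have D: "D = g $ 1 $ 1 * g $ 2 $ 2 - g $ 1 $ 2 * g $ 2 $ 1" "D \<noteq> 0" using assms by (simp_all add: D_def det_2)
  show "g ** ?J = mat 1" "?J ** g = mat 1"
    unfolding D_def[symmetric] using D
    by (simp_all add: vec_eq_iff forall_2 matrix_matrix_mult_def sum_2 mat_def vector_2 diff_divide_distrib[symmetric] mult.commute)
qed

lemma trace_product_4:
  fixes J X K Y :: "real^'n^'n"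
  shows "trace (J ** X ** K ** Y) = (\<Sum>i\<in>UNIV. \<Sum>l\<in>UNIV. \<Sum>k\<in>UNIV. \<Sum>j\<in>UNIV. J $ i $ j * X $ j $ k * K $ k $ l * Y $ l $ i)"
  by (simp add: trace_def matrix_matrix_mult_def sum_distrib_right)

lemma inner_matrix_eq_trace:
  fixes X Y :: "real^'n^'n"
  shows "X \<bullet> Y = trace (transpose X ** Y)"
  by (simp add: trace_def matrix_matrix_mult_def transpose_def inner_vec_def) (rule sum.swap)

text \<open>Cyclicity of the trace brings the two outer factors \<open>R\<close> together, so that only \<open>R ** R\<close> remains;
  applied to the inverse square root, this eliminates the root altogether.\<close>

lemma norm_sandwich_eq_trace:
  fixes R H :: "real^'n^'n"
  assumes "transpose R = R" "transpose H = H"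
  shows "(norm (R ** H ** R))\<^sup>2 = trace (R ** R ** H ** (R ** R) ** H)"
proof -
  have "(norm (R ** H ** R))\<^sup>2 = trace (transpose (R ** H ** R) ** (R ** H ** R))"
    by (simp add: power2_norm_eq_inner inner_matrix_eq_trace)
  also have "\<dots> = trace (R ** (H ** R ** R ** H ** R))"
    using assms by (simp add: matrix_transpose_mul matrix_mul_assoc)
  also have "\<dots> = trace ((H ** R ** R ** H ** R) ** R)" by (rule trace_mul_sym)
  also have "\<dots> = trace (H ** (R ** R ** H ** R ** R))" by (simp add: matrix_mul_assoc)
  also have "\<dots> = trace ((R ** R ** H ** R ** R) ** H)" by (rule trace_mul_sym)
  finally show ?thesis by (simp add: matrix_mul_assoc)
qed

lemma matrix_mult_diff_left: "A ** (B - C) = A ** B - A ** C"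
  and matrix_mult_diff_right: "(B - C) ** D = B ** D - C ** D"
  for A B C D :: "real^'n^'n"
  by (simp_all add: matrix_matrix_mult_def vec_eq_iff sum_subtractf algebra_simps)

lemma trace_difference_square:
  fixes J A B :: "real^'n^'n"
  assumes J: "transpose J = J" and B: "transpose B = B"
  shows "trace ((J ** (A - B)) ** (J ** (A - B)))
    = trace (J ** A ** J ** A) - 2 * (B \<bullet> (J ** A ** J)) + trace (J ** B ** J ** B)"
proof -
  have "trace ((J ** (A - B)) ** (J ** (A - B))) = trace (J ** A ** (J ** A)) - trace (J ** A ** (J ** B))
      - trace (J ** B ** (J ** A)) + trace (J ** B ** (J ** B))"
    by (simp add: matrix_mult_diff_left matrix_mult_diff_right trace_sub)
  moreover have "trace (J ** B ** (J ** A)) = trace (J ** A ** (J ** B))" by (rule trace_mul_sym)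
  moreover have "B \<bullet> (J ** A ** J) = trace (J ** A ** (J ** B))"
    using B trace_mul_sym[of B "J ** A ** J"] by (simp add: inner_matrix_eq_trace matrix_mul_assoc)
  ultimately show ?thesis by (simp add: matrix_mul_assoc)
qed

lemma gram_cross3:
  fixes u v :: "real^3"
  shows "(norm (cross3 u v))\<^sup>2 = (u \<bullet> u) * (v \<bullet> v) - (u \<bullet> v) * (u \<bullet> v)"
  by (simp add: power2_norm_eq_inner inner_vec_def sum_3 cross3_def vector_3) algebra

text \<open>The expansion of the inner product in the frame formed by \<open>u\<close>, \<open>v\<close> and their cross product,
  multiplied by the Gram determinant to make it a polynomial identity.\<close>

lemma inner_in_frame:
  fixes u v x y :: "real^3"
  shows "(norm (cross3 u v))\<^sup>2 * (x \<bullet> y) = (x \<bullet> cross3 u v) * (y \<bullet> cross3 u v)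
    + (v \<bullet> v) * (x \<bullet> u) * (y \<bullet> u) - (u \<bullet> v) * (x \<bullet> u) * (y \<bullet> v) - (u \<bullet> v) * (x \<bullet> v) * (y \<bullet> u) + (u \<bullet> u) * (x \<bullet> v) * (y \<bullet> v)"
  unfolding gram_cross3 by (simp add: inner_vec_def sum_3 cross3_def vector_3) algebra

text \<open>For symmetric \<open>V\<close>, if \<open>t j k a\<close> is the inner product of the vector \<open>V j k\<close> with the \<open>a\<close>-th tangent vector and \<open>J\<close> is the
  inverse metric, this is the squared norm, in the metric, of the tangential part of \<open>V\<close>.\<close>

definition tangential_energy :: "real^2^2 \<Rightarrow> (2 \<Rightarrow> 2 \<Rightarrow> 2 \<Rightarrow> real) \<Rightarrow> real" where
  "tangential_energy J t = (\<Sum>i\<in>UNIV. \<Sum>l\<in>UNIV. \<Sum>k\<in>UNIV. \<Sum>j\<in>UNIV. J $ i $ j * J $ k $ l *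
     (\<Sum>a\<in>UNIV. \<Sum>b\<in>UNIV. J $ a $ b * t j k a * t l i b))"

text \<open>Summing over the components \<open>m\<close> yields inner products of the vectors \<open>V j k\<close> and \<open>V l i\<close>; each of them
  splits into a normal part, which is a product of entries of the second fundamental form, and
  a tangential part.\<close>

lemma hessian_trace_decomposition:
  fixes V :: "2 \<Rightarrow> 2 \<Rightarrow> real^3" and W :: "2 \<Rightarrow> real^3" and g :: "real^2^2"
  assumes g: "\<And>a b. g $ a $ b = W a \<bullet> W b" and "det g > 0"
  defines "J \<equiv> matrix_inv g" and "n \<equiv> cross3 (W 1) (W 2) /\<^sub>R norm (cross3 (W 1) (W 2))"
  defines "B \<equiv> (- (\<chi> i j. V i j \<bullet> n)) :: real^2^2" and "H \<equiv> (\<lambda>m. \<chi> i j. V i j $ m) :: 3 \<Rightarrow> real^2^2"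
  shows "(\<Sum>m\<in>UNIV. trace (J ** H m ** J ** H m)) = trace (J ** B ** J ** B) + tangential_energy J (\<lambda>i j k. V i j \<bullet> W k)"
proof -
  have det: "det g = (norm (cross3 (W 1) (W 2)))\<^sup>2"
    by (simp add: gram_cross3 det_2 g inner_commute)
  have J: "J $ 1 $ 1 = W 2 \<bullet> W 2 / det g" "J $ 1 $ 2 = - (W 1 \<bullet> W 2) / det g"
    "J $ 2 $ 1 = - (W 1 \<bullet> W 2) / det g" "J $ 2 $ 2 = W 1 \<bullet> W 1 / det g"
    unfolding J_def using \<open>det g > 0\<close> by (simp_all add: matrix_inv_2 vector_2 g inner_commute)
  have frame: "x \<bullet> y = (x \<bullet> n) * (y \<bullet> n) + (\<Sum>a\<in>UNIV. \<Sum>b\<in>UNIV. J $ a $ b * (x \<bullet> W a) * (y \<bullet> W b))" for x y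
  proof -
    have n: "(x \<bullet> n) * (y \<bullet> n) = (x \<bullet> cross3 (W 1) (W 2)) * (y \<bullet> cross3 (W 1) (W 2)) / det g"
      by (simp add: n_def det power2_eq_square divide_inverse)
    have "x \<bullet> y = (det g * (x \<bullet> y)) / det g" using \<open>det g > 0\<close> by simp
    also have "\<dots> = (x \<bullet> n) * (y \<bullet> n) + (\<Sum>a\<in>UNIV. \<Sum>b\<in>UNIV. J $ a $ b * (x \<bullet> W a) * (y \<bullet> W b))"
      unfolding det inner_in_frame n sum_2 J by (simp add: det[symmetric] add_divide_distrib diff_divide_distrib algebra_simps)
    finally show ?thesis .
  qed
  have "(\<Sum>m\<in>UNIV. trace (J ** H m ** J ** H m)) =
      (\<Sum>i\<in>UNIV. \<Sum>l\<in>UNIV. \<Sum>k\<in>UNIV. \<Sum>j\<in>UNIV. J $ i $ j * J $ k $ l * (V j k \<bullet> V l i))"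
    by (simp add: trace_product_4 H_def sum_2 sum_3 inner_vec_def algebra_simps)
  also have "\<dots> = trace (J ** B ** J ** B) + tangential_energy J (\<lambda>i j k. V i j \<bullet> W k)"
    unfolding trace_product_4 tangential_energy_def frame[of "V _ _" "V _ _"] distrib_left sum.distrib
    by (simp add: B_def mult.assoc mult.left_commute)
  finally show ?thesis .
qed

section \<open>Integrability and the energy identity\<close>

lemma integrable_lebesgue_on_AE:
  fixes f g :: "'a::euclidean_space \<Rightarrow> real"
  assumes "S \<in> sets lebesgue" "integrable (lebesgue_on S) f" "AE x in lebesgue_on S. f x = g x"
  shows "integrable (lebesgue_on S) g"
  using integrable_cong_AE_imp[OF assms(2) borel_measurable_lebesgue_on_AE[OF assms(1) _ assms(3)] assms(3)] assms(2) by simp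

text \<open>Every integrand of the theorem other than the load has this shape: products of two square integrable
  functions with bounded weights.\<close>

lemma integrable_weighted_trace:
  fixes J X Y :: "real^'n \<Rightarrow> real^2^2"
  assumes J: "\<And>i j. (\<lambda>x. J x $ i $ j) \<in> borel_measurable (lebesgue_on \<omega>)" "AE x in lebesgue_on \<omega>. \<forall>i j. \<bar>J x $ i $ j\<bar> \<le> C"
    and s: "s \<in> borel_measurable (lebesgue_on \<omega>)" "AE x in lebesgue_on \<omega>. \<bar>s x\<bar> \<le> C'"
    and XY: "\<And>i j. L2 \<omega> (\<lambda>x. X x $ i $ j)" "\<And>i j. L2 \<omega> (\<lambda>x. Y x $ i $ j)"
  shows "integrable (lebesgue_on \<omega>) (\<lambda>x. s x * trace (J x ** X x ** J x ** Y x))"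
proof -
  have "integrable (lebesgue_on \<omega>) (\<lambda>x. s x * (J x $ i $ j * X x $ j $ k * J x $ k $ l * Y x $ l $ i))" for i j k l
  proof -
    have bd: "AE x in lebesgue_on \<omega>. \<bar>s x * (J x $ i $ j * J x $ k $ l)\<bar> \<le> C' * (C * C)"
      using J(2) s(2)
    proof eventually_elim
      case (elim x)
      have "\<bar>J x $ i $ j\<bar> \<le> C" "\<bar>J x $ k $ l\<bar> \<le> C" using elim(1) by auto
      then show ?case unfolding abs_mult using elim(2) by (intro mult_mono) auto
    qed
    have "(\<lambda>x. s x * (J x $ i $ j * J x $ k $ l)) \<in> borel_measurable (lebesgue_on \<omega>)"
      by (intro borel_measurable_times s J)
    from integrable_mult_AE_bounded[OF L2_mult_integrable[OF XY] this bd]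
    show ?thesis by (simp add: mult_ac)
  qed
  then show ?thesis unfolding trace_product_4 sum_distrib_left by (intro Bochner_Integration.integrable_sum)
qed

lemma borel_measurable_vec:
  fixes f :: "'a \<Rightarrow> real^'n"
  assumes "\<And>i. (\<lambda>x. f x $ i) \<in> borel_measurable M" shows "f \<in> borel_measurable M"
  by (subst borel_measurable_euclidean_space) (use assms in \<open>auto simp: Basis_vec_def inner_axis\<close>)

lemma hessian_L2:
  assumes "open \<omega>" "sobolev_H 2 \<omega> \<psi>" shows "L2 \<omega> (\<lambda>x. hessian \<omega> \<psi> m x $ i $ j)"
  using sobolev_weak_deriv(2)[OF assms, of "[i, j]" m] by (simp add: hessian_def)

lemma weak_deriv_vec_measurable:
  assumes "open \<omega>" "sobolev_H k \<omega> \<psi>" "length \<beta> \<le> k"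
  shows "(\<lambda>x. weak_deriv_vec \<omega> \<beta> \<psi> x $ m) \<in> borel_measurable (lebesgue_on \<omega>)"
    and "weak_deriv_vec \<omega> \<beta> \<psi> \<in> borel_measurable (lebesgue_on \<omega>)"
proof -
  show c: "(\<lambda>x. weak_deriv_vec \<omega> \<beta> \<psi> x $ m) \<in> borel_measurable (lebesgue_on \<omega>)" for m
    using sobolev_weak_deriv(2)[OF assms] by (simp add: L2_def)
  show "weak_deriv_vec \<omega> \<beta> \<psi> \<in> borel_measurable (lebesgue_on \<omega>)" by (rule borel_measurable_vec[OF c])
qed

lemma unit_normal_measurable:
  assumes "open \<omega>" "sobolev_H k \<omega> \<psi>" "k \<ge> 1"
  shows "unit_normal \<omega> \<psi> \<in> borel_measurable (lebesgue_on \<omega>)"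
proof -
  have [measurable]: "(\<lambda>x. weak_deriv_vec \<omega> [a] \<psi> x $ m) \<in> borel_measurable (lebesgue_on \<omega>)" for a m
    using assms by (intro weak_deriv_vec_measurable(1)) auto
  have "(\<lambda>x. cross3 (weak_deriv_vec \<omega> [1] \<psi> x) (weak_deriv_vec \<omega> [2] \<psi> x) $ m) \<in> borel_measurable (lebesgue_on \<omega>)" for m
    using exhaust_3[of m] by (auto simp: cross_components)
  then have [measurable]: "(\<lambda>x. cross3 (weak_deriv_vec \<omega> [1] \<psi> x) (weak_deriv_vec \<omega> [2] \<psi> x)) \<in> borel_measurable (lebesgue_on \<omega>)"
    by (rule borel_measurable_vec)
  show ?thesis unfolding unit_normal_def[abs_def] Let_def by measurable
qed

text \<open>Taking the inner product with the unit normal does not increase the norm. Where the cross product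
  vanishes the normal has the default value \<open>0\<close>, which does no harm to this bound.\<close>

lemma second_form_L2:
  assumes "open \<omega>" "sobolev_H 2 \<omega> \<psi>" shows "L2 \<omega> (\<lambda>x. second_form \<omega> \<psi> x $ i $ j)"
proof -
  let ?V = "weak_deriv_vec \<omega> [i, j] \<psi>"
  have [measurable]: "?V \<in> borel_measurable (lebesgue_on \<omega>)" "unit_normal \<omega> \<psi> \<in> borel_measurable (lebesgue_on \<omega>)"
    using assms by (auto intro!: weak_deriv_vec_measurable(2) unit_normal_measurable)
  have eq: "second_form \<omega> \<psi> x $ i $ j = - (?V x \<bullet> unit_normal \<omega> \<psi> x)" for x by (simp add: second_form_def)
  have "integrable (lebesgue_on \<omega>) (\<lambda>x. (norm (second_form \<omega> \<psi> x $ i $ j))\<^sup>2)"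
  proof (rule Bochner_Integration.integrable_bound)
    show "integrable (lebesgue_on \<omega>) (\<lambda>x. \<Sum>m\<in>UNIV. ?V x $ m * ?V x $ m)"
      by (intro Bochner_Integration.integrable_sum L2_mult_integrable sobolev_weak_deriv(2)[OF assms]) simp_all
    show "AE x in lebesgue_on \<omega>. norm ((norm (second_form \<omega> \<psi> x $ i $ j))\<^sup>2) \<le> norm (\<Sum>m\<in>UNIV. ?V x $ m * ?V x $ m)"
    proof (rule AE_I2)
      fix x
      have "norm (v /\<^sub>R norm v) \<le> 1" for v :: "real^3" by (cases "v = 0") simp_all
      then have "norm (unit_normal \<omega> \<psi> x) \<le> 1" unfolding unit_normal_def Let_def .
      then have "\<bar>?V x \<bullet> unit_normal \<omega> \<psi> x\<bar> \<le> norm (?V x)"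
        using Cauchy_Schwarz_ineq2[of "?V x" "unit_normal \<omega> \<psi> x"] mult_left_le[of "norm (unit_normal \<omega> \<psi> x)" "norm (?V x)"]
        by simp
      then have "\<bar>?V x \<bullet> unit_normal \<omega> \<psi> x\<bar>\<^sup>2 \<le> (norm (?V x))\<^sup>2" by (intro power_mono) auto
      also have "(norm (?V x))\<^sup>2 = (\<Sum>m\<in>UNIV. ?V x $ m * ?V x $ m)"
        by (simp add: power2_norm_eq_inner inner_vec_def)
      finally show "norm ((norm (second_form \<omega> \<psi> x $ i $ j))\<^sup>2) \<le> norm (\<Sum>m\<in>UNIV. ?V x $ m * ?V x $ m)"
        by (simp add: eq)
    qed
  qed (simp add: eq)
  then show ?thesis by (simp add: L2_def eq)
qed

lemma sym_pos_def_matrix_inv_2: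
  fixes g :: "real^2^2"
  assumes "sym_pos_def g" shows "sym_pos_def (matrix_inv g)"
proof -
  define D where "D = det g"
  have g: "g $ 1 $ 2 = g $ 2 $ 1" "g $ 1 $ 1 > 0" and D: "D > 0" "D = g $ 1 $ 1 * g $ 2 $ 2 - g $ 2 $ 1 * g $ 2 $ 1"
    using assms by (auto simp: sym_pos_def_2 D_def det_2)
  have "g $ 1 $ 1 * g $ 2 $ 2 > 0" using D zero_le_square[of "g $ 2 $ 1"] by linarith
  then have "g $ 2 $ 2 > 0" using g by (simp add: zero_less_mult_iff)
  moreover have "g $ 2 $ 2 / D * (g $ 1 $ 1 / D) - g $ 2 $ 1 / D * (g $ 2 $ 1 / D) = 1 / D"
    using D by (simp add: diff_divide_distrib[symmetric] mult.commute)
  ultimately show ?thesis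
    using g D(1) by (simp add: sym_pos_def_2 matrix_inv_2 vector_2 D_def[symmetric])
qed

lemma inv_sqrt_2:
  fixes g :: "real^2^2"
  assumes "sym_pos_def g"
  shows "transpose (inv_sqrt g) = inv_sqrt g" "inv_sqrt g ** inv_sqrt g = matrix_inv g"
  using spd_sqrt_2[OF sym_pos_def_matrix_inv_2[OF assms]] by (simp_all add: inv_sqrt_def sym_pos_def_def)

lemma first_form_sym_pos_def:
  assumes "det (first_form \<omega> \<psi> x) > 0" shows "sym_pos_def (first_form \<omega> \<psi> x)"
proof -
  have d: "first_form \<omega> \<psi> x $ 1 $ 1 * first_form \<omega> \<psi> x $ 2 $ 2 - first_form \<omega> \<psi> x $ 1 $ 2 * first_form \<omega> \<psi> x $ 2 $ 1 > 0"
    and s: "first_form \<omega> \<psi> x $ 1 $ 2 = first_form \<omega> \<psi> x $ 2 $ 1"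
    using assms by (simp_all add: det_2 first_form_nth inner_commute)
  have "first_form \<omega> \<psi> x $ 1 $ 1 \<noteq> 0" using d s by (auto simp: not_less)
  then have "first_form \<omega> \<psi> x $ 1 $ 1 > 0" by (simp add: first_form_nth)
  with d s show ?thesis by (simp add: sym_pos_def_2)
qed

text \<open>The Hessian energy as a sum of traces serves for integrability, and its splitting into a normal
  and a tangential part for the comparison of two isometric parametrizations.\<close>

lemma hessian_energy_decomposition:
  assumes sym: "\<forall>i j. weak_deriv_vec \<omega> [i, j] \<psi> x = weak_deriv_vec \<omega> [j, i] \<psi> x"
    and g: "first_form \<omega> \<psi> x = g" and det: "det g > 0"
  shows "(\<Sum>m\<in>UNIV. (norm (inv_sqrt g ** hessian \<omega> \<psi> m x ** inv_sqrt g))\<^sup>2)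
      = (\<Sum>m\<in>UNIV. trace (matrix_inv g ** hessian \<omega> \<psi> m x ** matrix_inv g ** hessian \<omega> \<psi> m x))"
    and "(\<Sum>m\<in>UNIV. (norm (inv_sqrt g ** hessian \<omega> \<psi> m x ** inv_sqrt g))\<^sup>2)
      = trace (matrix_inv g ** second_form \<omega> \<psi> x ** matrix_inv g ** second_form \<omega> \<psi> x)
        + tangential_energy (matrix_inv g) (\<lambda>i j k. weak_deriv_vec \<omega> [i, j] \<psi> x \<bullet> weak_deriv_vec \<omega> [k] \<psi> x)"
proof -
  have spd: "sym_pos_def g" using first_form_sym_pos_def[of \<omega> \<psi> x] det g by simp
  have H: "transpose (hessian \<omega> \<psi> m x) = hessian \<omega> \<psi> m x" for m
    using sym by (simp add: hessian_def transpose_def vec_eq_iff)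
  show 1: "(\<Sum>m\<in>UNIV. (norm (inv_sqrt g ** hessian \<omega> \<psi> m x ** inv_sqrt g))\<^sup>2)
      = (\<Sum>m\<in>UNIV. trace (matrix_inv g ** hessian \<omega> \<psi> m x ** matrix_inv g ** hessian \<omega> \<psi> m x))"
    by (simp add: norm_sandwich_eq_trace[OF inv_sqrt_2(1)[OF spd] H] inv_sqrt_2(2)[OF spd])
  show "(\<Sum>m\<in>UNIV. (norm (inv_sqrt g ** hessian \<omega> \<psi> m x ** inv_sqrt g))\<^sup>2)
      = trace (matrix_inv g ** second_form \<omega> \<psi> x ** matrix_inv g ** second_form \<omega> \<psi> x)
        + tangential_energy (matrix_inv g) (\<lambda>i j k. weak_deriv_vec \<omega> [i, j] \<psi> x \<bullet> weak_deriv_vec \<omega> [k] \<psi> x)"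
    unfolding 1 unfolding hessian_def second_form_def unit_normal_def Let_def
    by (rule hessian_trace_decomposition) (use det g in \<open>auto simp: first_form_nth\<close>)
qed

lemma second_form_symmetric:
  assumes "\<forall>i j. weak_deriv_vec \<omega> [i, j] \<psi> x = weak_deriv_vec \<omega> [j, i] \<psi> x"
  shows "transpose (second_form \<omega> \<psi> x) = second_form \<omega> \<psi> x"
proof -
  have "transpose (second_form \<omega> \<psi> x) $ i $ j = second_form \<omega> \<psi> x $ i $ j" for i j
    using assms[rule_format, of i j] by (simp add: second_form_def transpose_def)
  then show ?thesis by (simp add: vec_eq_iff)
qed

lemma sobolev_H_mono: "sobolev_H k \<omega> \<psi> \<Longrightarrow> l \<le> k \<Longrightarrow> sobolev_H l \<omega> \<psi>"
  by (auto simp: sobolev_H_def)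

theorem corollary2p2:
  fixes \<omega> :: "(real^2) set" and \<alpha> :: real
    and \<psi>A f :: "real^2 \<Rightarrow> real^3"
  assumes "bounded_lipschitz_domain \<omega>"
    and "sobolev_H 3 \<omega> \<psi>A" and "injective_regular \<omega> \<psi>A"
    and "L2 \<omega> f" and "\<alpha> > 0"
  shows "\<exists>C::real. \<forall>\<psi>B :: real^2 \<Rightarrow> real^3.
     sobolev_H 2 \<omega> \<psi>B \<and>
     (AE x in lebesgue_on \<omega>. first_form \<omega> \<psi>B x = first_form \<omega> \<psi>A x) \<longrightarrow>
     free_energy \<omega> \<alpha> f \<psi>A \<psi>B =
       \<alpha> / 2 * (LINT x|lebesgue_on \<omega>. sqrt (det (first_form \<omega> \<psi>A x)) *
          ((\<Sum>m\<in>UNIV. (norm (inv_sqrt (first_form \<omega> \<psi>A x) ** hessian \<omega> \<psi>B m x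
                ** inv_sqrt (first_form \<omega> \<psi>A x)))\<^sup>2)
           - 2 * (second_form \<omega> \<psi>B x \<bullet>
               (matrix_inv (first_form \<omega> \<psi>A x) ** second_form \<omega> \<psi>A x
                ** matrix_inv (first_form \<omega> \<psi>A x)))))
       - (LINT x|lebesgue_on \<omega>. sqrt (det (first_form \<omega> \<psi>A x)) * (f x \<bullet> \<psi>B x))
       + C"
proof -
  have \<omega>: "open \<omega>" "bounded \<omega>" and \<omega>': "\<omega> \<in> sets lebesgue"
    using assms(1) by (auto simp: bounded_lipschitz_domain_def)
  have A: "sobolev_H 2 \<omega> \<psi>A" using assms(2) by (rule sobolev_H_mono) simp
  define g where "g = first_form \<omega> \<psi>A"
  define J where "J x = matrix_inv (g x)" for x
  define s where "s x = sqrt (det (g x))" for x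
  let ?IA = "second_form \<omega> \<psi>A" and ?R = "\<lambda>x. inv_sqrt (g x)"
  let ?N = "\<lambda>\<psi> x. \<Sum>m\<in>UNIV. (norm (?R x ** hessian \<omega> \<psi> m x ** ?R x))\<^sup>2"
  let ?F = "\<lambda>\<psi> x. s x * (?N \<psi> x - 2 * (second_form \<omega> \<psi> x \<bullet> (J x ** ?IA x ** J x)))"
  obtain M \<delta> where \<delta>: "\<delta> > 0"
    and bounds: "AE x in lebesgue_on \<omega>. (\<forall>a. norm (weak_deriv_vec \<omega> [a] \<psi>A x) \<le> M) \<and> \<delta> \<le> det (g x)"
    using regular_bounds[OF \<omega> assms(2) _ assms(3)] unfolding g_def by auto
  have M: "AE x in lebesgue_on \<omega>. \<forall>a. norm (weak_deriv_vec \<omega> [a] \<psi>A x) \<le> M"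
    using bounds by eventually_elim simp
  have g_bd: "AE x in lebesgue_on \<omega>. (\<forall>a b. \<bar>g x $ a $ b\<bar> \<le> M * M) \<and> \<delta> \<le> det (g x)"
    using bounds
  proof eventually_elim
    case (elim x)
    have "\<bar>g x $ a $ b\<bar> \<le> M * M" for a b
    proof -
      have "\<bar>g x $ a $ b\<bar> \<le> norm (weak_deriv_vec \<omega> [a] \<psi>A x) * norm (weak_deriv_vec \<omega> [b] \<psi>A x)"
        unfolding g_def first_form_nth by (rule Cauchy_Schwarz_ineq2)
      also have "\<dots> \<le> M * M" using elim by (intro mult_mono) (auto intro: order_trans[OF norm_ge_zero])
      finally show ?thesis .
    qed
    with elim show ?case by simp
  qed
  have g_meas [measurable]: "(\<lambda>x. g x $ a $ b) \<in> borel_measurable (lebesgue_on \<omega>)" for a b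
    unfolding g_def first_form_nth using weak_deriv_vec_measurable(2)[OF \<omega>(1) A] by (intro borel_measurable_inner) auto
  have det_meas [measurable]: "(\<lambda>x. det (g x)) \<in> borel_measurable (lebesgue_on \<omega>)"
    unfolding det_2 by measurable
  have s_meas: "s \<in> borel_measurable (lebesgue_on \<omega>)" unfolding s_def[abs_def] by measurable
  have s_bd: "AE x in lebesgue_on \<omega>. \<bar>s x\<bar> \<le> sqrt (2 * ((M * M) * (M * M)))"
    using g_bd
  proof eventually_elim
    case (elim x)
    have le: "\<bar>g x $ a $ b * g x $ c $ d\<bar> \<le> (M * M) * (M * M)" for a b c d
      unfolding abs_mult using elim by (intro mult_mono) auto
    have "det (g x) \<le> 2 * ((M * M) * (M * M))"
      unfolding det_2 using le[of 1 1 2 2] le[of 1 2 2 1] by linarith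
    then show ?case using elim \<delta> by (simp add: s_def)
  qed
  have J_eq: "AE x in lebesgue_on \<omega>. vector [vector [g x $ 2 $ 2 / det (g x), - g x $ 1 $ 2 / det (g x)],
      vector [- g x $ 2 $ 1 / det (g x), g x $ 1 $ 1 / det (g x)]] = J x"
    using g_bd by eventually_elim (use \<delta> in \<open>simp add: J_def matrix_inv_2\<close>)
  have J_meas: "(\<lambda>x. J x $ i $ j) \<in> borel_measurable (lebesgue_on \<omega>)" for i j
  proof (rule borel_measurable_lebesgue_on_AE[OF \<omega>'])
    show "AE x in lebesgue_on \<omega>. (vector [vector [g x $ 2 $ 2 / det (g x), - g x $ 1 $ 2 / det (g x)],
      vector [- g x $ 2 $ 1 / det (g x), g x $ 1 $ 1 / det (g x)]] :: real^2^2) $ i $ j = J x $ i $ j"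
      using J_eq by eventually_elim simp
    show "(\<lambda>x. (vector [vector [g x $ 2 $ 2 / det (g x), - g x $ 1 $ 2 / det (g x)],
      vector [- g x $ 2 $ 1 / det (g x), g x $ 1 $ 1 / det (g x)]] :: real^2^2) $ i $ j) \<in> borel_measurable (lebesgue_on \<omega>)"
      using exhaust_2[of i] exhaust_2[of j] by (auto simp: vector_2)
  qed
  have J_bd: "AE x in lebesgue_on \<omega>. \<forall>i j. \<bar>J x $ i $ j\<bar> \<le> M * M / \<delta>"
    using g_bd J_eq
  proof eventually_elim
    case (elim x)
    have "\<bar>g x $ a $ b / det (g x)\<bar> \<le> M * M / \<delta>" for a b
      using elim(1) \<delta> by (simp add: abs_divide) (intro frac_le, auto)
    then show ?case unfolding elim(2)[symmetric] by (simp add: forall_2 vector_2)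
  qed
  note weighted = integrable_weighted_trace[OF J_meas J_bd s_meas s_bd]
  have sym_A: "AE x in lebesgue_on \<omega>. \<forall>i j. weak_deriv_vec \<omega> [i, j] \<psi>A x = weak_deriv_vec \<omega> [j, i] \<psi>A x"
    by (rule second_weak_derivs_symmetric[OF \<omega>(1) A])
  have N_int: "integrable (lebesgue_on \<omega>) (\<lambda>x. s x * ?N \<psi> x)"
    if \<psi>: "sobolev_H 2 \<omega> \<psi>" and iso: "AE x in lebesgue_on \<omega>. first_form \<omega> \<psi> x = g x" for \<psi>
  proof (rule integrable_lebesgue_on_AE[OF \<omega>'])
    show "integrable (lebesgue_on \<omega>) (\<lambda>x. \<Sum>m\<in>UNIV. s x * trace (J x ** hessian \<omega> \<psi> m x ** J x ** hessian \<omega> \<psi> m x))"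
      by (intro Bochner_Integration.integrable_sum weighted hessian_L2[OF \<omega>(1) \<psi>])
    show "AE x in lebesgue_on \<omega>. (\<Sum>m\<in>UNIV. s x * trace (J x ** hessian \<omega> \<psi> m x ** J x ** hessian \<omega> \<psi> m x)) = s x * ?N \<psi> x"
      using second_weak_derivs_symmetric[OF \<omega>(1) \<psi>] iso g_bd
    proof eventually_elim
      case (elim x)
      then show ?case using \<delta> by (simp add: hessian_energy_decomposition(1)[of \<omega> \<psi> x "g x"] J_def sum_distrib_left)
    qed
  qed
  \<comment> \<open>The density of the constant: by the Hessian decomposition of \<open>\<psi>A\<close>, up to the area element it equals the squared norm of \<open>II\<^sub>A\<close> minus the tangential energy.\<close>
  define c where "c x = s x * (2 * trace (J x ** ?IA x ** J x ** ?IA x) - ?N \<psi>A x)" for x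
  have c_int: "integrable (lebesgue_on \<omega>) c"
  proof -
    have "integrable (lebesgue_on \<omega>) (\<lambda>x. 2 * (s x * trace (J x ** ?IA x ** J x ** ?IA x)) - s x * ?N \<psi>A x)"
      using weighted[OF second_form_L2[OF \<omega>(1) A] second_form_L2[OF \<omega>(1) A]] N_int[OF A]
      by (intro Bochner_Integration.integrable_diff integrable_mult_right) (auto simp: g_def)
    then show ?thesis by (simp add: c_def[abs_def] algebra_simps)
  qed
  show ?thesis
  proof (intro exI[of _ "\<alpha> / 2 * integral\<^sup>L (lebesgue_on \<omega>) c"] allI impI, elim conjE)
    fix \<psi>B :: "real^2 \<Rightarrow> real^3"
    assume B: "sobolev_H 2 \<omega> \<psi>B" and iso: "AE x in lebesgue_on \<omega>. first_form \<omega> \<psi>B x = first_form \<omega> \<psi>A x"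
    let ?IB = "second_form \<omega> \<psi>B"
    have sym_B: "AE x in lebesgue_on \<omega>. \<forall>i j. weak_deriv_vec \<omega> [i, j] \<psi>B x = weak_deriv_vec \<omega> [j, i] \<psi>B x"
      by (rule second_weak_derivs_symmetric[OF \<omega>(1) B])
    have isog: "AE x in lebesgue_on \<omega>. first_form \<omega> \<psi>B x = g x" using iso by (simp add: g_def)
    \<comment> \<open>Writing the mixed term as a trace brings it into the form covered by the integrability lemma.\<close>
    have inner_eq: "AE x in lebesgue_on \<omega>. s x * trace (J x ** ?IA x ** J x ** ?IB x) = s x * (?IB x \<bullet> (J x ** ?IA x ** J x))"
      using sym_B
    proof eventually_elim
      case (elim x)
      show ?case
        using trace_mul_sym[of "?IB x" "J x ** ?IA x ** J x"] second_form_symmetric[OF elim]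
        by (simp add: inner_matrix_eq_trace)
    qed
    have F_int: "integrable (lebesgue_on \<omega>) (?F \<psi>B)"
    proof -
      have "integrable (lebesgue_on \<omega>) (\<lambda>x. s x * (?IB x \<bullet> (J x ** ?IA x ** J x)))"
        by (rule integrable_lebesgue_on_AE[OF \<omega>' weighted[OF second_form_L2[OF \<omega>(1) A] second_form_L2[OF \<omega>(1) B]] inner_eq])
      then have "integrable (lebesgue_on \<omega>) (\<lambda>x. s x * ?N \<psi>B x - 2 * (s x * (?IB x \<bullet> (J x ** ?IA x ** J x))))"
        using N_int[OF B isog] by (intro Bochner_Integration.integrable_diff integrable_mult_right)
      then show ?thesis by (simp add: algebra_simps)
    qed
    have Fc_int: "integrable (lebesgue_on \<omega>) (\<lambda>x. ?F \<psi>B x + c x)"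
      using F_int c_int by (rule Bochner_Integration.integrable_add)
    have density: "AE x in lebesgue_on \<omega>. ?F \<psi>B x + c x = s x * trace (rel_shape \<omega> \<psi>A \<psi>B x ** rel_shape \<omega> \<psi>A \<psi>B x)"
      using sym_A sym_B isog g_bd tangential_parts_determined[OF \<omega> A B M iso]
    proof eventually_elim
      case (elim x)
      have det: "det (g x) > 0" using elim(4) \<delta> by simp
      have gA: "first_form \<omega> \<psi>A x = g x" by (simp add: g_def)
      have J: "transpose (J x) = J x"
        using sym_pos_def_matrix_inv_2[OF first_form_sym_pos_def[of \<omega> \<psi>A x]] det by (simp add: J_def g_def sym_pos_def_def)
      \<comment> \<open>The tangential energies of both parametrizations agree and drop out of the difference.\<close>
      have "?N \<psi>B x - ?N \<psi>A x = trace (J x ** ?IB x ** J x ** ?IB x) - trace (J x ** ?IA x ** J x ** ?IA x)"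
        using hessian_energy_decomposition(2)[OF elim(1) gA det] hessian_energy_decomposition(2)[OF elim(2) elim(3) det] elim(5)
        by (simp add: J_def)
      moreover have "trace (rel_shape \<omega> \<psi>A \<psi>B x ** rel_shape \<omega> \<psi>A \<psi>B x) = trace (J x ** ?IA x ** J x ** ?IA x)
          - 2 * (?IB x \<bullet> (J x ** ?IA x ** J x)) + trace (J x ** ?IB x ** J x ** ?IB x)"
        using trace_difference_square[OF J second_form_symmetric[OF elim(2)]] by (simp add: rel_shape_def J_def g_def)
      ultimately have "?N \<psi>B x - 2 * (?IB x \<bullet> (J x ** ?IA x ** J x)) + (2 * trace (J x ** ?IA x ** J x ** ?IA x) - ?N \<psi>A x)
          = trace (rel_shape \<omega> \<psi>A \<psi>B x ** rel_shape \<omega> \<psi>A \<psi>B x)" by linarith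
      then show ?case unfolding c_def distrib_left[symmetric] by (rule arg_cong)
    qed
    have "(LINT x|lebesgue_on \<omega>. s x * trace (rel_shape \<omega> \<psi>A \<psi>B x ** rel_shape \<omega> \<psi>A \<psi>B x)) = (LINT x|lebesgue_on \<omega>. ?F \<psi>B x + c x)"
      using integrable_lebesgue_on_AE[OF \<omega>' Fc_int density] Fc_int density
      by (intro integral_cong_AE) (auto elim!: eventually_mono)
    also have "\<dots> = integral\<^sup>L (lebesgue_on \<omega>) (?F \<psi>B) + integral\<^sup>L (lebesgue_on \<omega>) c"
      using F_int c_int by (rule Bochner_Integration.integral_add)
    finally show "free_energy \<omega> \<alpha> f \<psi>A \<psi>B =
       \<alpha> / 2 * (LINT x|lebesgue_on \<omega>. sqrt (det (first_form \<omega> \<psi>A x)) *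
          ((\<Sum>m\<in>UNIV. (norm (inv_sqrt (first_form \<omega> \<psi>A x) ** hessian \<omega> \<psi>B m x
                ** inv_sqrt (first_form \<omega> \<psi>A x)))\<^sup>2)
           - 2 * (second_form \<omega> \<psi>B x \<bullet>
               (matrix_inv (first_form \<omega> \<psi>A x) ** second_form \<omega> \<psi>A x
                ** matrix_inv (first_form \<omega> \<psi>A x)))))
       - (LINT x|lebesgue_on \<omega>. sqrt (det (first_form \<omega> \<psi>A x)) * (f x \<bullet> \<psi>B x))
       + \<alpha> / 2 * integral\<^sup>L (lebesgue_on \<omega>) c"
      unfolding free_energy_def s_def J_def g_def by (simp add: distrib_left)
  qed
qed

end
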